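(* Let $n\ge 1$, let $M^n$ be Euclidean, spherical or hyperbolic $n$-space, let $\mathbf{A}=\{A_1,\dots,A_{n+2}\}\subset M^n$ be the vertex set of a degenerate $(n+1)$-simplex all of whose $n$-faces are non-degenerate, let $\alpha=\{\alpha_1,\dots,\alpha_{n+2}\}$ be a $1$-stress on $\mathbf{A}$, and let $1\le k\le n$. Let $\mathbf{A}(t)=\{A_1(t),\dots,A_{n+2}(t)\}$, $t\ge 0$, be a smooth motion in $M^n$ with $\mathbf{A}(0)=\mathbf{A}$. If the motion satisfies the volume constraints of $G_{n,k}$, or if it satisfies the volume constraints of $G'_{n,k}$, then it preserves the volumes of all $k$-faces of $\mathbf{A}(t)$ for small $t\ge 0$; that is, there is $\varepsilon>0$ such that for every $k$-face the $k$-dimensional volume of that face of $\mathbf{A}(t)$ is constant on $[0,\varepsilon)$.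
   Context: Spaces: $M^n$ is $\mathbb{R}^n$, or the unit sphere $\mathbb{S}^n\subset\mathbb{R}^{n+1}$, or $\mathbb{H}^n=\{x\in\mathbb{R}^{n,1}: x\cdot x=-1,\ x_0>0\}$, where $\mathbb{R}^{n,1}$ is $\mathbb{R}^{n+1}$ with $x\cdot y=-x_0y_0+x_1y_1+\cdots+x_ny_n$. Points of $\mathbb{S}^n$ and $\mathbb{H}^n$ are regarded as vectors of the ambient vector space. Setting: all $n$-faces of $\mathbf{A}$ being non-degenerate means that any $n+1$ of the points are affinely independent (Euclidean case), resp. linearly independent (non-Euclidean case). A $1$-stress $\alpha$ on $\mathbf{A}$ is the sequence of non-zero real coefficients, unique up to a constant factor, with $\sum\alpha_iA_i=0$ and $\sum\alpha_i=0$ (Euclidean case), or $\sum\alpha_iA_i=0$ (spherical or hyperbolic case). A $k$-face $F$ of $\mathbf{A}$ is the $k$-simplex spanned by $k+1$ of the vertices; the corresponding face of $\mathbf{A}(t)$ is spanned by the corresponding moved vertices. Constraints: $G_{n,k}$ imposes the following constraints on the motion: the volume of a $k$-face $F$ may only decrease (be non-increasing in $t$) if $\prod_{A_s\in F}\alpha_s<0$, and may only increase (be non-decreasing in $t$) if $\prod_{A_s\in F}\alpha_s>0$. $G'_{n,k}$ imposes the constraints with "decrease" and "increase" interchanged. *)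

theory Defs
  imports
    "HOL-Analysis.Analysis"
    "Jordan_Normal_Form.Determinant"
begin

section \<open>The three model spaces\<close>

text \<open>
  With \<open>n = CARD('n)\<close>, Euclidean n-space is \<^typ>\<open>real ^ 'n\<close>, and the ambient space of the
  other two geometries is \<^typ>\<open>real \<times> (real ^ 'n)\<close>; its first component is the coordinate
  \<open>x\<^sub>0\<close>. The library norm on the product type is the Euclidean norm of \<open>\<real>\<^sup>n\<^sup>+\<^sup>1\<close>, so the unit sphere
  \<open>S\<^sup>n\<close> is \<open>sphere 0 1 :: (real \<times> (real ^ 'n)) set\<close>.
\<close>

definition lorentz :: "real \<times> (real ^ 'n::finite) \<Rightarrow> real \<times> (real ^ 'n) \<Rightarrow> real" where
  "lorentz x y = - (fst x * fst y) + snd x \<bullet> snd y"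

definition hyperbolic_space :: "(real \<times> (real ^ 'n::finite)) set" where
  "hyperbolic_space = {x. lorentz x x = -1 \<and> 0 < fst x}"


section \<open>Volumes of simplices\<close>

text \<open>
  The volume of a k-simplex is its Riemannian volume: the integral of the square root of the
  Gram determinant of the partial derivatives of a parametrization \<open>\<Phi>\<close> by a subset of \<open>\<real>\<^sup>k\<close>, where
  \<open>B\<close> is the bilinear form of the ambient space that induces the metric. Points of \<open>\<real>\<^sup>k\<close> are
  represented as functions on \<open>{..<k}\<close>, with Lebesgue measure the product measure.
\<close>

definition std_simplex :: "nat \<Rightarrow> (nat \<Rightarrow> real) set" where
  "std_simplex k = {x \<in> {..<k} \<rightarrow>\<^sub>E UNIV. (\<forall>i<k. 0 \<le> x i) \<and> (\<Sum>i<k. x i) \<le> 1}"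

definition partial_deriv ::
  "((nat \<Rightarrow> real) \<Rightarrow> 'v::real_normed_vector) \<Rightarrow> nat \<Rightarrow> (nat \<Rightarrow> real) \<Rightarrow> 'v" where
  "partial_deriv \<Phi> i x = vector_derivative (\<lambda>s. \<Phi> (x(i := s))) (at (x i))"

definition parametrized_volume ::
  "('v::real_normed_vector \<Rightarrow> 'v \<Rightarrow> real) \<Rightarrow> nat \<Rightarrow> (nat \<Rightarrow> real) set
    \<Rightarrow> ((nat \<Rightarrow> real) \<Rightarrow> 'v) \<Rightarrow> real" where
  "parametrized_volume B k U \<Phi> =
    (LINT x:U | Pi\<^sub>M {..<k} (\<lambda>_. lborel).
       sqrt (Determinant.det (Matrix.mat k k
         (\<lambda>(i, j). B (partial_deriv \<Phi> i x) (partial_deriv \<Phi> j x)))))"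

definition affine_param :: "nat \<Rightarrow> (nat \<Rightarrow> 'v::real_vector) \<Rightarrow> (nat \<Rightarrow> real) \<Rightarrow> 'v" where
  "affine_param k v x = (1 - (\<Sum>i<k. x i)) *\<^sub>R v 0 + (\<Sum>i<k. x i *\<^sub>R v (Suc i))"

text \<open>
  A spherical or hyperbolic simplex is the radial projection onto \<open>S\<^sup>n\<close> or \<open>H\<^sup>n\<close> of the affine
  simplex with the same vertices in the ambient vector space.
\<close>

definition sphere_proj :: "real \<times> (real ^ 'n::finite) \<Rightarrow> real \<times> (real ^ 'n)" where
  "sphere_proj y = y /\<^sub>R norm y"

definition hyperbolic_proj :: "real \<times> (real ^ 'n::finite) \<Rightarrow> real \<times> (real ^ 'n)" where
  "hyperbolic_proj y = y /\<^sub>R sqrt (- lorentz y y)"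

text \<open>The simplex has the vertices \<open>v 0, \<dots>, v k\<close>.\<close>

definition euclidean_simplex_volume :: "nat \<Rightarrow> (nat \<Rightarrow> real ^ 'n::finite) \<Rightarrow> real" where
  "euclidean_simplex_volume k v =
    parametrized_volume inner k (std_simplex k) (affine_param k v)"

definition spherical_simplex_volume :: "nat \<Rightarrow> (nat \<Rightarrow> real \<times> (real ^ 'n::finite)) \<Rightarrow> real" where
  "spherical_simplex_volume k v =
    parametrized_volume inner k (std_simplex k) (\<lambda>x. sphere_proj (affine_param k v x))"

definition hyperbolic_simplex_volume :: "nat \<Rightarrow> (nat \<Rightarrow> real \<times> (real ^ 'n::finite)) \<Rightarrow> real" where
  "hyperbolic_simplex_volume k v =
    parametrized_volume lorentz k (std_simplex k) (\<lambda>x. hyperbolic_proj (affine_param k v x))"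


section \<open>Point configurations, stresses and motions\<close>

text \<open>
  A configuration of \<open>n + 2\<close> points is a family indexed by \<open>{1..n + 2}\<close>, and a k-face is given by
  the set of the indices of its vertices. The vertices are listed by increasing index; the volume
  does not depend on this order.
\<close>

definition faces :: "nat \<Rightarrow> nat \<Rightarrow> nat set set" where
  "faces n k = {F. F \<subseteq> {1..n + 2} \<and> card F = k + 1}"

definition face_vertices :: "(nat \<Rightarrow> 'v) \<Rightarrow> nat set \<Rightarrow> nat \<Rightarrow> 'v" where
  "face_vertices A F j = A (sorted_list_of_set F ! j)"

definition affinely_nondegenerate_faces :: "nat \<Rightarrow> (nat \<Rightarrow> 'v::real_vector) \<Rightarrow> bool" where
  "affinely_nondegenerate_faces n A \<longleftrightarrow>
    (\<forall>F \<in> faces n n. inj_on A F \<and> \<not> affine_dependent (A ` F))"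

definition linearly_nondegenerate_faces :: "nat \<Rightarrow> (nat \<Rightarrow> 'v::real_vector) \<Rightarrow> bool" where
  "linearly_nondegenerate_faces n A \<longleftrightarrow>
    (\<forall>F \<in> faces n n. inj_on A F \<and> independent (A ` F))"

definition linear_stress :: "nat \<Rightarrow> (nat \<Rightarrow> real) \<Rightarrow> (nat \<Rightarrow> 'v::real_vector) \<Rightarrow> bool" where
  "linear_stress n \<alpha> A \<longleftrightarrow>
    (\<forall>i \<in> {1..n + 2}. \<alpha> i \<noteq> 0) \<and> (\<Sum>i = 1..n + 2. \<alpha> i *\<^sub>R A i) = 0"

definition affine_stress :: "nat \<Rightarrow> (nat \<Rightarrow> real) \<Rightarrow> (nat \<Rightarrow> 'v::real_vector) \<Rightarrow> bool" where
  "affine_stress n \<alpha> A \<longleftrightarrow> linear_stress n \<alpha> A \<and> (\<Sum>i = 1..n + 2. \<alpha> i) = 0"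

text \<open>\<open>D m\<close> is the m-th derivative of the curve on \<open>[0, \<infinity>)\<close>, one-sided at \<open>0\<close>.\<close>

definition smooth_curve :: "(real \<Rightarrow> 'v::real_normed_vector) \<Rightarrow> bool" where
  "smooth_curve c \<longleftrightarrow>
    (\<exists>D. D 0 = c \<and>
      (\<forall>m. \<forall>t \<ge> 0. (D m has_vector_derivative D (Suc m) t) (at t within {0..})))"

definition smooth_motion ::
  "nat \<Rightarrow> 'v::real_normed_vector set \<Rightarrow> (nat \<Rightarrow> 'v) \<Rightarrow> (real \<Rightarrow> nat \<Rightarrow> 'v) \<Rightarrow> bool" where
  "smooth_motion n M A P \<longleftrightarrow>
    (\<forall>i \<in> {1..n + 2}. P 0 i = A i \<and> smooth_curve (\<lambda>t. P t i) \<and> (\<forall>t \<ge> 0. P t i \<in> M))"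


section \<open>Volume constraints\<close>

text \<open>\<open>vol t F\<close> stands for the volume of the face \<open>F\<close> at time \<open>t\<close>.\<close>

definition G_constraints ::
  "nat \<Rightarrow> nat \<Rightarrow> (nat \<Rightarrow> real) \<Rightarrow> (real \<Rightarrow> nat set \<Rightarrow> real) \<Rightarrow> bool" where
  "G_constraints n k \<alpha> vol \<longleftrightarrow>
    (\<forall>F \<in> faces n k.
      ((\<Prod>s\<in>F. \<alpha> s) < 0 \<longrightarrow> antimono_on {0..} (\<lambda>t. vol t F)) \<and>
      ((\<Prod>s\<in>F. \<alpha> s) > 0 \<longrightarrow> mono_on {0..} (\<lambda>t. vol t F)))"

definition G'_constraints ::
  "nat \<Rightarrow> nat \<Rightarrow> (nat \<Rightarrow> real) \<Rightarrow> (real \<Rightarrow> nat set \<Rightarrow> real) \<Rightarrow> bool" where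
  "G'_constraints n k \<alpha> vol \<longleftrightarrow>
    (\<forall>F \<in> faces n k.
      ((\<Prod>s\<in>F. \<alpha> s) < 0 \<longrightarrow> mono_on {0..} (\<lambda>t. vol t F)) \<and>
      ((\<Prod>s\<in>F. \<alpha> s) > 0 \<longrightarrow> antimono_on {0..} (\<lambda>t. vol t F)))"

definition preserves_volumes_initially ::
  "nat \<Rightarrow> nat \<Rightarrow> (real \<Rightarrow> nat set \<Rightarrow> real) \<Rightarrow> bool" where
  "preserves_volumes_initially n k vol \<longleftrightarrow>
    (\<exists>\<epsilon>>0. \<forall>F \<in> faces n k. (\<lambda>t. vol t F) constant_on {0..<\<epsilon>})"

end

theory Submission
  imports Defs
begin

text \<open>
  As long as the points \<open>A\<^sub>i(t)\<close> stay in a space of dimension n they carry a 1-stress \<open>a(t)\<close>, whose signs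
  agree with those of \<open>\<alpha>\<close> for small t. If the face F moves, its volume changes through the motion of its
  facets E along the outer normals, and the normal of E in \<open>E \<union> {i}\<close> is the component of \<open>A\<^sub>i\<close> orthogonal
  to E, up to a factor \<open>det G\<^sub>E / det G\<^sub>F\<close> under the square root (G: Gram matrices). Weighting the faces with
  \<open>\<Prod>s\<in>F. a\<^sub>s\<close> times \<open>\<surd>det G\<^sub>F\<close>, the contributions at each E add up to the component orthogonal to E of
  \<open>\<Sum>i. a\<^sub>i A\<^sub>i = 0\<close>. So a weighted sum of the derivatives of the volumes vanishes. Under the
  constraints all terms have the same sign, and hence every derivative is zero.

  The first variation of a spherical or hyperbolic volume is obtained without integrating over the boundary
  of a curved simplex: the volume is \<open>\<surd>det G\<^sub>F\<close> times the integral over the orthant of a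
  function of the quadratic form of \<open>G\<^sub>F\<close>, where integration by parts is one-dimensional.
\<close>

section \<open>Determinants indexed by finite sets\<close>

text \<open>Two obstacles shape the proof: the volume of a curved simplex has no elementary formula,
  and the form of hyperbolic space is indefinite. A sign \<sigma>, 1 on the sphere and -1 in
  hyperbolic space, treats both alike: \<sigma> times the Gram determinant is positive for faces
  with at most n + 1 vertices, and \<sigma> times the form is positive on nonzero nonnegative
  combinations of the vertices of a k-face. The form is homogeneous along rays, so integrating a
  fixed profile of it over the orthant gives the volume up to known factors, and the profile may
  have bounded support. The boundary terms are first moments over the facet E, which do not see the
  opposite vertex; hence the sum over faces can be regrouped by facets. Euclidean volume does not
  arise by radial projection. There the points are lifted to the heights 1 and 2: the stress stays a
  linear relation because its coefficients sum to zero, the difference of the two Gram determinants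
  gives the squared volume up to a constant, and the cancellation is used once per height. The
  constraints refer to the stress at time 0, the identity to the one at time t; only their signs
  connect them.\<close>

definition gdet :: "'i set \<Rightarrow> ('i \<Rightarrow> 'i \<Rightarrow> real) \<Rightarrow> real" where
  "gdet F M = (\<Sum>p | p permutes F. of_int (sign p) * (\<Prod>i\<in>F. M i (p i)))"

text \<open>The cofactor matrix. Replacing a row by a unit vector avoids the signs of the Laplace expansion,
  which would need an order on the index set.\<close>

definition gcof :: "'i set \<Rightarrow> ('i \<Rightarrow> 'i \<Rightarrow> real) \<Rightarrow> 'i \<Rightarrow> 'i \<Rightarrow> real" where
  "gcof F M i l = gdet F (M(i := (\<lambda>j. of_bool (j = l))))"

lemma gdet_cong:
  assumes "\<And>i j. i \<in> F \<Longrightarrow> j \<in> F \<Longrightarrow> M i j = N i j"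
  shows "gdet F M = gdet F N"
  unfolding gdet_def
  by (intro sum.cong refl arg_cong2[where f="(*)"] prod.cong) (auto simp: assms permutes_in_image)

lemma gdet_empty [simp]: "gdet {} M = 1"
  by (simp add: gdet_def)

lemma prod_row_replaced:
  assumes "finite F" "i \<in> F"
  shows "(\<Prod>j\<in>F. (M(i := v)) j (p j)) = v (p i) * (\<Prod>j\<in>F - {i}. M j (p j))"
  using assms by (subst prod.remove[of F i]) (auto intro!: prod.cong)

lemma gdet_row:
  assumes "finite F" "i \<in> F"
  shows "gdet F (M(i := v)) = (\<Sum>l\<in>F. gcof F M i l * v l)"
proof -
  have "(\<Sum>l\<in>F. gcof F M i l * v l) =
      (\<Sum>p | p permutes F. \<Sum>l\<in>F. of_int (sign p) * (of_bool (p i = l) * (\<Prod>j\<in>F - {i}. M j (p j))) * v l)"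
    unfolding gcof_def gdet_def prod_row_replaced[OF assms] sum_distrib_right by (rule sum.swap)
  also have "\<dots> = (\<Sum>p | p permutes F. of_int (sign p) * (v (p i) * (\<Prod>j\<in>F - {i}. M j (p j))))"
  proof (rule sum.cong[OF refl])
    fix p assume "p \<in> {p. p permutes F}"
    then have "p i \<in> F" using assms by (auto simp: permutes_in_image)
    then show "(\<Sum>l\<in>F. of_int (sign p) * (of_bool (p i = l) * (\<Prod>j\<in>F - {i}. M j (p j))) * v l) =
        of_int (sign p) * (v (p i) * (\<Prod>j\<in>F - {i}. M j (p j)))"
      using assms by (subst sum.remove[of F "p i"]) (auto intro!: sum.neutral)
  qed
  finally show ?thesis unfolding gdet_def prod_row_replaced[OF assms] by simp
qed

text \<open>Composing a permutation with the transposition of i and j flips its sign and keeps its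
  product, so the determinant equals its own negative.\<close>

lemma gdet_identical_rows:
  assumes F: "finite F" "i \<in> F" "j \<in> F" and ij: "i \<noteq> j" and eq: "\<And>l. l \<in> F \<Longrightarrow> M i l = M j l"
  shows "gdet F M = 0"
proof -
  let ?t = "Transposition.transpose i j"
  have t: "?t permutes F" using F by (simp add: permutes_swap_id)
  have "gdet F M = (\<Sum>p | p permutes F. of_int (sign (p \<circ> ?t)) * (\<Prod>x\<in>F. M x ((p \<circ> ?t) x)))"
    unfolding gdet_def by (rule sum_permutations_compose_right[OF t])
  also have "\<dots> = (\<Sum>p | p permutes F. - (of_int (sign p) * (\<Prod>x\<in>F. M x (p x))))"
  proof (rule sum.cong[OF refl])
    fix p assume "p \<in> {p. p permutes F}"
    then have p: "p permutes F" by simp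
    have "sign (p \<circ> ?t) = - sign p"
      using ij sign_compose[of p ?t] permutation_permutes p F(1)
      by (auto simp: permutation_swap_id sign_swap_id)
    moreover have "(\<Prod>x\<in>F. M x ((p \<circ> ?t) x)) = (\<Prod>x\<in>F. M (?t x) ((p \<circ> ?t) x))"
    proof (rule prod.cong[OF refl])
      fix x assume x: "x \<in> F"
      have "p (?t x) \<in> F" using x p t by (simp add: permutes_in_image)
      then show "M x ((p \<circ> ?t) x) = M (?t x) ((p \<circ> ?t) x)"
        using eq[of "p (?t x)"] by (auto simp: Transposition.transpose_def)
    qed
    moreover have "\<dots> = (\<Prod>x\<in>F. M x (p x))"
      using prod.permute[OF t, of "\<lambda>x. M x (p x)"] by (simp add: o_def)
    ultimately show "of_int (sign (p \<circ> ?t)) * (\<Prod>x\<in>F. M x ((p \<circ> ?t) x)) =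
        - (of_int (sign p) * (\<Prod>x\<in>F. M x (p x)))" by simp
  qed
  also have "\<dots> = - gdet F M" by (simp add: gdet_def sum_negf)
  finally show ?thesis by simp
qed

text \<open>Off the diagonal the sum expands a determinant whose row i has been overwritten by row
  j.\<close>

lemma gcof_mult_row:
  assumes "finite F" "i \<in> F" "j \<in> F"
  shows "(\<Sum>l\<in>F. gcof F M i l * M j l) = (if i = j then gdet F M else 0)"
proof (cases "i = j")
  case True
  then show ?thesis using gdet_row[OF assms(1,2), of M "M i"] by simp
next
  case False
  have "gdet F (M(i := M j)) = 0"
    by (rule gdet_identical_rows[OF assms False]) (use False in auto)
  then show ?thesis using gdet_row[OF assms(1,2), of M "M j"] False by simp
qed

lemma gdet_transpose:
  assumes "finite F"
  shows "gdet F (\<lambda>i j. M j i) = gdet F M"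
proof -
  have "gdet F (\<lambda>i j. M j i) = (\<Sum>p | p permutes F. of_int (sign (inv_into UNIV p)) * (\<Prod>i\<in>F. M (inv_into UNIV p i) i))"
    unfolding gdet_def by (rule sum_permutations_inverse)
  also have "\<dots> = gdet F M"
    unfolding gdet_def
  proof (rule sum.cong[OF refl])
    fix p assume "p \<in> {p. p permutes F}"
    then have p: "p permutes F" by simp
    have "sign (inv_into UNIV p) = sign p"
      using p assms by (metis permutation_permutes sign_inverse)
    moreover have "(\<Prod>i\<in>F. M (inv_into UNIV p i) i) = (\<Prod>i\<in>F. M i (p i))"
      using prod.permute[OF p, of "\<lambda>i. M (inv_into UNIV p i) i"] p by (simp add: o_def permutes_inverses)
    ultimately show "of_int (sign (inv_into UNIV p)) * (\<Prod>i\<in>F. M (inv_into UNIV p i) i) = of_int (sign p) * (\<Prod>i\<in>F. M i (p i))"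
      by simp
  qed
  finally show ?thesis .
qed

lemma gcof_eq:
  assumes "finite F" "i \<in> F"
  shows "gcof F M i l =
    (\<Sum>p | p permutes F. of_int (sign p) * (of_bool (p i = l) * (\<Prod>j\<in>F - {i}. M j (p j))))"
  unfolding gcof_def gdet_def prod_row_replaced[OF assms] ..

text \<open>Inverting the permutation turns p i = l into p l = i, and the symmetry of M matches the
  remaining factors.\<close>

lemma gcof_sym:
  assumes F: "finite F" "i \<in> F" "l \<in> F" and sym: "\<And>i j. i \<in> F \<Longrightarrow> j \<in> F \<Longrightarrow> M i j = M j i"
  shows "gcof F M i l = gcof F M l i"
proof -
  have "gcof F M i l = (\<Sum>p | p permutes F. of_int (sign (inv_into UNIV p)) *
      (of_bool (inv_into UNIV p i = l) * (\<Prod>j\<in>F - {i}. M j (inv_into UNIV p j))))"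
    unfolding gcof_eq[OF F(1,2)] by (rule sum_permutations_inverse)
  also have "\<dots> = gcof F M l i"
    unfolding gcof_eq[OF F(1,3)]
  proof (rule sum.cong[OF refl])
    fix p assume "p \<in> {p. p permutes F}"
    then have p: "p permutes F" by simp
    have "sign (inv_into UNIV p) = sign p"
      using p F by (metis permutation_permutes sign_inverse)
    moreover have iff: "inv_into UNIV p i = l \<longleftrightarrow> p l = i"
      using p by (metis permutes_inverses)
    moreover have "(\<Prod>j\<in>F - {i}. M j (inv_into UNIV p j)) = (\<Prod>j\<in>F - {l}. M j (p j))" if "p l = i"
    proof (rule prod.reindex_bij_witness[of _ p "inv_into UNIV p"])
      fix a assume "a \<in> F - {i}"
      then show "p (inv_into UNIV p a) = a" "inv_into UNIV p a \<in> F - {l}"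
        using p that by (auto simp: permutes_inverses permutes_in_image permutes_inv)
    next
      fix b assume b: "b \<in> F - {l}"
      then show "inv_into UNIV p (p b) = b" using p by (auto simp: permutes_inverses)
      have "p b \<noteq> i" using b that p by (metis DiffD2 insertI1 permutes_inverses(2))
      then show "p b \<in> F - {i}" using b p by (auto simp: permutes_in_image)
    next
      fix a assume a: "a \<in> F - {i}"
      then have "inv_into UNIV p a \<in> F" using p by (auto simp: permutes_in_image permutes_inv)
      then show "M (inv_into UNIV p a) (p (inv_into UNIV p a)) = M a (inv_into UNIV p a)" using sym a p by (auto simp: permutes_inverses)
    qed
    ultimately show "of_int (sign (inv_into UNIV p)) * (of_bool (inv_into UNIV p i = l) * (\<Prod>j\<in>F - {i}. M j (inv_into UNIV p j))) =
      of_int (sign p) * (of_bool (p l = i) * (\<Prod>j\<in>F - {l}. M j (p j)))" by auto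
  qed
  finally show ?thesis .
qed

text \<open>The unit row leaves only the permutations that fix i. For a Gram matrix the diagonal
  cofactor is therefore the determinant of the opposite facet, in which the vertex i no longer
  occurs.\<close>

lemma gcof_insert_self:
  assumes "finite E" "i \<notin> E"
  shows "gcof (insert i E) M i i = gdet E M"
proof -
  have "gcof (insert i E) M i i =
      (\<Sum>p | p permutes (insert i E). of_int (sign p) * (of_bool (p i = i) * (\<Prod>j\<in>E. M j (p j))))"
    using assms by (subst gcof_eq) auto
  also have "\<dots> = (\<Sum>p | p permutes E. of_int (sign p) * (of_bool (p i = i) * (\<Prod>j\<in>E. M j (p j))))"
  proof (rule sum.mono_neutral_right)
    show "finite {p. p permutes (insert i E)}" using assms by (simp add: finite_permutations)
    show "{p. p permutes E} \<subseteq> {p. p permutes (insert i E)}" by (auto intro: permutes_subset)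
    have "p permutes E" if "p permutes (insert i E)" "p i = i" for p
      using permutes_superset[OF that(1), of E] that(2) by auto
    then show "\<forall>p\<in>{p. p permutes (insert i E)} - {p. p permutes E}.
        of_int (sign p) * (of_bool (p i = i) * (\<Prod>j\<in>E. M j (p j))) = 0" by auto
  qed
  also have "\<dots> = gdet E M"
    unfolding gdet_def using assms by (intro sum.cong) (auto simp: permutes_not_in)
  finally show ?thesis .
qed

lemma gdet_insert_zero_row:
  assumes "finite E" "i \<notin> E" "\<And>j. j \<in> E \<Longrightarrow> M i j = 0"
  shows "gdet (insert i E) M = M i i * gdet E M"
  using gcof_mult_row[of "insert i E" i i M] gcof_insert_self[of E i M] assms by (simp add: mult.commute)

lemma gdet_singleton [simp]: "gdet {i} M = M i i"
  using gdet_insert_zero_row[of "{}" i M] by simp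

lemma gdet_add_row:
  assumes "finite F" "i \<in> F" "r \<in> F" "i \<noteq> r"
  shows "gdet F (M(i := (\<lambda>j. M i j + c * M r j))) = gdet F M"
proof -
  have "gdet F (M(i := (\<lambda>j. M i j + c * M r j))) =
      (\<Sum>l\<in>F. gcof F M i l * M i l) + c * (\<Sum>l\<in>F. gcof F M i l * M r l)"
    unfolding gdet_row[OF assms(1,2)] by (simp add: algebra_simps sum.distrib sum_distrib_left)
  then show ?thesis using gcof_mult_row[OF assms(1,2,2), of M] gcof_mult_row[OF assms(1,2,3), of M] assms(4) by simp
qed

lemma gdet_add_rows:
  assumes "finite F" "r \<in> F"
  shows "gdet F (\<lambda>i j. M i j + (if i = r then 0 else c i) * M r j) = gdet F M"
proof -
  have "gdet F (\<lambda>i j. M i j + (if i \<in> S then c i else 0) * M r j) = gdet F M"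
    if "finite S" "S \<subseteq> F - {r}" for S
    using that
  proof (induction S)
    case (insert s S)
    let ?M = "\<lambda>i j. M i j + (if i \<in> S then c i else 0) * M r j"
    have "gdet F (\<lambda>i j. M i j + (if i \<in> insert s S then c i else 0) * M r j) =
        gdet F (?M(s := (\<lambda>j. ?M s j + c s * ?M r j)))"
      using insert by (intro gdet_cong) (auto simp: algebra_simps)
    also have "\<dots> = gdet F ?M" by (rule gdet_add_row) (use insert assms in auto)
    finally show ?case using insert by simp
  qed simp
  from this[of "F - {r}"] have "gdet F (\<lambda>i j. M i j + (if i \<in> F - {r} then c i else 0) * M r j) = gdet F M"
    using assms by simp
  moreover have "gdet F (\<lambda>i j. M i j + (if i \<in> F - {r} then c i else 0) * M r j) =
      gdet F (\<lambda>i j. M i j + (if i = r then 0 else c i) * M r j)"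
    by (rule gdet_cong) auto
  ultimately show ?thesis by simp
qed

lemma gdet_scale_rows:
  assumes "finite F"
  shows "gdet F (\<lambda>i j. a i * M i j) = prod a F * gdet F M"
  unfolding gdet_def by (simp add: prod.distrib sum_distrib_left algebra_simps)

text \<open>Faces are index sets and \<open>gdet\<close> works on them without an enumeration. The
  passage to an enumeration is needed only to reach the k by k matrices in the definition of the
  volume.\<close>

lemma gdet_reindex:
  assumes "finite S" "inj_on f S"
  shows "gdet (f ` S) M = gdet S (\<lambda>i j. M (f i) (f j))"
proof -
  have "bij_betw (map_permutation S f) {p. p permutes S} {p. p permutes (f ` S)}"
    unfolding map_permutation_def restrict_id_def o_def
    using bij_betw_permutations[of f S "f ` S"] assms by (simp add: bij_betw_def)
  have "gdet (f ` S) M =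
      (\<Sum>p | p permutes S. of_int (sign (map_permutation S f p)) * (\<Prod>i\<in>f ` S. M i (map_permutation S f p i)))"
    unfolding gdet_def
    by (rule sum.reindex_bij_betw[symmetric]) fact
  also have "\<dots> = gdet S (\<lambda>i j. M (f i) (f j))"
    unfolding gdet_def
    using assms by (intro sum.cong refl) (auto simp: sign_map_permutation prod.reindex map_permutation_apply)
  finally show ?thesis .
qed

lemma det_mat_eq_gdet: "Determinant.det (Matrix.mat k k (\<lambda>(i, j). M i j)) = gdet {..<k} M"
  unfolding Determinant.det_def gdet_def
  by (auto simp: lessThan_atLeast0 sign_def permutes_in_image intro!: sum.cong prod.cong)

text \<open>Jacobi's formula: the product rule differentiates one row at a time, and
  \<open>gdet_row\<close> expands each resulting determinant.\<close>

lemma has_real_derivative_gdet: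
  assumes "finite F"
    and "\<And>i j. i \<in> F \<Longrightarrow> j \<in> F \<Longrightarrow> ((\<lambda>t. M t i j) has_real_derivative M' i j) (at t within S)"
  shows "((\<lambda>t. gdet F (M t)) has_real_derivative (\<Sum>i\<in>F. \<Sum>l\<in>F. gcof F (M t) i l * M' i l)) (at t within S)"
proof -
  have "((\<lambda>t. \<Prod>i\<in>F. M t i (p i)) has_real_derivative
      (\<Sum>i\<in>F. M' i (p i) * (\<Prod>j\<in>F - {i}. M t j (p j)))) (at t within S)" if "p permutes F" for p
    unfolding has_field_derivative_def
    by (rule has_derivative_eq_rhs[OF has_derivative_prod[where f'="\<lambda>i. (*) (M' i (p i))"]])
      (use that assms(2) in \<open>auto simp: permutes_in_image has_field_derivative_def fun_eq_iff
        sum_distrib_left mult_ac\<close>)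
  then have "((\<lambda>t. gdet F (M t)) has_real_derivative (\<Sum>p | p permutes F. of_int (sign p) *
      (\<Sum>i\<in>F. M' i (p i) * (\<Prod>j\<in>F - {i}. M t j (p j))))) (at t within S)"
    unfolding gdet_def by (intro DERIV_sum DERIV_cmult) auto
  moreover have "(\<Sum>p | p permutes F. of_int (sign p) * (\<Sum>i\<in>F. M' i (p i) * (\<Prod>j\<in>F - {i}. M t j (p j)))) =
      (\<Sum>i\<in>F. gdet F ((M t)(i := M' i)))"
    unfolding gdet_def sum_distrib_left
    by (subst sum.swap) (auto simp: prod_row_replaced[OF assms(1)] simp del: fun_upd_apply intro!: sum.cong)
  ultimately show ?thesis using assms(1) by (simp add: gdet_row)
qed

section \<open>Gram determinants and stresses\<close>

text \<open>Positivity is not assumed, so that the Lorentz form is an instance. Boundedness provides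
  the limits and derivatives of Gram entries.\<close>

locale symmetric_form = bounded_bilinear b for b :: "'v::real_normed_vector \<Rightarrow> 'v \<Rightarrow> real" +
  assumes commute: "b x y = b y x"
begin

declare zero_left [simp] zero_right [simp]

lemma scale_left: "b (c *\<^sub>R x) z = c * b x z"
  by (simp add: scaleR_left)

lemma scale_right: "b z (c *\<^sub>R x) = c * b z x"
  by (simp add: scaleR_right)

lemmas linear_simps = add_left add_right scale_left scale_right minus_left minus_right
  diff_left diff_right sum_left sum_right

definition gram :: "('i \<Rightarrow> 'v) \<Rightarrow> 'i \<Rightarrow> 'i \<Rightarrow> real" where
  "gram B i j = b (B i) (B j)"

abbreviation gram_det :: "'i set \<Rightarrow> ('i \<Rightarrow> 'v) \<Rightarrow> real" where
  "gram_det F B \<equiv> gdet F (gram B)"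

lemma gram_commute: "gram B i j = gram B j i"
  by (simp add: gram_def commute)

lemma gram_det_cong: "(\<And>i. i \<in> F \<Longrightarrow> B i = B' i) \<Longrightarrow> gram_det F B = gram_det F B'"
  by (rule gdet_cong) (simp add: gram_def)

text \<open>A change of the vectors acts on rows and columns of the Gram matrix at once, so the row
  operation is applied twice, with transpositions around the second application.\<close>

lemma gram_det_add_multiples:
  assumes "finite F" "r \<in> F"
  shows "gram_det F (\<lambda>i. B i + (if i = r then 0 else c i) *\<^sub>R B r) = gram_det F B"
proof -
  let ?c = "\<lambda>i. if i = r then 0 else c i"
  let ?N = "\<lambda>i j. gram B i j + ?c i * gram B r j"
  have "gram_det F (\<lambda>i. B i + ?c i *\<^sub>R B r) = gdet F (\<lambda>i j. (\<lambda>i j. ?N j i + ?c i * ?N j r) j i)"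
    by (rule gdet_cong) (simp add: gram_def linear_simps algebra_simps)
  also have "\<dots> = gdet F (\<lambda>i j. ?N j i + ?c i * ?N j r)"
    by (rule gdet_transpose[OF assms(1)])
  also have "\<dots> = gdet F (\<lambda>i j. ?N j i)"
    using gdet_add_rows[OF assms, of "\<lambda>i j. ?N j i" c] by simp
  also have "\<dots> = gdet F ?N" by (rule gdet_transpose[OF assms(1)])
  also have "\<dots> = gram_det F B" using gdet_add_rows[OF assms, of "gram B" c] by simp
  finally show ?thesis .
qed

lemma gram_det_add_combination:
  assumes "finite F" "i \<in> F" "S \<subseteq> F - {i}"
  shows "gram_det F (B(i := B i + (\<Sum>j\<in>S. c j *\<^sub>R B j))) = gram_det F B"
proof -
  have "finite S" using assms finite_subset by blast
  then show ?thesis using assms(3)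
  proof (induction S)
    case (insert s S)
    let ?B = "B(i := B i + (\<Sum>j\<in>S. c j *\<^sub>R B j))"
    have "gram_det F (B(i := B i + (\<Sum>j\<in>insert s S. c j *\<^sub>R B j))) =
        gram_det F (\<lambda>l. ?B l + (if l = s then 0 else if l = i then c s else 0) *\<^sub>R ?B s)"
      using insert by (intro gram_det_cong) (auto simp: algebra_simps)
    also have "\<dots> = gram_det F ?B"
      by (rule gram_det_add_multiples) (use insert assms in auto)
    also have "\<dots> = gram_det F B" using insert by (simp del: fun_upd_apply)
    finally show ?case .
  qed simp
qed

text \<open>Since the weights sum to 1, the point is \<open>u k\<close> plus a combination of the
  edges \<open>u j - u k\<close>; replacing \<open>u k\<close> by it is an elementary
  operation.\<close>

lemma gram_det_cone:
  fixes u :: "nat \<Rightarrow> 'v"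
  assumes "(\<Sum>j\<le>k. y j) = 1"
  shows "gram_det {..k} (\<lambda>i. if i < k then u i - u k else (\<Sum>j\<le>k. y j *\<^sub>R u j)) = gram_det {..k} u"
proof -
  let ?u = "\<lambda>i. u i + (if i = k then 0 else - 1) *\<^sub>R u k"
  have "(\<Sum>j\<le>k. y j *\<^sub>R u j) = ?u k + (\<Sum>j\<in>{..k} - {k}. y j *\<^sub>R ?u j)"
  proof -
    have "{..k} - {k} = {..<k}" by auto
    moreover have "y k *\<^sub>R u k = u k - (\<Sum>j<k. y j *\<^sub>R u k)"
    proof -
      have "y k = 1 - (\<Sum>j<k. y j)"
        using assms unfolding lessThan_Suc_atMost[symmetric] by simp
      then show ?thesis by (simp add: scaleR_diff_left scaleR_sum_left)
    qed
    moreover have "(\<Sum>j\<le>k. y j *\<^sub>R u j) = (\<Sum>j<k. y j *\<^sub>R u j) + y k *\<^sub>R u k"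
      unfolding lessThan_Suc_atMost[symmetric] by simp
    ultimately show ?thesis
      by (simp add: scaleR_diff_right sum_subtractf)
  qed
  then have "gram_det {..k} (\<lambda>i. if i < k then u i - u k else (\<Sum>j\<le>k. y j *\<^sub>R u j)) =
      gram_det {..k} (?u(k := ?u k + (\<Sum>j\<in>{..k} - {k}. y j *\<^sub>R ?u j)))"
    by (intro gram_det_cong) auto
  also have "\<dots> = gram_det {..k} ?u"
    by (rule gram_det_add_combination) auto
  also have "\<dots> = gram_det {..k} u"
    using gram_det_add_multiples[of "{..k}" k u "\<lambda>_. -1"] by simp
  finally show ?thesis .
qed

text \<open>Making the edges orthogonal to the point p does not change the determinant, and then the
  row of p splits off the factor \<open>b p p\<close>. The vectors on the left are, up to scale, the
  tangent vectors of the radially projected simplex at p.\<close>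

lemma gram_det_projected:
  fixes u :: "nat \<Rightarrow> 'v"
  assumes y: "(\<Sum>j\<le>k. y j) = 1" and p: "p = (\<Sum>j\<le>k. y j *\<^sub>R u j)" and nz: "b p p \<noteq> 0"
  shows "gram_det {..<k} (\<lambda>i. (u i - u k) - (b (u i - u k) p / b p p) *\<^sub>R p) = gram_det {..k} u / b p p"
proof -
  let ?g = "\<lambda>i. if i < k then u i - u k else p"
  let ?c = "\<lambda>i. - (b (?g i) p / b p p)"
  let ?h = "\<lambda>i. ?g i + (if i = k then 0 else ?c i) *\<^sub>R ?g k"
  have ins: "{..k} = insert k {..<k}" by auto
  have "gram_det {..k} u = gram_det {..k} ?g"
    unfolding p by (rule gram_det_cone[OF y, symmetric])
  also have "\<dots> = gram_det {..k} ?h"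
    using gram_det_add_multiples[of "{..k}" k ?g ?c] by simp
  also have "\<dots> = gram ?h k k * gram_det {..<k} ?h"
    unfolding ins by (rule gdet_insert_zero_row) (use nz in \<open>auto simp: gram_def linear_simps commute\<close>)
  also have "gram_det {..<k} ?h = gram_det {..<k} (\<lambda>i. (u i - u k) - (b (u i - u k) p / b p p) *\<^sub>R p)"
    by (rule gram_det_cong) simp
  also have "gram ?h k k = b p p" by (simp add: gram_def)
  finally show ?thesis using nz by simp
qed

text \<open>The member of the dual basis belonging to i, multiplied by \<open>gram_det F B\<close>;
  without the division it is defined for degenerate faces as well. It is a normal of the facet
  opposite to i.\<close>

definition dual_vector :: "'i set \<Rightarrow> ('i \<Rightarrow> 'v) \<Rightarrow> 'i \<Rightarrow> 'v" where
  "dual_vector F B i = (\<Sum>l\<in>F. gcof F (gram B) i l *\<^sub>R B l)"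

lemma form_dual_vector:
  assumes "finite F" "i \<in> F" "j \<in> F"
  shows "b (dual_vector F B i) (B j) = (if i = j then gram_det F B else 0)"
  using gcof_mult_row[OF assms, of "gram B"]
  by (simp add: dual_vector_def linear_simps gram_def commute[of "B j"])

text \<open>Cramer's rule: pairing with the dual vector reads off one coefficient.\<close>

lemma form_dual_vector_sum:
  assumes "finite F" "i \<in> F"
  shows "b (dual_vector F B i) (\<Sum>m\<in>F. x m *\<^sub>R B m) = gram_det F B * x i"
proof -
  have "b (dual_vector F B i) (\<Sum>m\<in>F. x m *\<^sub>R B m) = (\<Sum>m\<in>F. x m * (if i = m then gram_det F B else 0))"
    unfolding sum_right scale_right
    by (rule sum.cong[OF refl]) (use form_dual_vector[OF assms] in simp)
  also have "\<dots> = x i * gram_det F B"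
    unfolding sum.remove[OF assms] by (auto intro!: sum.neutral split: if_splits)
  finally show ?thesis by simp
qed

lemma form_dual_vector_self:
  assumes "finite F" "i \<in> F"
  shows "b (dual_vector F B i) (dual_vector F B i) = gram_det F B * gcof F (gram B) i i"
  using form_dual_vector_sum[OF assms, of B "gcof F (gram B) i"] by (simp add: dual_vector_def)

end

text \<open>A property of the family, not of its image set: repeated vectors count as dependent, and
  sums stay indexed by vertices.\<close>

definition independent_family :: "'i set \<Rightarrow> ('i \<Rightarrow> 'v::real_vector) \<Rightarrow> bool" where
  "independent_family F B \<longleftrightarrow> (\<forall>x. (\<Sum>i\<in>F. x i *\<^sub>R B i) = 0 \<longrightarrow> (\<forall>i\<in>F. x i = 0))"

lemma independent_family_subset:
  assumes "independent_family F B" "finite F" "E \<subseteq> F"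
  shows "independent_family E B"
  unfolding independent_family_def
proof (intro allI impI ballI)
  fix x i assume x: "(\<Sum>i\<in>E. x i *\<^sub>R B i) = 0" and i: "i \<in> E"
  have "(\<Sum>i\<in>F. (if i \<in> E then x i else 0) *\<^sub>R B i) = (\<Sum>i\<in>E. x i *\<^sub>R B i)"
    using assms by (intro sum.mono_neutral_cong_right) auto
  then have zero: "\<forall>i\<in>F. (if i \<in> E then x i else 0) = 0"
    using assms(1)[unfolded independent_family_def, THEN spec, of "\<lambda>i. if i \<in> E then x i else 0"] x
    by simp
  show "x i = 0" using bspec[OF zero subsetD[OF assms(3) i]] i by simp
qed

context symmetric_form
begin

lemma gram_det_nonzero_imp_independent:
  assumes "finite F" "gram_det F B \<noteq> 0"
  shows "independent_family F B"
  unfolding independent_family_def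
proof (intro allI impI ballI)
  fix x i assume "(\<Sum>i\<in>F. x i *\<^sub>R B i) = 0" "i \<in> F"
  then show "x i = 0" using form_dual_vector_sum[OF assms(1) \<open>i \<in> F\<close>, of B x] assms(2) by simp
qed

text \<open>Adding a vertex i to E yields the normal \<open>?N\<close> of E, which is nonzero
  because its coefficient at i is \<open>gram_det E B\<close>. By \<open>pos\<close> its square is
  positive, and this square is the product of the Gram determinants before and after the step. So
  the sign \<sigma> of a single vertex is passed on to all larger faces. On hyperbolic points
  \<sigma> is -1.\<close>

lemma gram_det_sign:
  assumes "finite F" "F \<noteq> {}" "independent_family F B"
    and diag: "\<And>i. i \<in> F \<Longrightarrow> 0 < \<sigma> * b (B i) (B i)"
    and pos: "\<And>v i. i \<in> F \<Longrightarrow> b v (B i) = 0 \<Longrightarrow> v \<noteq> 0 \<Longrightarrow> 0 < b v v"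
  shows "0 < \<sigma> * gram_det F B"
  using assms
proof (induction F rule: finite_ne_induct)
  case (singleton i)
  then show ?case by (simp add: gram_def)
next
  case (insert i E)
  let ?F = "insert i E"
  let ?N = "dual_vector ?F B i"
  have E: "0 < \<sigma> * gram_det E B"
    using insert independent_family_subset[of ?F B E] by blast
  have "gcof ?F (gram B) i i = gram_det E B" using insert by (simp add: gcof_insert_self)
  then have "?N \<noteq> 0"
    using insert.prems(1) E unfolding independent_family_def dual_vector_def by fastforce
  moreover obtain j where j: "j \<in> E" using insert by auto
  moreover from this have "b ?N (B j) = 0" using form_dual_vector[of ?F i j B] insert by auto
  ultimately have "0 < b ?N ?N" using insert.prems(3)[of j ?N] by auto
  then have "0 < gram_det ?F B * gram_det E B"
    using form_dual_vector_self[of ?F i B] insert by (simp add: gcof_insert_self)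
  then have "0 < (\<sigma> * gram_det ?F B) * (\<sigma> * gram_det E B)"
    using E by (simp add: zero_less_mult_iff) argo
  then show ?case using E by (simp add: zero_less_mult_iff)
qed

text \<open>The vectors \<open>dual_vector (insert i E) B i\<close> are orthogonal to E. Their sum weighted with the stress lies
  in the span of E, since the components along \<open>B i\<close> with \<open>i \<notin> E\<close> can be eliminated by the stress; so it is
  zero, which gives the coefficients of the sum.\<close>

lemma stress_cofactor_sum:
  assumes U: "finite U" "E \<subseteq> U" and \<alpha>: "(\<Sum>i\<in>U. \<alpha> i *\<^sub>R B i) = 0" and D: "gram_det E B \<noteq> 0"
  shows "(\<Sum>i\<in>U - E. \<alpha> i * (\<Sum>l\<in>insert i E. gcof (insert i E) (gram B) i l * c l)) =
    gram_det E B * (\<Sum>l\<in>U. \<alpha> l * c l)"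
proof -
  let ?D = "gram_det E B"
  have fin: "finite E" using U finite_subset by blast
  define y where "y l = (\<Sum>i\<in>U - E. \<alpha> i * gcof (insert i E) (gram B) i l)" for l
  define v where "v = (\<Sum>l\<in>E. (y l - ?D * \<alpha> l) *\<^sub>R B l)"
  have dual: "dual_vector (insert i E) B i = (\<Sum>l\<in>E. gcof (insert i E) (gram B) i l *\<^sub>R B l) + ?D *\<^sub>R B i"
    if "i \<in> U - E" for i
    using that fin unfolding dual_vector_def by (simp add: gcof_insert_self)
  have "(\<Sum>i\<in>U - E. \<alpha> i *\<^sub>R dual_vector (insert i E) B i) =
      (\<Sum>i\<in>U - E. \<Sum>l\<in>E. (\<alpha> i * gcof (insert i E) (gram B) i l) *\<^sub>R B l) + ?D *\<^sub>R (\<Sum>i\<in>U - E. \<alpha> i *\<^sub>R B i)"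
    by (simp add: dual scaleR_add_right scaleR_sum_right sum.distrib mult.commute)
  also have "(\<Sum>i\<in>U - E. \<Sum>l\<in>E. (\<alpha> i * gcof (insert i E) (gram B) i l) *\<^sub>R B l) = (\<Sum>l\<in>E. y l *\<^sub>R B l)"
    unfolding y_def scaleR_sum_left by (rule sum.swap)
  also have "(\<Sum>i\<in>U - E. \<alpha> i *\<^sub>R B i) = - (\<Sum>i\<in>E. \<alpha> i *\<^sub>R B i)"
    using \<alpha> sum.subset_diff[OF U(2,1), of "\<lambda>i. \<alpha> i *\<^sub>R B i"] by (simp add: eq_neg_iff_add_eq_0)
  also have "(\<Sum>l\<in>E. y l *\<^sub>R B l) + ?D *\<^sub>R - (\<Sum>i\<in>E. \<alpha> i *\<^sub>R B i) = v"
    unfolding v_def by (simp add: scaleR_diff_left sum_subtractf scaleR_sum_right)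
  finally have v: "v = (\<Sum>i\<in>U - E. \<alpha> i *\<^sub>R dual_vector (insert i E) B i)" by simp
  have orth: "b v (B j) = 0" if "j \<in> E" for j
    unfolding v sum_left scale_left
    by (rule sum.neutral) (use that form_dual_vector[of "insert _ E" _ j] fin in auto)
  \<comment> \<open>In an indefinite form, orthogonality of v to E alone would not make its
    coefficients vanish; the nonzero determinant of E does, by pairing v with the dual vectors of
    E.\<close>
  have y: "y l = ?D * \<alpha> l" if l: "l \<in> E" for l
  proof -
    have "?D * (y l - ?D * \<alpha> l) = b (dual_vector E B l) v"
      unfolding v_def by (rule form_dual_vector_sum[OF fin l, symmetric])
    also have "\<dots> = 0"
      unfolding dual_vector_def by (simp add: linear_simps commute[of _ v] orth)
    finally show ?thesis using D by simp
  qed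
  have "(\<Sum>i\<in>U - E. \<alpha> i * (\<Sum>l\<in>insert i E. gcof (insert i E) (gram B) i l * c l)) =
      (\<Sum>i\<in>U - E. \<alpha> i * (?D * c i)) + (\<Sum>i\<in>U - E. \<Sum>l\<in>E. \<alpha> i * gcof (insert i E) (gram B) i l * c l)"
    using fin by (simp add: gcof_insert_self sum.distrib distrib_left sum_distrib_left mult.assoc)
  also have "(\<Sum>i\<in>U - E. \<Sum>l\<in>E. \<alpha> i * gcof (insert i E) (gram B) i l * c l) = (\<Sum>l\<in>E. y l * c l)"
    unfolding y_def sum_distrib_right by (rule sum.swap)
  also have "\<dots> = (\<Sum>l\<in>E. \<alpha> l * (?D * c l))" using y by (simp add: mult_ac)
  also have "(\<Sum>i\<in>U - E. \<alpha> i * (?D * c i)) + \<dots> = (\<Sum>l\<in>U. \<alpha> l * (?D * c l))"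
    using sum.subset_diff[OF U(2,1)] by metis
  finally show ?thesis by (simp add: sum_distrib_left mult_ac)
qed

end

text \<open>Removing and inserting the vertex i are inverse bijections between pairs of a face with
  a vertex in it and pairs of a facet with a vertex outside it.\<close>

lemma sum_faces_facets:
  fixes h :: "'i set \<Rightarrow> 'i \<Rightarrow> 'a::comm_monoid_add"
  assumes "finite U"
  shows "(\<Sum>F | F \<subseteq> U \<and> card F = Suc k. \<Sum>i\<in>F. h (F - {i}) i) =
    (\<Sum>E | E \<subseteq> U \<and> card E = k. \<Sum>i\<in>U - E. h E i)"
proof -
  let ?A = "SIGMA F:{F. F \<subseteq> U \<and> card F = Suc k}. F" and ?B = "SIGMA E:{E. E \<subseteq> U \<and> card E = k}. U - E"
  have fin: "finite F" if "F \<subseteq> U" for F using assms that finite_subset by blast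
  have "(\<Sum>F | F \<subseteq> U \<and> card F = Suc k. \<Sum>i\<in>F. h (F - {i}) i) = (\<Sum>(F, i)\<in>?A. h (F - {i}) i)"
    using assms by (intro sum.Sigma) (auto intro: fin)
  also have "\<dots> = (\<Sum>(E, i)\<in>?B. h E i)"
    by (rule sum.reindex_bij_witness[where i="\<lambda>(E, i). (insert i E, i)" and j="\<lambda>(F, i). (F - {i}, i)"])
      (auto simp: fin insert_absorb)
  also have "\<dots> = (\<Sum>E | E \<subseteq> U \<and> card E = k. \<Sum>i\<in>U - E. h E i)"
    using assms by (intro sum.Sigma[symmetric]) auto
  finally show ?thesis .
qed

text \<open>The product over F is \<alpha> at i times the product over E = F - {i}, and the weight
  \<open>R E m\<close> does not depend on i. After regrouping by E,
  \<open>stress_cofactor_sum\<close> evaluates the sum over i as \<open>gram_det E B\<close> times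
  the sum in \<open>C\<close>, hence as zero. The weight is a moment of the facet in the curved
  cases and the constant 1 in the Euclidean case.\<close>

lemma (in symmetric_form) stress_boundary_sum:
  assumes U: "finite U" and \<alpha>: "(\<Sum>i\<in>U. \<alpha> i *\<^sub>R B i) = 0"
    and D: "\<And>E. E \<subseteq> U \<Longrightarrow> card E = k \<Longrightarrow> gram_det E B \<noteq> 0"
    and C: "\<And>m. m \<in> U \<Longrightarrow> (\<Sum>l\<in>U. \<alpha> l * C l m) = 0"
  shows "(\<Sum>F | F \<subseteq> U \<and> card F = Suc k. (\<Prod>s\<in>F. \<alpha> s) *
    (\<Sum>i\<in>F. \<Sum>m\<in>F - {i}. (\<Sum>l\<in>F. gcof F (gram B) i l * C l m) * R (F - {i}) m)) = 0"
proof -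
  define h where "h E i = (\<Prod>s\<in>E. \<alpha> s) * (\<Sum>m\<in>E. \<alpha> i *
    (\<Sum>l\<in>insert i E. gcof (insert i E) (gram B) i l * C l m) * R E m)" for E i
  have "(\<Sum>F | F \<subseteq> U \<and> card F = Suc k. (\<Prod>s\<in>F. \<alpha> s) *
    (\<Sum>i\<in>F. \<Sum>m\<in>F - {i}. (\<Sum>l\<in>F. gcof F (gram B) i l * C l m) * R (F - {i}) m)) =
    (\<Sum>F | F \<subseteq> U \<and> card F = Suc k. \<Sum>i\<in>F. h (F - {i}) i)"
  proof (rule sum.cong[OF refl])
    fix F assume "F \<in> {F. F \<subseteq> U \<and> card F = Suc k}"
    then have fin: "finite F" using U finite_subset by blast
    show "(\<Prod>s\<in>F. \<alpha> s) * (\<Sum>i\<in>F. \<Sum>m\<in>F - {i}. (\<Sum>l\<in>F. gcof F (gram B) i l * C l m) * R (F - {i}) m) =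
        (\<Sum>i\<in>F. h (F - {i}) i)"
      unfolding sum_distrib_left h_def
      by (intro sum.cong refl) (simp add: insert_absorb prod.remove[OF fin] sum_distrib_left mult_ac)
  qed
  also have "\<dots> = (\<Sum>E | E \<subseteq> U \<and> card E = k. \<Sum>i\<in>U - E. h E i)"
    by (rule sum_faces_facets[OF U])
  also have "\<dots> = 0"
  proof (rule sum.neutral, rule ballI)
    fix E assume E: "E \<in> {E. E \<subseteq> U \<and> card E = k}"
    have "(\<Sum>i\<in>U - E. h E i) = (\<Prod>s\<in>E. \<alpha> s) * (\<Sum>m\<in>E. (\<Sum>i\<in>U - E. \<alpha> i *
        (\<Sum>l\<in>insert i E. gcof (insert i E) (gram B) i l * C l m)) * R E m)"
      unfolding h_def sum_distrib_left[symmetric] sum_distrib_right by (subst sum.swap) simp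
    also have "\<dots> = 0"
      using stress_cofactor_sum[OF U _ \<alpha>, of E "\<lambda>l. C l _"] D[of E] C E by (auto intro!: sum.neutral)
    finally show "(\<Sum>i\<in>U - E. h E i) = 0" .
  qed
  finally show ?thesis .
qed

section \<open>Integrals over the orthant\<close>

text \<open>Any nonnegative C1 profile with enough decay would do; since the support is bounded, all integrands below are
  bounded and vanish outside a box.\<close>

definition cutoff :: "real \<Rightarrow> real" where
  "cutoff q = (max 0 (1 - q))\<^sup>2"

definition cutoff_deriv :: "real \<Rightarrow> real" where
  "cutoff_deriv q = - 2 * max 0 (1 - q)"

lemma has_real_derivative_cutoff: "(cutoff has_real_derivative cutoff_deriv q) (at q)"
proof (cases q "1::real" rule: linorder_cases)
  case less
  have "((\<lambda>q. (1 - q)\<^sup>2) has_real_derivative - 2 * (1 - q)) (at q)"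
    by (auto intro!: derivative_eq_intros)
  moreover have "cutoff_deriv q = - 2 * (1 - q)" using less by (simp add: cutoff_deriv_def)
  ultimately show ?thesis
    using less has_field_derivative_transform_within_open[of "\<lambda>q. (1 - q)\<^sup>2" "- 2 * (1 - q)" q "{..<1}" cutoff]
    by (simp add: cutoff_def)
next
  case greater
  have "((\<lambda>q::real. 0::real) has_real_derivative 0) (at q)" by simp
  moreover have "cutoff_deriv q = 0" using greater by (simp add: cutoff_deriv_def)
  ultimately show ?thesis
    using greater has_field_derivative_transform_within_open[of "\<lambda>q. 0" 0 q "{1<..}" cutoff]
    by (simp add: cutoff_def)
next
  case equal
  \<comment> \<open>At the edge of the support the one-sided formulas do not apply directly; there
    the difference quotient is bounded by the distance to 1.\<close>
  have "((\<lambda>y. (cutoff y - cutoff 1) / (y - 1)) \<longlongrightarrow> 0) (at 1)"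
  proof (rule Lim_null_comparison)
    show "\<forall>\<^sub>F y in at 1. norm ((cutoff y - cutoff 1) / (y - 1)) \<le> \<bar>y - 1\<bar>"
    proof (rule always_eventually, rule allI)
      fix y :: real
      have "max 0 (1 - y) * max 0 (1 - y) \<le> \<bar>y - 1\<bar> * \<bar>y - 1\<bar>" by (rule mult_mono) auto
      then show "norm ((cutoff y - cutoff 1) / (y - 1)) \<le> \<bar>y - 1\<bar>"
        by (cases "y = 1") (auto simp: cutoff_def power2_eq_square abs_divide divide_le_eq)
    qed
    show "((\<lambda>y::real. \<bar>y - 1\<bar>) \<longlongrightarrow> 0) (at 1)"
      by (rule tendsto_eq_intros refl)+ simp
  qed
  then show ?thesis unfolding equal has_field_derivative_iff by (simp add: cutoff_deriv_def)
qed

lemma continuous_cutoff_deriv [continuous_intros]: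
  "isCont f x \<Longrightarrow> isCont (\<lambda>x. cutoff_deriv (f x)) x"
  unfolding cutoff_deriv_def by (intro continuous_intros)

lemma continuous_cutoff [continuous_intros]:
  "isCont f x \<Longrightarrow> isCont (\<lambda>x. cutoff (f x)) x"
  unfolding cutoff_def by (intro continuous_intros)

lemma measurable_cutoff [measurable]: "cutoff \<in> borel_measurable borel" "cutoff_deriv \<in> borel_measurable borel"
  unfolding cutoff_def cutoff_deriv_def by measurable

lemma cutoff_eq_0: "1 \<le> q \<Longrightarrow> cutoff q = 0" "1 \<le> q \<Longrightarrow> cutoff_deriv q = 0"
  by (auto simp: cutoff_def cutoff_deriv_def)

lemma cutoff_nonneg: "0 \<le> cutoff q"
  by (simp add: cutoff_def)

lemma abs_cutoff_le:
  assumes "0 \<le> q" shows "\<bar>cutoff q\<bar> \<le> 1" "\<bar>cutoff_deriv q\<bar> \<le> 2"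
  using assms by (auto simp: cutoff_def cutoff_deriv_def max_def power2_eq_square mult_le_one)

lemma cutoff_lipschitz:
  assumes "0 \<le> p" "0 \<le> q" shows "\<bar>cutoff p - cutoff q\<bar> \<le> 2 * \<bar>p - q\<bar>"
proof -
  let ?a = "max 0 (1 - p)" and ?b = "max 0 (1 - q)"
  have "cutoff p - cutoff q = (?a + ?b) * (?a - ?b)"
    by (simp add: cutoff_def power2_eq_square algebra_simps)
  moreover have "\<bar>?a + ?b\<bar> \<le> 2" "\<bar>?a - ?b\<bar> \<le> \<bar>p - q\<bar>" using assms by auto
  ultimately show ?thesis by (simp add: abs_mult mult_mono)
qed

section \<open>Quadratic forms on the nonnegative orthant\<close>

definition qform :: "'i set \<Rightarrow> ('i \<Rightarrow> 'i \<Rightarrow> real) \<Rightarrow> ('i \<Rightarrow> real) \<Rightarrow> real" where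
  "qform F H x = (\<Sum>i\<in>F. \<Sum>j\<in>F. H i j * x i * x j)"

definition orthant :: "'i set \<Rightarrow> ('i \<Rightarrow> real) \<Rightarrow> real" where
  "orthant F x = (\<Prod>i\<in>F. indicator {0..} (x i))"

text \<open>Only the nonnegative vectors matter: the form of a hyperbolic simplex is indefinite.\<close>

definition coercive :: "'i set \<Rightarrow> ('i \<Rightarrow> 'i \<Rightarrow> real) \<Rightarrow> real \<Rightarrow> bool" where
  "coercive F H R \<longleftrightarrow> (\<forall>x. (\<forall>i\<in>F. 0 \<le> x i) \<and> qform F H x \<le> 1 \<longrightarrow> (\<forall>i\<in>F. x i \<le> R))"

text \<open>For the Gram matrix of a face, multiplied by \<sigma>, this is the volume divided by
  \<open>sqrt (\<sigma> * gram_det F B)\<close>, up to the constant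
  \<open>radial_constant k\<close>.\<close>

definition cone_integral :: "'i set \<Rightarrow> ('i \<Rightarrow> 'i \<Rightarrow> real) \<Rightarrow> real" where
  "cone_integral F H = (\<integral>x. orthant F x * cutoff (qform F H x) \<partial>Pi\<^sub>M F (\<lambda>_. lborel))"

text \<open>Appears with a facet in place of \<open>F\<close>, as the boundary term of an
  integration by parts.\<close>

definition cone_moment :: "'i set \<Rightarrow> ('i \<Rightarrow> 'i \<Rightarrow> real) \<Rightarrow> 'i \<Rightarrow> real" where
  "cone_moment F H m = (\<integral>x. orthant F x * x m * cutoff (qform F H x) \<partial>Pi\<^sub>M F (\<lambda>_. lborel))"

lemma orthant_eq: "finite F \<Longrightarrow> orthant F x = of_bool (\<forall>i\<in>F. 0 \<le> x i)"
  by (induction F rule: finite_induct) (auto simp: orthant_def)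

lemma measurable_orthant [measurable]: "orthant F \<in> borel_measurable (Pi\<^sub>M F (\<lambda>_. lborel))"
  unfolding orthant_def
  by (intro borel_measurable_prod measurable_compose[OF measurable_component_singleton borel_measurable_indicator]) auto

lemma measurable_lborel_component: "i \<in> F \<Longrightarrow> (\<lambda>x. x i) \<in> borel_measurable (Pi\<^sub>M F (\<lambda>_. lborel :: real measure))"
  using measurable_component_singleton[of i F "\<lambda>_. lborel :: real measure"] by simp

lemma measurable_linear_form [measurable]:
  "(\<lambda>x. \<Sum>i\<in>F. c i * x i) \<in> borel_measurable (Pi\<^sub>M F (\<lambda>_. lborel :: real measure))"
  by (intro borel_measurable_sum borel_measurable_times measurable_lborel_component) auto

lemma measurable_qform [measurable]: "qform F H \<in> borel_measurable (Pi\<^sub>M F (\<lambda>_. lborel))"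
  unfolding qform_def by (intro borel_measurable_sum borel_measurable_times measurable_lborel_component) auto

lemma qform_scale: "qform F H (\<lambda>i. c * x i) = c\<^sup>2 * qform F H x"
  by (simp add: qform_def sum_distrib_left power2_eq_square mult_ac)

lemma qform_insert:
  assumes "finite E" "i \<notin> E" and sym: "\<And>j. j \<in> E \<Longrightarrow> H j i = H i j"
  shows "qform (insert i E) H (x(i := y)) = H i i * y\<^sup>2 + 2 * (\<Sum>j\<in>E. H i j * x j) * y + qform E H x"
proof -
  have ne: "j \<noteq> i" if "j \<in> E" for j using that assms by auto
  have 1: "(\<Sum>j\<in>E. H i j * y * (x(i := y)) j) = (\<Sum>j\<in>E. H i j * x j) * y"
    unfolding sum_distrib_right by (rule sum.cong) (use ne in auto)
  have 2: "(\<Sum>j\<in>E. H j i * (x(i := y)) j * y) = (\<Sum>j\<in>E. H i j * x j) * y"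
    unfolding sum_distrib_right by (rule sum.cong) (use ne sym in auto)
  have 3: "(\<Sum>j\<in>E. \<Sum>l\<in>E. H j l * (x(i := y)) j * (x(i := y)) l) = qform E H x"
    unfolding qform_def by (intro sum.cong refl) (use ne in auto)
  show ?thesis
    using assms(1,2) 1 2 3 unfolding qform_def
    by (simp add: sum.distrib power2_eq_square del: fun_upd_apply) simp
qed

lemma qform_extend:
  assumes "finite F" "E \<subseteq> F"
  shows "qform F H (\<lambda>i. if i \<in> E then x i else 0) = qform E H x"
proof -
  have "qform F H (\<lambda>i. if i \<in> E then x i else 0) = (\<Sum>i\<in>E. \<Sum>j\<in>F. H i j * x i * (if j \<in> E then x j else 0))"
    unfolding qform_def using assms by (intro sum.mono_neutral_cong_right) auto
  also have "\<dots> = qform E H x"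
    unfolding qform_def using assms by (intro sum.cong refl sum.mono_neutral_cong_right) auto
  finally show ?thesis .
qed

text \<open>Extension by zero places the orthant of E on the boundary of the orthant of F.\<close>

lemma coercive_subset:
  assumes "coercive F H R" "finite F" "E \<subseteq> F"
  shows "coercive E H R"
  unfolding coercive_def
proof (intro allI impI ballI)
  fix x i assume x: "(\<forall>i\<in>E. 0 \<le> x i) \<and> qform E H x \<le> 1" and i: "i \<in> E"
  let ?x = "\<lambda>i. if i \<in> E then x i else 0"
  have "(\<forall>i\<in>F. 0 \<le> ?x i) \<and> qform F H ?x \<le> 1" using x qform_extend[OF assms(2,3)] by simp
  then have "\<forall>i\<in>F. ?x i \<le> R"
    using assms(1)[unfolded coercive_def, THEN spec, of ?x] by blast
  then have "?x i \<le> R" using assms(3) i by blast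
  then show "x i \<le> R" using i by simp
qed

text \<open>If the form were nonpositive at x, it would be so on the whole ray through x, which
  leaves the box; the multiple \<open>c\<close> brings coordinate i to
  \<open>\<bar>R\<bar> + 1\<close>.\<close>

lemma coercive_pos:
  assumes "coercive F H R" "\<And>i. i \<in> F \<Longrightarrow> 0 \<le> x i" "i \<in> F" "0 < x i"
  shows "0 < qform F H x"
proof (rule ccontr)
  assume "\<not> 0 < qform F H x"
  then have "qform F H x \<le> 0" by simp
  define c where "c = (\<bar>R\<bar> + 1) / x i"
  have c: "0 < c" using assms by (simp add: c_def)
  have "qform F H (\<lambda>i. c * x i) \<le> 1"
    unfolding qform_scale using mult_nonneg_nonpos[OF zero_le_power2[of c] \<open>qform F H x \<le> 0\<close>] by linarith
  moreover have "\<forall>i\<in>F. 0 \<le> c * x i" using assms(2) c by simp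
  ultimately have "\<forall>i\<in>F. c * x i \<le> R"
    using assms(1)[unfolded coercive_def, THEN spec, of "\<lambda>i. c * x i"] by blast
  then have "c * x i \<le> R" using assms(3) by blast
  then show False using assms(4) by (simp add: c_def)
qed

lemma coercive_nonneg:
  assumes "coercive F H R" "\<And>i. i \<in> F \<Longrightarrow> 0 \<le> x i"
  shows "0 \<le> qform F H x"
proof (cases "\<exists>i\<in>F. 0 < x i")
  case True
  then show ?thesis using coercive_pos[OF assms] by force
next
  case False
  then have "\<forall>i\<in>F. x i = 0" using assms(2) by force
  then show ?thesis by (simp add: qform_def)
qed

lemma coerciveD:
  assumes "coercive F H R" "\<And>i. i \<in> F \<Longrightarrow> 0 \<le> x i" "qform F H x < 1" "i \<in> F"
  shows "x i \<le> R"
  using assms unfolding coercive_def by force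

lemma integrable_PiM_box:
  fixes f :: "('i \<Rightarrow> real) \<Rightarrow> real"
  assumes "finite F" "f \<in> borel_measurable (Pi\<^sub>M F (\<lambda>_. lborel))"
    and "\<And>x i. f x \<noteq> 0 \<Longrightarrow> i \<in> F \<Longrightarrow> 0 \<le> x i \<and> x i \<le> R"
    and "\<And>x. (\<And>i. i \<in> F \<Longrightarrow> 0 \<le> x i \<and> x i \<le> R) \<Longrightarrow> \<bar>f x\<bar> \<le> K"
  shows "integrable (Pi\<^sub>M F (\<lambda>_. lborel)) f"
proof -
  interpret product_sigma_finite "\<lambda>_::'i. lborel :: real measure" by standard
  let ?A = "Pi\<^sub>E F (\<lambda>_. {0..R})"
  have "emeasure (Pi\<^sub>M F (\<lambda>_. lborel)) ?A = (\<Prod>i\<in>F. emeasure lborel {0..R})"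
    using assms(1) by (intro emeasure_PiM) auto
  also have "\<dots> < \<infinity>" by (auto intro!: power_less_top_ennreal[THEN iffD2] simp: emeasure_lborel_Icc_eq)
  finally have fin: "emeasure (Pi\<^sub>M F (\<lambda>_. lborel)) ?A < \<infinity>" .
  show ?thesis
  proof (rule integrableI_bounded_set[where A="?A" and B=K])
    show "?A \<in> sets (Pi\<^sub>M F (\<lambda>_. lborel))" using assms(1) by (intro sets_PiM_I_finite) auto
    show "AE x in Pi\<^sub>M F (\<lambda>_. lborel). x \<in> ?A \<longrightarrow> norm (f x) \<le> K"
      using assms(4) by (intro AE_I2) (auto simp: PiE_iff)
    show "AE x in Pi\<^sub>M F (\<lambda>_. lborel). x \<notin> ?A \<longrightarrow> f x = 0"
    proof (intro AE_I2 impI)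
      fix x assume "x \<in> space (Pi\<^sub>M F (\<lambda>_::'i. lborel :: real measure))" "x \<notin> ?A"
      then show "f x = 0" using assms(3)[of x] by (auto simp: space_PiM PiE_iff)
    qed
  qed (use assms fin in auto)
qed

section \<open>Integration by parts in one coordinate\<close>

text \<open>The integrand is the derivative of \<open>(S + T * y) * cutoff (q y)\<close>, which
  vanishes for large y and takes the value \<open>S * cutoff c\<close> at 0.\<close>

lemma integral_half_line:
  fixes a b c S T R :: real
  defines "q \<equiv> \<lambda>y. a * y\<^sup>2 + b * y + c"
  assumes R: "\<And>y. 0 \<le> y \<Longrightarrow> q y \<le> 1 \<Longrightarrow> y \<le> R"
  shows "(\<integral>y. indicator {0..} y * (T * cutoff (q y) + (S + T * y) * (cutoff_deriv (q y) * (2 * a * y + b))) \<partial>lborel) =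
    - S * cutoff c"
proof -
  \<comment> \<open>Every nonnegative y above R has q y > 1, where the cutoff vanishes. The added 1
    makes r itself such a point.\<close>
  define r where "r = max R 0 + 1"
  let ?f = "\<lambda>y. T * cutoff (q y) + (S + T * y) * (cutoff_deriv (q y) * (2 * a * y + b))"
  let ?g = "\<lambda>y. (S + T * y) * cutoff (q y)"
  have r: "0 \<le> r" "1 \<le> q y" if "r \<le> y" for y
  proof -
    have y: "0 \<le> y" "R < y" using that by (auto simp: r_def)
    show "0 \<le> r" by (simp add: r_def)
    show "1 \<le> q y" using R[of y] y by (cases "q y \<le> 1") auto
  qed
  have r0: "0 \<le> r" by (simp add: r_def)
  have "(\<integral>y. indicator {0..} y * ?f y \<partial>lborel) = (\<integral>y. ?f y * indicator {0..r} y \<partial>lborel)"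
  proof (rule Bochner_Integration.integral_cong[OF refl])
    fix y :: real
    show "indicator {0..} y * ?f y = ?f y * indicator {0..r} y"
      using r[of y] cutoff_eq_0[of "q y"] by (auto simp: indicator_def)
  qed
  also have "\<dots> = ?g r - ?g 0"
  proof (rule integral_FTC_Icc_real[OF r0])
    fix y :: real
    have "(q has_real_derivative 2 * a * y + b) (at y)"
      unfolding q_def by (auto intro!: derivative_eq_intros)
    then have "((\<lambda>y. cutoff (q y)) has_real_derivative cutoff_deriv (q y) * (2 * a * y + b)) (at y)"
      by (rule DERIV_chain2[OF has_real_derivative_cutoff])
    then show "(?g has_real_derivative ?f y) (at y)"
      by (auto intro!: derivative_eq_intros)
    have "isCont q y" unfolding q_def by (intro continuous_intros)
    then show "isCont ?f y" by (intro continuous_intros)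
  qed
  also have "\<dots> = - S * cutoff c"
    using cutoff_eq_0(1)[OF r(2)[OF order_refl]] by (simp add: q_def)
  finally show ?thesis .
qed

lemma linear_form_bound:
  assumes "\<And>i. i \<in> F \<Longrightarrow> 0 \<le> x i \<and> x i \<le> (R::real)"
  shows "\<bar>\<Sum>i\<in>F. c i * x i\<bar> \<le> (\<Sum>i\<in>F. \<bar>c i\<bar> * R)"
  by (rule order_trans[OF sum_abs]) (intro sum_mono, auto simp: abs_mult intro!: mult_left_mono dest: assms)

lemma integrable_cone_moment:
  assumes F: "finite F" "m \<in> F" and co: "coercive F H R"
  shows "integrable (Pi\<^sub>M F (\<lambda>_. lborel)) (\<lambda>x. orthant F x * x m * cutoff (qform F H x))"
proof (rule integrable_PiM_box[OF F(1), where R=R and K=R])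
  have [measurable]: "(\<lambda>x. x m) \<in> borel_measurable (Pi\<^sub>M F (\<lambda>_. lborel :: real measure))"
    using F by (rule_tac measurable_lborel_component)
  show "(\<lambda>x. orthant F x * x m * cutoff (qform F H x)) \<in> borel_measurable (Pi\<^sub>M F (\<lambda>_. lborel))"
    by measurable
next
  fix x i assume "orthant F x * x m * cutoff (qform F H x) \<noteq> 0" "i \<in> F"
  then show "0 \<le> x i \<and> x i \<le> R"
    using coerciveD[OF co, of x i] cutoff_eq_0[of "qform F H x"] F
    by (auto simp: orthant_eq not_le[symmetric])
next
  fix x :: "'a \<Rightarrow> real" assume x: "\<And>i. i \<in> F \<Longrightarrow> 0 \<le> x i \<and> x i \<le> R"
  have "\<bar>cutoff (qform F H x)\<bar> \<le> 1" using x coercive_nonneg[OF co] abs_cutoff_le by blast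
  then show "\<bar>orthant F x * x m * cutoff (qform F H x)\<bar> \<le> R"
    using x[OF F(2)] mult_mono[of "\<bar>x m\<bar>" R "\<bar>cutoff (qform F H x)\<bar>" 1]
    by (auto simp: orthant_eq[OF F(1)] abs_mult)
qed

text \<open>By the symmetry of \<open>H\<close>, \<open>f\<close> is the partial derivative in
  direction i of the linear form \<open>L\<close> times \<open>cutoff (qform F H x)\<close> on the
  orthant. Integrating over coordinate i first leaves only the values at \<open>x i = 0\<close>,
  where the i-th term of the linear form is absent; this is why m ranges over the facet.\<close>

lemma integral_orthant_partial:
  fixes H :: "'a \<Rightarrow> 'a \<Rightarrow> real" and L :: "'a \<Rightarrow> real"
  assumes F: "finite F" "i \<in> F" and sym: "\<And>i j. i \<in> F \<Longrightarrow> j \<in> F \<Longrightarrow> H i j = H j i"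
    and co: "coercive F H R"
  defines "f \<equiv> \<lambda>x. orthant F x * (L i * cutoff (qform F H x) +
      (\<Sum>m\<in>F. L m * x m) * (cutoff_deriv (qform F H x) * (2 * (\<Sum>j\<in>F. H i j * x j))))"
  shows "integrable (Pi\<^sub>M F (\<lambda>_. lborel)) f"
    and "(\<integral>x. f x \<partial>Pi\<^sub>M F (\<lambda>_. lborel)) = - (\<Sum>m\<in>F - {i}. L m * cone_moment (F - {i}) H m)"
proof -
  interpret product_sigma_finite "\<lambda>_::'a. lborel :: real measure" by standard
  define E where "E = F - {i}"
  have E: "finite E" "i \<notin> E" "F = insert i E" using F by (auto simp: E_def)
  show int: "integrable (Pi\<^sub>M F (\<lambda>_. lborel)) f"
  proof (rule integrable_PiM_box[OF F(1), where R=R and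
        K="\<bar>L i\<bar> + (\<Sum>m\<in>F. \<bar>L m\<bar> * R) * (2 * (2 * (\<Sum>j\<in>F. \<bar>H i j\<bar> * R)))"])
    show "f \<in> borel_measurable (Pi\<^sub>M F (\<lambda>_. lborel))"
      unfolding f_def by measurable
  next
    fix x l assume "f x \<noteq> 0" "l \<in> F"
    then show "0 \<le> x l \<and> x l \<le> R"
      using coerciveD[OF co, of x l] cutoff_eq_0[of "qform F H x"] F unfolding f_def
      by (cases "1 \<le> qform F H x") (auto simp: orthant_eq)
  next
    fix x :: "'a \<Rightarrow> real" assume x: "\<And>i. i \<in> F \<Longrightarrow> 0 \<le> x i \<and> x i \<le> R"
    have q: "0 \<le> qform F H x" using x coercive_nonneg[OF co] by blast
    have R: "0 \<le> R" using x[OF F(2)] by linarith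
    let ?A = "L i * cutoff (qform F H x)" and ?l = "\<Sum>m\<in>F. L m * x m"
    let ?B = "cutoff_deriv (qform F H x)" and ?h = "\<Sum>j\<in>F. H i j * x j"
    have "\<bar>f x\<bar> \<le> \<bar>?A + ?l * (?B * (2 * ?h))\<bar>"
      unfolding f_def by (auto simp: orthant_eq[OF F(1)])
    also have "\<dots> \<le> \<bar>?A\<bar> + \<bar>?l\<bar> * (\<bar>?B\<bar> * (2 * \<bar>?h\<bar>))"
      by (rule order_trans[OF abs_triangle_ineq]) (simp add: abs_mult)
    also have "\<dots> \<le> \<bar>L i\<bar> + (\<Sum>m\<in>F. \<bar>L m\<bar> * R) * (2 * (2 * (\<Sum>j\<in>F. \<bar>H i j\<bar> * R)))"
      using abs_cutoff_le[OF q] linear_form_bound[OF x, where c=L] linear_form_bound[OF x, where c="H i"] R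
      by (intro add_mono mult_mono) (auto simp: abs_mult mult_left_le intro!: sum_nonneg mult_nonneg_nonneg)
    finally show "\<bar>f x\<bar> \<le> \<bar>L i\<bar> + (\<Sum>m\<in>F. \<bar>L m\<bar> * R) * (2 * (2 * (\<Sum>j\<in>F. \<bar>H i j\<bar> * R)))" .
  qed
  have coE: "coercive E H R" using coercive_subset[OF co F(1)] E by auto
  have inner: "(\<integral>y. f (x(i := y)) \<partial>lborel) =
      - (\<Sum>m\<in>E. L m * (orthant E x * x m * cutoff (qform E H x)))" for x
  proof (cases "\<forall>j\<in>E. 0 \<le> x j")
    case False
    then have "f (x(i := y)) = 0" for y
      using E(2,3) unfolding f_def orthant_eq[OF F(1)] by auto
    moreover have "orthant E x = 0" using False by (auto simp: orthant_eq[OF E(1)])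
    ultimately show ?thesis by simp
  next
    case True
    define h where "h = (\<Sum>j\<in>E. H i j * x j)"
    define l where "l = (\<Sum>j\<in>E. L j * x j)"
    let ?q = "\<lambda>y. H i i * y\<^sup>2 + (2 * h) * y + qform E H x"
    have q: "qform F H (x(i := y)) = ?q y" for y
      unfolding E(3) h_def by (rule qform_insert) (use E sym in auto)
    have lin: "(\<Sum>j\<in>F. c j * (x(i := y)) j) = (\<Sum>j\<in>E. c j * x j) + c i * y" for c y
      using E(1,2) unfolding E(3) by (simp add: add.commute cong: sum.cong_simp) (auto intro!: sum.cong)
    have "f (x(i := y)) = indicator {0..} y * (L i * cutoff (?q y) +
        (l + L i * y) * (cutoff_deriv (?q y) * (2 * H i i * y + 2 * h)))" for y
    proof -
      have "orthant F (x(i := y)) = indicator {0..} y"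
        using True E(2,3) unfolding orthant_eq[OF F(1)] by (auto simp: indicator_def)
      then show ?thesis
        unfolding f_def q lin h_def[symmetric] l_def[symmetric] by (simp add: algebra_simps)
    qed
    moreover have "y \<le> R" if "0 \<le> y" "?q y \<le> 1" for y
    proof -
      have "\<forall>j\<in>F. 0 \<le> (x(i := y)) j" using True that E by auto
      then have "(x(i := y)) i \<le> R"
        using co that(2) F(2) unfolding coercive_def q[symmetric] by blast
      then show ?thesis by simp
    qed
    ultimately have "(\<integral>y. f (x(i := y)) \<partial>lborel) = - l * cutoff (qform E H x)"
      using integral_half_line[of "H i i" "2 * h" "qform E H x" R "L i" l] by simp
    also have "orthant E x = 1" using True by (auto simp: orthant_eq[OF E(1)])
    then have "- l * cutoff (qform E H x) = - (\<Sum>m\<in>E. L m * (orthant E x * x m * cutoff (qform E H x)))"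
      by (simp add: l_def sum_distrib_right mult.assoc)
    finally show ?thesis .
  qed
  have "(\<integral>x. f x \<partial>Pi\<^sub>M F (\<lambda>_. lborel)) = (\<integral>x. (\<integral>y. f (x(i := y)) \<partial>lborel) \<partial>Pi\<^sub>M E (\<lambda>_. lborel))"
    using int unfolding E(3) by (intro product_integral_insert E)
  also have "\<dots> = - (\<Sum>m\<in>E. L m * cone_moment E H m)"
    unfolding inner cone_moment_def
    by (simp add: Bochner_Integration.integral_sum integrable_cone_moment[OF E(1) _ coE])
  finally show "(\<integral>x. f x \<partial>Pi\<^sub>M F (\<lambda>_. lborel)) = - (\<Sum>m\<in>F - {i}. L m * cone_moment (F - {i}) H m)"
    by (simp add: E_def)
qed

lemma integrable_cone_integrand:
  assumes F: "finite F" and co: "coercive F H R"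
  shows "integrable (Pi\<^sub>M F (\<lambda>_. lborel)) (\<lambda>x. orthant F x * cutoff (qform F H x))"
proof (rule integrable_PiM_box[OF F(1), where R=R and K=1])
  fix x i assume "orthant F x * cutoff (qform F H x) \<noteq> 0" "i \<in> F"
  then show "0 \<le> x i \<and> x i \<le> R"
    using coerciveD[OF co, of x i] cutoff_eq_0[of "qform F H x"] F
    by (auto simp: orthant_eq not_le[symmetric])
next
  fix x :: "'a \<Rightarrow> real" assume x: "\<And>i. i \<in> F \<Longrightarrow> 0 \<le> x i \<and> x i \<le> R"
  have "\<bar>cutoff (qform F H x)\<bar> \<le> 1" using x coercive_nonneg[OF co] abs_cutoff_le by blast
  then show "\<bar>orthant F x * cutoff (qform F H x)\<bar> \<le> 1"
    by (auto simp: orthant_eq[OF F(1)])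
qed measurable

lemma qform_difference_bound:
  assumes x: "\<And>i. i \<in> F \<Longrightarrow> 0 \<le> x i \<and> x i \<le> R"
    and M: "\<And>i j. i \<in> F \<Longrightarrow> j \<in> F \<Longrightarrow> \<bar>H i j - H' i j\<bar> \<le> M i j"
  shows "\<bar>qform F H x - qform F H' x\<bar> \<le> (\<Sum>i\<in>F. \<Sum>j\<in>F. M i j * R * R)"
proof -
  have "qform F H x - qform F H' x = (\<Sum>i\<in>F. \<Sum>j\<in>F. (H i j - H' i j) * x i * x j)"
    by (simp add: qform_def sum_subtractf left_diff_distrib)
  also have "\<bar>\<dots>\<bar> \<le> (\<Sum>i\<in>F. \<Sum>j\<in>F. \<bar>(H i j - H' i j) * x i * x j\<bar>)"
    by (rule order_trans[OF sum_abs sum_mono[OF sum_abs]])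
  also have "\<dots> \<le> (\<Sum>i\<in>F. \<Sum>j\<in>F. M i j * R * R)"
  proof (intro sum_mono)
    fix i j assume ij: "i \<in> F" "j \<in> F"
    have "0 \<le> M i j" using M[OF ij] by linarith
    moreover have "0 \<le> R" using x[OF ij(1)] by linarith
    ultimately show "\<bar>(H i j - H' i j) * x i * x j\<bar> \<le> M i j * R * R"
      unfolding abs_mult using x[OF ij(1)] x[OF ij(2)] M[OF ij]
      by (intro mult_mono) auto
  qed
  finally show ?thesis .
qed

section \<open>Differentiation under the integral\<close>

text \<open>One R for all parameters near s confines all integrands to one box. There the difference
  quotients are bounded, because the cutoff is Lipschitz and the entries are differentiable, so
  dominated convergence applies along every sequence.\<close>

lemma has_real_derivative_cone_integral:
  fixes H :: "real \<Rightarrow> 'i \<Rightarrow> 'i \<Rightarrow> real"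
  assumes F: "finite F" and co: "coercive F (H s) R"
    and ev: "\<forall>\<^sub>F t in at s within S. coercive F (H t) R"
    and d: "\<And>i j. i \<in> F \<Longrightarrow> j \<in> F \<Longrightarrow> ((\<lambda>t. H t i j) has_real_derivative H' i j) (at s within S)"
  shows "((\<lambda>t. cone_integral F (H t)) has_real_derivative
    (\<integral>x. orthant F x * (cutoff_deriv (qform F (H s) x) * qform F H' x) \<partial>Pi\<^sub>M F (\<lambda>_. lborel))) (at s within S)"
  unfolding has_field_derivative_iff tendsto_at_iff_sequentially
proof (intro allI impI)
  fix X :: "nat \<Rightarrow> real" assume X: "\<forall>i. X i \<in> S - {s}" "X \<longlonglongrightarrow> s"
  define g where "g t x = orthant F x * cutoff (qform F (H t) x)" for t and x :: "'i \<Rightarrow> real"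
  \<comment> \<open>2 is the Lipschitz constant of the cutoff, \<open>\<bar>H' i j\<bar> + 1\<close>
    eventually bounds the difference quotient of an entry, and \<open>R * R\<close> bounds the
    product of two coordinates.\<close>
  define K where "K = 2 * (\<Sum>i\<in>F. \<Sum>j\<in>F. (\<bar>H' i j\<bar> + 1) * R * R)"
  define box where "box x = (\<Prod>i\<in>F. indicator {0..R} (x i) :: real)" for x :: "'i \<Rightarrow> real"
  have box: "box x = of_bool (\<forall>i\<in>F. 0 \<le> x i \<and> x i \<le> R)" for x
    using F unfolding box_def by (induction F rule: finite_induct) auto
  have Xs: "filterlim X (at s within S) sequentially"
    using X by (auto simp: filterlim_at)
  have lip: "\<forall>\<^sub>F t in at s within S. \<forall>i\<in>F. \<forall>j\<in>F. \<bar>H t i j - H s i j\<bar> \<le> (\<bar>H' i j\<bar> + 1) * \<bar>t - s\<bar>"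
  proof (intro eventually_ball_finite ballI F)
    fix i j assume "i \<in> F" "j \<in> F"
    then have "((\<lambda>t. \<bar>(H t i j - H s i j) / (t - s)\<bar>) \<longlongrightarrow> \<bar>H' i j\<bar>) (at s within S)"
      using d unfolding has_field_derivative_iff by (intro tendsto_rabs) auto
    then have "\<forall>\<^sub>F t in at s within S. \<bar>(H t i j - H s i j) / (t - s)\<bar> < \<bar>H' i j\<bar> + 1"
      by (rule order_tendstoD(2)) simp
    moreover have "\<forall>\<^sub>F t in at s within S. t \<noteq> s" by (simp add: eventually_at_filter)
    ultimately show "\<forall>\<^sub>F t in at s within S. \<bar>H t i j - H s i j\<bar> \<le> (\<bar>H' i j\<bar> + 1) * \<bar>t - s\<bar>"
      by eventually_elim (auto simp: abs_divide divide_less_eq)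
  qed
  have "\<forall>\<^sub>F n in sequentially. coercive F (H (X n)) R \<and>
      (\<forall>i\<in>F. \<forall>j\<in>F. \<bar>H (X n) i j - H s i j\<bar> \<le> (\<bar>H' i j\<bar> + 1) * \<bar>X n - s\<bar>)"
    using Xs ev lip by (auto simp: filterlim_iff intro: eventually_conj)
  then obtain N where N: "\<And>n. n \<ge> N \<Longrightarrow> coercive F (H (X n)) R"
    "\<And>n i j. n \<ge> N \<Longrightarrow> i \<in> F \<Longrightarrow> j \<in> F \<Longrightarrow> \<bar>H (X n) i j - H s i j\<bar> \<le> (\<bar>H' i j\<bar> + 1) * \<bar>X n - s\<bar>"
    unfolding eventually_sequentially by blast
  \<comment> \<open>Dominated convergence asks for the bound at every index, so the first N terms
    are dropped; \<open>LIMSEQ_offset\<close> restores them at the end.\<close>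
  define u where "u n x = (g (X (n + N)) x - g s x) / (X (n + N) - s)" for n x
  have "(\<lambda>n. \<integral>x. u n x \<partial>Pi\<^sub>M F (\<lambda>_. lborel)) \<longlonglongrightarrow>
      (\<integral>x. orthant F x * (cutoff_deriv (qform F (H s) x) * qform F H' x) \<partial>Pi\<^sub>M F (\<lambda>_. lborel))"
  proof (rule integral_dominated_convergence[where w="\<lambda>x. K * box x"])
    show "integrable (Pi\<^sub>M F (\<lambda>_. lborel)) (\<lambda>x. K * box x)"
    proof (intro integrable_mult_right integrable_PiM_box[OF F, where R=R and K=1])
      show "box \<in> borel_measurable (Pi\<^sub>M F (\<lambda>_. lborel))"
        unfolding box_def
        by (intro borel_measurable_prod measurable_compose[OF measurable_component_singleton borel_measurable_indicator]) auto
    qed (auto simp: box split: if_splits)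
    show "AE x in Pi\<^sub>M F (\<lambda>_. lborel). (\<lambda>n. u n x) \<longlonglongrightarrow>
        orthant F x * (cutoff_deriv (qform F (H s) x) * qform F H' x)"
    proof (rule AE_I2)
      fix x
      have "((\<lambda>t. qform F (H t) x) has_real_derivative qform F H' x) (at s within S)"
        unfolding qform_def by (intro DERIV_sum) (auto intro!: derivative_eq_intros d)
      then have "((\<lambda>t. cutoff (qform F (H t) x)) has_real_derivative
          cutoff_deriv (qform F (H s) x) * qform F H' x) (at s within S)"
        by (rule DERIV_chain2[OF has_real_derivative_cutoff])
      then have "((\<lambda>t. g t x) has_real_derivative
          orthant F x * (cutoff_deriv (qform F (H s) x) * qform F H' x)) (at s within S)"
        unfolding g_def by (rule DERIV_cmult)
      then have "((\<lambda>t. (g t x - g s x) / (t - s)) \<longlongrightarrow>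
          orthant F x * (cutoff_deriv (qform F (H s) x) * qform F H' x)) (at s within S)"
        by (simp add: has_field_derivative_iff)
      from filterlim_compose[OF this Xs]
      show "(\<lambda>n. u n x) \<longlonglongrightarrow> orthant F x * (cutoff_deriv (qform F (H s) x) * qform F H' x)"
        unfolding u_def by (rule LIMSEQ_ignore_initial_segment)
    qed
    fix n
    show "AE x in Pi\<^sub>M F (\<lambda>_. lborel). norm (u n x) \<le> K * box x"
    proof (rule AE_I2)
      fix x :: "'i \<Rightarrow> real"
      let ?t = "X (n + N)"
      have t: "?t \<noteq> s" using X by auto
      have cot: "coercive F (H ?t) R" using N by simp
      show "norm (u n x) \<le> K * box x"
      proof (cases "\<forall>i\<in>F. 0 \<le> x i \<and> x i \<le> R")
        case True
        then have x: "\<And>i. i \<in> F \<Longrightarrow> 0 \<le> x i \<and> x i \<le> R" by blast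
        have o: "orthant F x = 1" using True by (simp add: orthant_eq[OF F])
        have "\<bar>cutoff (qform F (H ?t) x) - cutoff (qform F (H s) x)\<bar> \<le>
            2 * \<bar>qform F (H ?t) x - qform F (H s) x\<bar>"
          using x coercive_nonneg[OF cot] coercive_nonneg[OF co] by (intro cutoff_lipschitz) auto
        also have "\<dots> \<le> 2 * (\<Sum>i\<in>F. \<Sum>j\<in>F. ((\<bar>H' i j\<bar> + 1) * \<bar>?t - s\<bar>) * R * R)"
          using qform_difference_bound[OF x, where H="H ?t" and H'="H s" and M="\<lambda>i j. (\<bar>H' i j\<bar> + 1) * \<bar>?t - s\<bar>"]
            N(2)[of "n + N"]
          by simp
        also have "\<dots> = K * \<bar>?t - s\<bar>"
          by (simp add: K_def sum_distrib_left sum_distrib_right algebra_simps)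
        finally show ?thesis
          using t True unfolding u_def g_def o box by (simp add: divide_le_eq)
      next
        case False
        have "g \<tau> x = 0" if "coercive F (H \<tau>) R" for \<tau>
          using coerciveD[OF that, of x] False cutoff_eq_0[of "qform F (H \<tau>) x"]
          unfolding g_def orthant_eq[OF F] by (cases "qform F (H \<tau>) x < 1") auto
        then have "u n x = 0" using cot co by (simp add: u_def)
        moreover have "box x = 0" using False unfolding box by simp
        ultimately show ?thesis by simp
      qed
    qed
    show "u n \<in> borel_measurable (Pi\<^sub>M F (\<lambda>_. lborel))"
      unfolding u_def g_def by measurable
  qed measurable
  moreover have "(\<integral>x. u n x \<partial>Pi\<^sub>M F (\<lambda>_. lborel)) =
      (cone_integral F (H (X (n + N))) - cone_integral F (H s)) / (X (n + N) - s)" for n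
    unfolding u_def g_def cone_integral_def
    using integrable_cone_integrand[OF F co] integrable_cone_integrand[OF F N(1)[of "n + N"]]
    by simp
  ultimately have "(\<lambda>n. (cone_integral F (H (X (n + N))) - cone_integral F (H s)) / (X (n + N) - s)) \<longlonglongrightarrow>
      (\<integral>x. orthant F x * (cutoff_deriv (qform F (H s) x) * qform F H' x) \<partial>Pi\<^sub>M F (\<lambda>_. lborel))"
    by simp
  then show "((\<lambda>t. (cone_integral F (H t) - cone_integral F (H s)) / (t - s)) \<circ> X) \<longlonglongrightarrow>
      (\<integral>x. orthant F x * (cutoff_deriv (qform F (H s) x) * qform F H' x) \<partial>Pi\<^sub>M F (\<lambda>_. lborel))"
    unfolding o_def by (rule LIMSEQ_offset)
qed

section \<open>Polar coordinates on the orthant\<close>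

lemma PiM_lborel_scale:
  fixes r :: real
  assumes "finite I" "0 < r"
  shows "Pi\<^sub>M I (\<lambda>_. lborel) = density (distr (Pi\<^sub>M I (\<lambda>_. lborel)) (Pi\<^sub>M I (\<lambda>_. lborel)) (\<lambda>x. \<lambda>i\<in>I. r * x i))
    (\<lambda>_. ennreal (r ^ card I))"
proof (rule sym)
  interpret product_sigma_finite "\<lambda>_::'a. lborel :: real measure" by standard
  let ?h = "\<lambda>x. \<lambda>i\<in>I. r * x i"
  have [measurable]: "?h \<in> measurable (Pi\<^sub>M I (\<lambda>_. lborel)) (Pi\<^sub>M I (\<lambda>_. lborel))"
    by (intro measurable_restrict) (simp add: measurable_lborel_component)
  show "density (distr (Pi\<^sub>M I (\<lambda>_. lborel)) (Pi\<^sub>M I (\<lambda>_. lborel)) ?h) (\<lambda>_. ennreal (r ^ card I)) = Pi\<^sub>M I (\<lambda>_. lborel)"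
  proof (rule PiM_eqI[OF assms(1)])
    fix A :: "'a \<Rightarrow> real set" assume A: "\<And>i. i \<in> I \<Longrightarrow> A i \<in> sets lborel"
    have sets: "Pi\<^sub>E I A \<in> sets (Pi\<^sub>M I (\<lambda>_. lborel))" using A assms(1) by (intro sets_PiM_I_finite) auto
    have vim: "(\<lambda>x. r * x) -` A i \<in> sets lborel" if "i \<in> I" for i
      using measurable_sets[of "\<lambda>x. r * x" borel borel "A i"] A[OF that] by simp
    have pre: "?h -` Pi\<^sub>E I A \<inter> space (Pi\<^sub>M I (\<lambda>_. lborel)) = Pi\<^sub>E I (\<lambda>i. (\<lambda>x. r * x) -` A i)"
      by (auto simp: space_PiM PiE_iff)
    have one: "emeasure lborel (A i) = ennreal r * emeasure lborel ((\<lambda>x. r * x) -` A i)" if "i \<in> I" for i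
    proof -
      have "emeasure lborel (A i) = (\<integral>\<^sup>+x. indicator (A i) x \<partial>lborel)" using A[OF that] by simp
      also have "\<dots> = \<bar>r\<bar> * (\<integral>\<^sup>+x. indicator (A i) (0 + r * x) \<partial>lborel)"
        using A[OF that] assms(2) by (intro nn_integral_real_affine) auto
      also have "(\<integral>\<^sup>+x. indicator (A i) (0 + r * x) \<partial>lborel) = (\<integral>\<^sup>+x. indicator ((\<lambda>x. r * x) -` A i) x \<partial>lborel)"
        by (intro nn_integral_cong) (simp add: indicator_def)
      also have "\<dots> = emeasure lborel ((\<lambda>x. r * x) -` A i)" using vim[OF that] by simp
      finally show ?thesis using assms(2) by simp
    qed
    have "emeasure (density (distr (Pi\<^sub>M I (\<lambda>_. lborel)) (Pi\<^sub>M I (\<lambda>_. lborel)) ?h) (\<lambda>_. ennreal (r ^ card I))) (Pi\<^sub>E I A) =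
        ennreal (r ^ card I) * emeasure (Pi\<^sub>M I (\<lambda>_. lborel)) (Pi\<^sub>E I (\<lambda>i. (\<lambda>x. r * x) -` A i))"
      using sets by (simp add: emeasure_density_const emeasure_distr pre)
    also have "emeasure (Pi\<^sub>M I (\<lambda>_. lborel)) (Pi\<^sub>E I (\<lambda>i. (\<lambda>x. r * x) -` A i)) =
        (\<Prod>i\<in>I. emeasure lborel ((\<lambda>x. r * x) -` A i))"
      using assms(1) vim by (intro emeasure_PiM) auto
    also have "ennreal (r ^ card I) * \<dots> = (\<Prod>i\<in>I. ennreal r * emeasure lborel ((\<lambda>x. r * x) -` A i))"
      using assms(2) by (simp add: prod.distrib ennreal_power)
    also have "\<dots> = (\<Prod>i\<in>I. emeasure lborel (A i))" using one by simp
    finally show "emeasure (density (distr (Pi\<^sub>M I (\<lambda>_. lborel)) (Pi\<^sub>M I (\<lambda>_. lborel)) ?h) (\<lambda>_. ennreal (r ^ card I))) (Pi\<^sub>E I A) =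
        (\<Prod>i\<in>I. emeasure lborel (A i))" .
  qed simp
qed

lemma nn_integral_PiM_lborel_scale:
  fixes r :: real
  assumes "finite I" "0 < r" and [measurable]: "f \<in> borel_measurable (Pi\<^sub>M I (\<lambda>_. lborel))"
  shows "(\<integral>\<^sup>+x. f x \<partial>Pi\<^sub>M I (\<lambda>_. lborel)) =
    ennreal (r ^ card I) * (\<integral>\<^sup>+x. f (\<lambda>i\<in>I. r * x i) \<partial>Pi\<^sub>M I (\<lambda>_. lborel))"
proof -
  have [measurable]: "(\<lambda>x. \<lambda>i\<in>I. r * x i) \<in> measurable (Pi\<^sub>M I (\<lambda>_. lborel)) (Pi\<^sub>M I (\<lambda>_. lborel))"
    by (intro measurable_restrict) (simp add: measurable_lborel_component)
  show ?thesis
    by (subst PiM_lborel_scale[OF assms(1,2)]) (simp add: nn_integral_density nn_integral_distr nn_integral_cmult)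
qed

lemma PiM_lborel_reindex:
  assumes "finite S" "inj_on f S"
  shows "distr (Pi\<^sub>M S (\<lambda>_. lborel)) (Pi\<^sub>M (f ` S) (\<lambda>_. lborel)) (\<lambda>x. \<lambda>j\<in>f ` S. x (inv_into S f j)) =
    Pi\<^sub>M (f ` S) (\<lambda>_. lborel :: real measure)"
proof -
  interpret product_sigma_finite "\<lambda>_. lborel :: real measure" by standard
  let ?h = "\<lambda>x. \<lambda>j\<in>f ` S. x (inv_into S f j)"
  have h: "?h \<in> measurable (Pi\<^sub>M S (\<lambda>_. lborel)) (Pi\<^sub>M (f ` S) (\<lambda>_. lborel :: real measure))"
    by (intro measurable_restrict) (use assms in \<open>auto simp: measurable_lborel_component\<close>)
  show ?thesis
  proof (rule PiM_eqI)
    fix A :: "_ \<Rightarrow> real set" assume A: "\<And>i. i \<in> f ` S \<Longrightarrow> A i \<in> sets lborel"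
    have pre: "?h -` Pi\<^sub>E (f ` S) A \<inter> space (Pi\<^sub>M S (\<lambda>_. lborel)) = Pi\<^sub>E S (\<lambda>i. A (f i))"
      using assms by (auto simp: space_PiM PiE_iff)
    have "emeasure (distr (Pi\<^sub>M S (\<lambda>_. lborel)) (Pi\<^sub>M (f ` S) (\<lambda>_. lborel)) ?h) (Pi\<^sub>E (f ` S) A) =
        emeasure (Pi\<^sub>M S (\<lambda>_. lborel)) (Pi\<^sub>E S (\<lambda>i. A (f i)))"
      using assms A by (subst emeasure_distr[OF h]) (auto simp: pre intro!: sets_PiM_I_finite)
    also have "\<dots> = (\<Prod>i\<in>S. emeasure lborel (A (f i)))"
      using assms A by (intro emeasure_PiM) auto
    also have "\<dots> = (\<Prod>i\<in>f ` S. emeasure lborel (A i))"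
      using assms by (simp add: prod.reindex)
    finally show "emeasure (distr (Pi\<^sub>M S (\<lambda>_. lborel)) (Pi\<^sub>M (f ` S) (\<lambda>_. lborel)) ?h) (Pi\<^sub>E (f ` S) A) =
        (\<Prod>i\<in>f ` S. emeasure lborel (A i))" .
  qed (use assms in auto)
qed

lemma cone_integral_reindex:
  assumes "finite S" "inj_on f S"
  shows "cone_integral (f ` S) H = cone_integral S (\<lambda>i j. H (f i) (f j))"
proof -
  let ?h = "\<lambda>x. \<lambda>j\<in>f ` S. x (inv_into S f j) :: real"
  have h: "?h \<in> measurable (Pi\<^sub>M S (\<lambda>_. lborel)) (Pi\<^sub>M (f ` S) (\<lambda>_. lborel :: real measure))"
    by (intro measurable_restrict) (use assms in \<open>auto simp: measurable_lborel_component\<close>)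
  have "cone_integral (f ` S) H =
      (\<integral>x. orthant (f ` S) (?h x) * cutoff (qform (f ` S) H (?h x)) \<partial>Pi\<^sub>M S (\<lambda>_. lborel))"
    unfolding cone_integral_def
    by (subst PiM_lborel_reindex[OF assms, symmetric], subst integral_distr[OF h]) simp_all
  also have "\<dots> = cone_integral S (\<lambda>i j. H (f i) (f j))"
    unfolding cone_integral_def orthant_def qform_def
    using assms by (simp add: prod.reindex sum.reindex)
  finally show ?thesis .
qed

text \<open>The dependent coordinate comes last, so that the others are the coordinates of
  \<open>std_simplex\<close>. The restriction to \<open>{..k}\<close> makes the value a point of the
  product space.\<close>

definition barycentric :: "nat \<Rightarrow> (nat \<Rightarrow> real) \<Rightarrow> nat \<Rightarrow> real" where
  "barycentric k x = (\<lambda>i\<in>{..k}. if i < k then x i else 1 - (\<Sum>i<k. x i))"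

lemma sum_barycentric: "(\<Sum>j\<le>k. barycentric k x j) = 1"
  unfolding lessThan_Suc_atMost[symmetric] by (simp add: barycentric_def)

lemma measurable_barycentric [measurable]:
  "barycentric k \<in> measurable (Pi\<^sub>M {..<k} (\<lambda>_. lborel)) (Pi\<^sub>M {..k} (\<lambda>_. lborel :: real measure))"
  unfolding barycentric_def
proof (rule measurable_restrict)
  fix i assume "i \<in> {..k}"
  have 1: "(\<lambda>x. \<Sum>i<k. x i) \<in> borel_measurable (Pi\<^sub>M {..<k} (\<lambda>_. lborel :: real measure))"
    by (intro borel_measurable_sum measurable_lborel_component) auto
  show "(\<lambda>x. if i < k then x i else 1 - (\<Sum>i<k. x i)) \<in> measurable (Pi\<^sub>M {..<k} (\<lambda>_. lborel)) (lborel :: real measure)"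
    using 1 by (cases "i < k") (auto intro: measurable_lborel_component)
qed

lemma orthant_barycentric:
  assumes "x \<in> space (Pi\<^sub>M {..<k} (\<lambda>_. lborel :: real measure))"
  shows "orthant {..k} (barycentric k x) = indicator (std_simplex k) x"
proof -
  have ins: "{..k} = insert k {..<k}" by auto
  have "(\<forall>i\<in>{..k}. 0 \<le> barycentric k x i) \<longleftrightarrow> (\<forall>i<k. 0 \<le> x i) \<and> (\<Sum>i<k. x i) \<le> 1"
    unfolding ins by (auto simp: barycentric_def)
  then show ?thesis
    using assms unfolding std_simplex_def space_PiM orthant_eq[OF finite_atMost] by (simp add: indicator_def)
qed

lemma measurable_std_simplex [measurable]: "std_simplex k \<in> sets (Pi\<^sub>M {..<k} (\<lambda>_. lborel :: real measure))"
proof -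
  have "std_simplex k = {x \<in> space (Pi\<^sub>M {..<k} (\<lambda>_. lborel :: real measure)). orthant {..k} (barycentric k x) = 1}"
  proof (intro equalityI subsetI)
    fix x assume "x \<in> std_simplex k"
    then show "x \<in> {x \<in> space (Pi\<^sub>M {..<k} (\<lambda>_. lborel :: real measure)). orthant {..k} (barycentric k x) = 1}"
      using orthant_barycentric[of x k] by (auto simp: std_simplex_def space_PiM)
  next
    fix x assume "x \<in> {x \<in> space (Pi\<^sub>M {..<k} (\<lambda>_. lborel :: real measure)). orthant {..k} (barycentric k x) = 1}"
    then show "x \<in> std_simplex k"
      using orthant_barycentric[of x k] by (auto simp: indicator_def split: if_splits)
  qed
  also have "\<dots> \<in> sets (Pi\<^sub>M {..<k} (\<lambda>_. lborel))" by measurable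
  finally show ?thesis .
qed

text \<open>The last coordinate is replaced by the sum r of all coordinates, and then the other coordinates are
  divided by r.\<close>

lemma nn_integral_orthant_polar:
  assumes [measurable]: "g \<in> borel_measurable (Pi\<^sub>M {..k} (\<lambda>_. lborel))"
  shows "(\<integral>\<^sup>+x. ennreal (orthant {..k} x) * g x \<partial>Pi\<^sub>M {..k} (\<lambda>_. lborel)) =
    (\<integral>\<^sup>+x. indicator (std_simplex k) x *
      (\<integral>\<^sup>+r. indicator {0<..} r * (ennreal (r ^ k) * g (\<lambda>i\<in>{..k}. r * barycentric k x i)) \<partial>lborel) \<partial>Pi\<^sub>M {..<k} (\<lambda>_. lborel))"
proof -
  interpret product_sigma_finite "\<lambda>_::nat. lborel :: real measure" by standard
  interpret fp: finite_product_sigma_finite "\<lambda>_::nat. lborel :: real measure" "{..<k}" by standard simp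
  let ?M = "Pi\<^sub>M {..<k} (\<lambda>_. lborel :: real measure)"
  interpret pair: pair_sigma_finite ?M "lborel :: real measure" by standard
  define G where "G x = ennreal (orthant {..k} x) * g x" for x
  have ins: "{..k} = insert k {..<k}" by auto
  have G[measurable]: "G \<in> borel_measurable (Pi\<^sub>M {..k} (\<lambda>_. lborel))"
    unfolding G_def by measurable
  have G': "G \<in> borel_measurable (Pi\<^sub>M (insert k {..<k}) (\<lambda>_. lborel))" using G by (simp only: ins)
  have s[measurable]: "(\<lambda>x. \<Sum>i<k. x i) \<in> borel_measurable ?M"
    by (intro borel_measurable_sum measurable_lborel_component) auto
  have upd[measurable]: "(\<lambda>(x, y). x(k := y)) \<in> measurable (?M \<Otimes>\<^sub>M lborel) (Pi\<^sub>M {..k} (\<lambda>_. lborel))"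
    using measurable_add_dim[of k "{..<k}" "\<lambda>_. lborel :: real measure"] by (simp only: ins)
  have shear[measurable]: "(\<lambda>(x, r). x(k := r - (\<Sum>i<k. x i))) \<in> measurable (?M \<Otimes>\<^sub>M lborel) (Pi\<^sub>M {..k} (\<lambda>_. lborel))"
  proof -
    have "(\<lambda>(x, r). (x, r - (\<Sum>i<k. x i))) \<in> measurable (?M \<Otimes>\<^sub>M lborel) (?M \<Otimes>\<^sub>M lborel)"
      by measurable
    from measurable_compose[OF this upd] show ?thesis by (simp add: case_prod_beta')
  qed
  have updx: "(\<lambda>y. G (x(k := y))) \<in> borel_measurable borel" if "x \<in> space ?M" for x
    using measurable_compose[OF measurable_Pair2[OF upd that] G] by simp
  have scaled[measurable]: "(\<lambda>(x, r). \<lambda>i\<in>{..k}. r * barycentric k x i) \<in> measurable (?M \<Otimes>\<^sub>M lborel) (Pi\<^sub>M {..k} (\<lambda>_. lborel))"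
  proof -
    have "(\<lambda>z. \<lambda>i\<in>{..k}. snd z * barycentric k (fst z) i) \<in> measurable (?M \<Otimes>\<^sub>M lborel) (Pi\<^sub>M {..k} (\<lambda>_. lborel))"
    proof (rule measurable_restrict)
      fix i assume "i \<in> {..k}"
      then have [measurable]: "(\<lambda>x. barycentric k x i) \<in> borel_measurable ?M"
        by (intro measurable_compose[OF measurable_barycentric measurable_lborel_component])
      show "(\<lambda>z. snd z * barycentric k (fst z) i) \<in> measurable (?M \<Otimes>\<^sub>M lborel) lborel"
        by measurable
    qed
    then show ?thesis by (simp add: case_prod_beta')
  qed
  have "(\<integral>\<^sup>+x. G x \<partial>Pi\<^sub>M {..k} (\<lambda>_. lborel)) = (\<integral>\<^sup>+x. (\<integral>\<^sup>+y. G (x(k := y)) \<partial>lborel) \<partial>?M)"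
    unfolding ins by (rule product_nn_integral_insert) (use G' in auto)
  also have "\<dots> = (\<integral>\<^sup>+x. (\<integral>\<^sup>+r. G (x(k := r - (\<Sum>i<k. x i))) \<partial>lborel) \<partial>?M)"
  proof (rule nn_integral_cong)
    fix x assume "x \<in> space ?M"
    from nn_integral_real_affine[OF updx[OF this], of 1 "- (\<Sum>i<k. x i)"]
    show "(\<integral>\<^sup>+y. G (x(k := y)) \<partial>lborel) = (\<integral>\<^sup>+r. G (x(k := r - (\<Sum>i<k. x i))) \<partial>lborel)"
      by simp
  qed
  also have "\<dots> = (\<integral>\<^sup>+r. (\<integral>\<^sup>+x. G (x(k := r - (\<Sum>i<k. x i))) \<partial>?M) \<partial>lborel)"
    by (rule pair.Fubini'[symmetric]) (use measurable_compose[OF shear G] in \<open>simp add: case_prod_beta'\<close>)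
  also have "\<dots> = (\<integral>\<^sup>+r. (\<integral>\<^sup>+x. indicator (std_simplex k) x * (indicator {0<..} r *
      (ennreal (r ^ k) * g (\<lambda>i\<in>{..k}. r * barycentric k x i))) \<partial>?M) \<partial>lborel)"
  \<comment> \<open>The null set r = 0 is discarded. For r < 0 no nonnegative point has coordinate
    sum r. For r > 0 the k free coordinates are scaled by r, which produces the factor r^k.\<close>
  proof (rule nn_integral_cong_AE, rule AE_mp[OF AE_lborel_singleton[of 0]], rule AE_I2, rule impI)
    fix r :: real assume "r \<noteq> 0"
    then consider "r < 0" | "0 < r" by linarith
    then show "(\<integral>\<^sup>+x. G (x(k := r - (\<Sum>i<k. x i))) \<partial>?M) = (\<integral>\<^sup>+x. indicator (std_simplex k) x * (indicator {0<..} r *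
      (ennreal (r ^ k) * g (\<lambda>i\<in>{..k}. r * barycentric k x i))) \<partial>?M)"
    proof cases
      case 1
      have "G (x(k := r - (\<Sum>i<k. x i))) = 0" for x
      proof (cases "\<forall>i<k. 0 \<le> x i")
        case True
        then have "0 \<le> (\<Sum>i<k. x i)" by (intro sum_nonneg) auto
        then have "\<not> 0 \<le> (x(k := r - (\<Sum>i<k. x i))) k" using 1 by simp
        then have "orthant {..k} (x(k := r - (\<Sum>i<k. x i))) = 0"
          unfolding orthant_eq[OF finite_atMost] by (auto simp del: fun_upd_apply)
        then show ?thesis by (simp add: G_def)
      next
        case False
        then obtain i where "i < k" "\<not> 0 \<le> x i" by auto
        then have "\<not> (\<forall>i\<in>{..k}. 0 \<le> (x(k := r - (\<Sum>i<k. x i))) i)" by (auto intro!: bexI[of _ i])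
        then show ?thesis unfolding G_def orthant_eq[OF finite_atMost] by simp
      qed
      then show ?thesis using 1 by simp
    next
      case 2
      have "(\<lambda>x. G (x(k := r - (\<Sum>i<k. x i)))) \<in> borel_measurable ?M"
        using measurable_compose[OF measurable_Pair1[OF shear] G, of r] by simp
      then have "(\<integral>\<^sup>+x. G (x(k := r - (\<Sum>i<k. x i))) \<partial>?M) =
          ennreal (r ^ k) * (\<integral>\<^sup>+x. G ((\<lambda>i\<in>{..<k}. r * x i)(k := r - (\<Sum>i<k. (\<lambda>i\<in>{..<k}. r * x i) i))) \<partial>?M)"
        using nn_integral_PiM_lborel_scale[OF _ 2, of "{..<k}" "\<lambda>x. G (x(k := r - (\<Sum>i<k. x i)))"] by simp
      also have "(\<integral>\<^sup>+x. G ((\<lambda>i\<in>{..<k}. r * x i)(k := r - (\<Sum>i<k. (\<lambda>i\<in>{..<k}. r * x i) i))) \<partial>?M) =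
          (\<integral>\<^sup>+x. indicator (std_simplex k) x * g (\<lambda>i\<in>{..k}. r * barycentric k x i) \<partial>?M)"
      proof (rule nn_integral_cong)
        fix x assume x: "x \<in> space ?M"
        have "(\<lambda>i\<in>{..<k}. r * x i)(k := r - (\<Sum>i<k. (\<lambda>i\<in>{..<k}. r * x i) i)) = (\<lambda>i\<in>{..k}. r * barycentric k x i)"
          by (auto simp: fun_eq_iff barycentric_def sum_distrib_left right_diff_distrib)
        moreover have "orthant {..k} (\<lambda>i\<in>{..k}. r * barycentric k x i) = orthant {..k} (barycentric k x)"
          using 2 by (auto simp: orthant_eq zero_le_mult_iff)
        ultimately show "G ((\<lambda>i\<in>{..<k}. r * x i)(k := r - (\<Sum>i<k. (\<lambda>i\<in>{..<k}. r * x i) i))) =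
            indicator (std_simplex k) x * g (\<lambda>i\<in>{..k}. r * barycentric k x i)"
          unfolding G_def by (simp add: orthant_barycentric[OF x] indicator_def)
      qed
      also have "ennreal (r ^ k) * \<dots> = (\<integral>\<^sup>+x. ennreal (r ^ k) * (indicator (std_simplex k) x * g (\<lambda>i\<in>{..k}. r * barycentric k x i)) \<partial>?M)"
      proof (rule nn_integral_cmult[symmetric])
        have "(\<lambda>x. \<lambda>i\<in>{..k}. r * barycentric k x i) \<in> measurable ?M (Pi\<^sub>M {..k} (\<lambda>_. lborel))"
          using measurable_Pair1[OF scaled, of r] by simp
        from measurable_compose[OF this assms]
        show "(\<lambda>x. indicator (std_simplex k) x * g (\<lambda>i\<in>{..k}. r * barycentric k x i)) \<in> borel_measurable ?M"
          by measurable
      qed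
      finally show ?thesis using 2 by (simp add: mult_ac del: fun_upd_apply)
    qed
  qed
  also have "\<dots> = (\<integral>\<^sup>+x. (\<integral>\<^sup>+r. indicator (std_simplex k) x * (indicator {0<..} r *
      (ennreal (r ^ k) * g (\<lambda>i\<in>{..k}. r * barycentric k x i))) \<partial>lborel) \<partial>?M)"
    by (rule pair.Fubini') (use measurable_compose[OF scaled assms] in \<open>simp add: case_prod_beta'\<close>)
  also have "\<dots> = (\<integral>\<^sup>+x. indicator (std_simplex k) x *
      (\<integral>\<^sup>+r. indicator {0<..} r * (ennreal (r ^ k) * g (\<lambda>i\<in>{..k}. r * barycentric k x i)) \<partial>lborel) \<partial>?M)"
  proof (rule nn_integral_cong)
    fix x assume "x \<in> space ?M"
    show "(\<integral>\<^sup>+r. indicator (std_simplex k) x * (indicator {0<..} r *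
      (ennreal (r ^ k) * g (\<lambda>i\<in>{..k}. r * barycentric k x i))) \<partial>lborel) = indicator (std_simplex k) x *
      (\<integral>\<^sup>+r. indicator {0<..} r * (ennreal (r ^ k) * g (\<lambda>i\<in>{..k}. r * barycentric k x i)) \<partial>lborel)"
      by (cases "x \<in> std_simplex k") auto
  qed
  finally show ?thesis unfolding G_def .
qed

section \<open>The radial factor\<close>

definition radial_constant :: "nat \<Rightarrow> ennreal" where
  "radial_constant k = (\<integral>\<^sup>+r. indicator {0<..} r * ennreal (r ^ k * cutoff (r\<^sup>2)) \<partial>lborel)"

lemma radial_constant_finite: "radial_constant k < \<infinity>"
proof -
  have "radial_constant k \<le> (\<integral>\<^sup>+r. indicator {0..1::real} r \<partial>lborel)"
    unfolding radial_constant_def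
  proof (rule nn_integral_mono)
    fix r :: real
    show "indicator {0<..} r * ennreal (r ^ k * cutoff (r\<^sup>2)) \<le> indicator {0..1} r"
    proof (cases "0 < r \<and> r \<le> 1")
      case True
      then have "r ^ k * cutoff (r\<^sup>2) \<le> 1 * 1"
        using abs_cutoff_le(1)[of "r\<^sup>2"] cutoff_nonneg[of "r\<^sup>2"] by (intro mult_mono power_le_one) auto
      then show ?thesis using True by (simp add: ennreal_le_1)
    next
      case False
      then have "r \<le> 0 \<or> 1 \<le> r\<^sup>2" by (auto simp: one_le_power)
      then show ?thesis by (auto simp: cutoff_eq_0)
    qed
  qed
  also have "\<dots> < \<infinity>" by (simp add: emeasure_lborel_Icc_eq)
  finally show ?thesis .
qed

lemma radial_constant_pos: "0 < radial_constant k"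
proof -
  \<comment> \<open>A lower bound on an interval inside the support: on [1/4, 1/2] the power is at
    least (1/4)^k and the cutoff of r^2 is at least (1/2)^2 = 1/4.\<close>
  have "0 < ennreal ((1/4) ^ k * (1/4)) * emeasure lborel {1/4..1/2 :: real}"
    by (simp add: ennreal_zero_less_mult_iff)
  also have "\<dots> = (\<integral>\<^sup>+r. ennreal ((1/4) ^ k * (1/4)) * indicator {1/4..1/2 :: real} r \<partial>lborel)"
    by (simp add: nn_integral_cmult)
  also have "\<dots> \<le> radial_constant k"
    unfolding radial_constant_def
  proof (rule nn_integral_mono)
    fix r :: real
    show "ennreal ((1/4) ^ k * (1/4)) * indicator {1/4..1/2} r \<le> indicator {0<..} r * ennreal (r ^ k * cutoff (r\<^sup>2))"
    proof (cases "r \<in> {1/4..1/2}")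
      case True
      have "r\<^sup>2 \<le> (1/2)\<^sup>2" using True by (intro power_mono) auto
      then have "(1/2)\<^sup>2 \<le> (1 - r\<^sup>2)\<^sup>2" by (intro power_mono) (auto simp: power2_eq_square)
      then have "(1/4) ^ k * (1/4) \<le> r ^ k * cutoff (r\<^sup>2)"
        using True \<open>r\<^sup>2 \<le> (1/2)\<^sup>2\<close>
        by (intro mult_mono power_mono) (auto simp: cutoff_def max_def power2_eq_square)
      then show ?thesis using True by (simp add: ennreal_leI)
    qed simp
  qed
  finally show ?thesis .
qed

text \<open>Substituting r / sqrt Q for r makes the argument of the cutoff r^2; the k factors r and
  the differential contribute k + 1 powers of 1 / sqrt Q.\<close>

lemma radial_integral:
  assumes "0 < Q"
  shows "(\<integral>\<^sup>+r. indicator {0<..} r * (ennreal (r ^ k) * ennreal (cutoff (r\<^sup>2 * Q))) \<partial>lborel) =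
    radial_constant k * ennreal (1 / sqrt (Q ^ (k + 1)))"
proof -
  define c where "c = 1 / sqrt Q"
  have c: "0 < c" "c\<^sup>2 * Q = 1" using assms by (auto simp: c_def power_divide)
  have "(\<integral>\<^sup>+r. indicator {0<..} r * (ennreal (r ^ k) * ennreal (cutoff (r\<^sup>2 * Q))) \<partial>lborel) =
      \<bar>c\<bar> * (\<integral>\<^sup>+r. indicator {0<..} (0 + c * r) * (ennreal ((0 + c * r) ^ k) * ennreal (cutoff ((0 + c * r)\<^sup>2 * Q))) \<partial>lborel)"
    using c by (intro nn_integral_real_affine) auto
  also have "(\<integral>\<^sup>+r. indicator {0<..} (0 + c * r) * (ennreal ((0 + c * r) ^ k) * ennreal (cutoff ((0 + c * r)\<^sup>2 * Q))) \<partial>lborel) =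
      (\<integral>\<^sup>+r. ennreal (c ^ k) * (indicator {0<..} r * ennreal (r ^ k * cutoff (r\<^sup>2))) \<partial>lborel)"
  proof (rule nn_integral_cong)
    fix r :: real
    have "(c * r)\<^sup>2 * Q = r\<^sup>2 * (c\<^sup>2 * Q)" by (simp add: power_mult_distrib)
    then have "cutoff ((0 + c * r)\<^sup>2 * Q) = cutoff (r\<^sup>2)" using c by simp
    moreover have "(0 + c * r) ^ k = c ^ k * r ^ k" by (simp add: power_mult_distrib)
    moreover have "0 < c * r \<longleftrightarrow> 0 < r" using c by (simp add: zero_less_mult_iff)
    ultimately show "indicator {0<..} (0 + c * r) * (ennreal ((0 + c * r) ^ k) * ennreal (cutoff ((0 + c * r)\<^sup>2 * Q))) =
        ennreal (c ^ k) * (indicator {0<..} r * ennreal (r ^ k * cutoff (r\<^sup>2)))"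
      using c cutoff_nonneg[of "r\<^sup>2"] by (auto simp: indicator_def ennreal_mult mult.assoc)
  qed
  also have "\<dots> = ennreal (c ^ k) * radial_constant k"
    unfolding radial_constant_def by (intro nn_integral_cmult) measurable
  also have "ennreal \<bar>c\<bar> * (ennreal (c ^ k) * radial_constant k) = radial_constant k * ennreal (c ^ (k + 1))"
    using c by (simp add: ennreal_mult mult_ac)
  also have "c ^ (k + 1) = 1 / sqrt (Q ^ (k + 1))"
    using assms by (simp add: c_def power_divide real_sqrt_power real_sqrt_mult)
  finally show ?thesis .
qed

text \<open>Integrating out the radius leaves a density which is, up to the Gram determinant, the
  Jacobian of the radial projection in \<open>projected_volume_eq\<close>. The profile survives only
  in the constant.\<close>

lemma cone_integral_eq:
  assumes co: "coercive {..k} H R"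
  shows "cone_integral {..k} H = enn2real (radial_constant k) *
    (LINT x:std_simplex k|Pi\<^sub>M {..<k} (\<lambda>_. lborel). 1 / sqrt (qform {..k} H (barycentric k x) ^ (k + 1)))"
proof -
  let ?M = "Pi\<^sub>M {..<k} (\<lambda>_. lborel :: real measure)"
  let ?Q = "\<lambda>x. qform {..k} H (barycentric k x)"
  have pos: "0 < ?Q x" if x: "x \<in> std_simplex k" for x
  proof -
    have nonneg: "0 \<le> barycentric k x i" if "i \<in> {..k}" for i
      using x that by (auto simp: barycentric_def std_simplex_def)
    have "\<exists>i\<in>{..k}. barycentric k x i \<noteq> 0"
      by (metis sum.neutral sum_barycentric zero_neq_one)
    then obtain i where "i \<in> {..k}" "0 < barycentric k x i" using nonneg by force
    then show ?thesis by (intro coercive_pos[OF co, of "barycentric k x" i] nonneg)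
  qed
  have [measurable]: "?Q \<in> borel_measurable ?M"
    by (rule measurable_compose[OF measurable_barycentric measurable_qform])
  have "(\<integral>\<^sup>+x. ennreal (orthant {..k} x * cutoff (qform {..k} H x)) \<partial>Pi\<^sub>M {..k} (\<lambda>_. lborel)) =
      (\<integral>\<^sup>+x. ennreal (orthant {..k} x) * ennreal (cutoff (qform {..k} H x)) \<partial>Pi\<^sub>M {..k} (\<lambda>_. lborel))"
    by (intro nn_integral_cong ennreal_mult) (auto simp: orthant_eq cutoff_nonneg)
  also have "\<dots> = (\<integral>\<^sup>+x. indicator (std_simplex k) x *
      (\<integral>\<^sup>+r. indicator {0<..} r * (ennreal (r ^ k) * ennreal (cutoff (qform {..k} H (\<lambda>i\<in>{..k}. r * barycentric k x i)))) \<partial>lborel) \<partial>?M)"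
    by (rule nn_integral_orthant_polar) measurable
  also have "\<dots> = (\<integral>\<^sup>+x. radial_constant k * ennreal (indicator (std_simplex k) x * (1 / sqrt (?Q x ^ (k + 1)))) \<partial>?M)"
  proof (rule nn_integral_cong)
    fix x
    have q: "qform {..k} H (\<lambda>i\<in>{..k}. r * barycentric k x i) = r\<^sup>2 * ?Q x" for r
      unfolding qform_scale[symmetric] by (simp add: qform_def)
    show "indicator (std_simplex k) x *
        (\<integral>\<^sup>+r. indicator {0<..} r * (ennreal (r ^ k) * ennreal (cutoff (qform {..k} H (\<lambda>i\<in>{..k}. r * barycentric k x i)))) \<partial>lborel) =
        radial_constant k * ennreal (indicator (std_simplex k) x * (1 / sqrt (?Q x ^ (k + 1))))"
      unfolding q using radial_integral[OF pos[of x], of k] by (cases "x \<in> std_simplex k") auto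
  qed
  also have "\<dots> = radial_constant k * (\<integral>\<^sup>+x. ennreal (indicator (std_simplex k) x * (1 / sqrt (?Q x ^ (k + 1)))) \<partial>?M)"
    by (rule nn_integral_cmult) measurable
  finally have eq: "(\<integral>\<^sup>+x. ennreal (orthant {..k} x * cutoff (qform {..k} H x)) \<partial>Pi\<^sub>M {..k} (\<lambda>_. lborel)) =
      radial_constant k * (\<integral>\<^sup>+x. ennreal (indicator (std_simplex k) x * (1 / sqrt (?Q x ^ (k + 1)))) \<partial>?M)" .
  have "cone_integral {..k} H = enn2real (\<integral>\<^sup>+x. ennreal (orthant {..k} x * cutoff (qform {..k} H x)) \<partial>Pi\<^sub>M {..k} (\<lambda>_. lborel))"
    unfolding cone_integral_def by (rule integral_eq_nn_integral) (auto simp: orthant_eq cutoff_nonneg)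
  also have "\<dots> = enn2real (radial_constant k) *
      enn2real (\<integral>\<^sup>+x. ennreal (indicator (std_simplex k) x * (1 / sqrt (?Q x ^ (k + 1)))) \<partial>?M)"
    unfolding eq by (rule enn2real_mult)
  also have "enn2real (\<integral>\<^sup>+x. ennreal (indicator (std_simplex k) x * (1 / sqrt (?Q x ^ (k + 1)))) \<partial>?M) =
      (LINT x:std_simplex k|?M. 1 / sqrt (?Q x ^ (k + 1)))"
    unfolding set_lebesgue_integral_def real_scaleR_def
    by (rule integral_eq_nn_integral[symmetric])
      (auto simp: indicator_def intro!: AE_I2 dest!: pos)
  finally show ?thesis .
qed

section \<open>Volumes of projected simplices\<close>

lemma coercive_reindex:
  assumes "inj_on f S" "coercive (f ` S) H R"
  shows "coercive S (\<lambda>i j. H (f i) (f j)) R"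
  unfolding coercive_def
proof (intro allI impI)
  fix x assume x: "(\<forall>i\<in>S. 0 \<le> x i) \<and> qform S (\<lambda>i j. H (f i) (f j)) x \<le> 1"
  let ?y = "\<lambda>j. x (inv_into S f j)"
  have "qform (f ` S) H ?y = qform S (\<lambda>i j. H (f i) (f j)) x"
    using assms(1) by (simp add: qform_def sum.reindex)
  then have "\<forall>j\<in>f ` S. ?y j \<le> R"
    using assms(2)[unfolded coercive_def, THEN spec, of ?y] x assms(1) by auto
  then show "\<forall>i\<in>S. x i \<le> R" using assms(1) by simp
qed

text \<open>The volumes list the base vertex of a simplex first; here it comes last.\<close>

definition base_last :: "nat \<Rightarrow> nat \<Rightarrow> nat" where
  "base_last k i = (if i < k then Suc i else 0)"

lemma base_last_bij: "inj_on (base_last k) {..k}" "base_last k ` {..k} = {..k}"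
proof -
  show inj: "inj_on (base_last k) {..k}" by (auto simp: inj_on_def base_last_def split: if_splits)
  have "base_last k ` {..k} \<subseteq> {..k}" by (auto simp: base_last_def)
  then show "base_last k ` {..k} = {..k}" using inj by (simp add: endo_inj_surj)
qed

lemma face_enumeration:
  assumes "finite F" "card F = k + 1"
  shows "inj_on (\<lambda>i. sorted_list_of_set F ! base_last k i) {..k}"
    and "(\<lambda>i. sorted_list_of_set F ! base_last k i) ` {..k} = F"
proof -
  have "bij_betw (\<lambda>i. sorted_list_of_set F ! i) {..<Suc k} F"
    using assms by (intro bij_betw_nth) auto
  then have nth: "inj_on (\<lambda>i. sorted_list_of_set F ! i) {..k}" "(\<lambda>i. sorted_list_of_set F ! i) ` {..k} = F"
    by (auto simp: bij_betw_def lessThan_Suc_atMost)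
  show "inj_on (\<lambda>i. sorted_list_of_set F ! base_last k i) {..k}"
    using comp_inj_on[OF base_last_bij(1)[of k], of "\<lambda>i. sorted_list_of_set F ! i"] nth(1) base_last_bij(2)[of k]
    by (simp add: o_def)
  show "(\<lambda>i. sorted_list_of_set F ! base_last k i) ` {..k} = F"
    using nth(2) base_last_bij(2)[of k] by (metis image_image)
qed

lemma affine_param_eq_barycentric:
  "affine_param k v x = (\<Sum>j\<le>k. barycentric k x j *\<^sub>R v (base_last k j))"
  unfolding lessThan_Suc_atMost[symmetric]
  by (simp add: affine_param_def barycentric_def base_last_def add.commute)

lemma affine_param_fun_upd:
  assumes "i < k"
  shows "affine_param k v (x(i := s)) = affine_param k v x + (s - x i) *\<^sub>R (v (Suc i) - v 0)"
proof -
  have i: "i \<in> {..<k}" using assms by simp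
  have 1: "(\<Sum>j<k. (x(i := s)) j) = (\<Sum>j<k. x j) + (s - x i)"
    by (simp add: sum.remove[OF finite_lessThan i] sum.cong[of "{..<k} - {i}" _ "x(i := s)" x])
  have 2: "(\<Sum>j<k. (x(i := s)) j *\<^sub>R v (Suc j)) = (\<Sum>j<k. x j *\<^sub>R v (Suc j)) + (s - x i) *\<^sub>R v (Suc i)"
    by (simp add: sum.remove[OF finite_lessThan i] scaleR_diff_left
        sum.cong[of "{..<k} - {i}" _ "\<lambda>j. (x(i := s)) j *\<^sub>R v (Suc j)" "\<lambda>j. x j *\<^sub>R v (Suc j)"])
  show ?thesis unfolding affine_param_def 1 2
    by (simp add: algebra_simps)
qed

context symmetric_form
begin

lemma qform_gram: "qform F (\<lambda>i j. \<sigma> * gram B i j) x = \<sigma> * b (\<Sum>i\<in>F. x i *\<^sub>R B i) (\<Sum>i\<in>F. x i *\<^sub>R B i)"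
  unfolding qform_def gram_def linear_simps
  by (simp add: sum_distrib_left mult_ac) (subst sum.swap, simp add: commute mult_ac)

text \<open>This is \<open>sphere_proj\<close> for the inner product with \<sigma> = 1 and
  \<open>hyperbolic_proj\<close> for \<open>lorentz\<close> with \<sigma> = -1.\<close>

definition radial_projection :: "real \<Rightarrow> 'v \<Rightarrow> 'v" where
  "radial_projection \<sigma> y = y /\<^sub>R sqrt (\<sigma> * b y y)"

text \<open>Along the line, \<sigma> times the form is the quadratic polynomial \<open>?q\<close>;
  differentiating its inverse square root removes from w the component along p.\<close>

lemma vector_derivative_radial_projection:
  assumes \<sigma>: "\<sigma> * \<sigma> = 1" and pos: "0 < \<sigma> * b p p"
  shows "((\<lambda>s. radial_projection \<sigma> (p + (s - a) *\<^sub>R w)) has_vector_derivative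
    (1 / sqrt (\<sigma> * b p p)) *\<^sub>R (w - (b w p / b p p) *\<^sub>R p)) (at a)"
proof -
  let ?Q = "\<sigma> * b p p"
  let ?q = "\<lambda>s. ?Q + 2 * \<sigma> * b w p * (s - a) + \<sigma> * b w w * (s - a)\<^sup>2"
  have q: "\<sigma> * b (p + (s - a) *\<^sub>R w) (p + (s - a) *\<^sub>R w) = ?q s" for s
    by (simp add: linear_simps power2_eq_square commute[of p w] algebra_simps)
  have dq: "(?q has_real_derivative 2 * \<sigma> * b w p) (at a)"
    by (auto intro!: derivative_eq_intros)
  have "(sqrt has_real_derivative inverse (sqrt ?Q) / 2) (at (?q a))"
    using pos by (auto intro!: derivative_eq_intros)
  from DERIV_chain2[OF this dq]
  have d: "((\<lambda>s. sqrt (?q s)) has_real_derivative inverse (sqrt ?Q) / 2 * (2 * \<sigma> * b w p)) (at a)" .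
  have qa: "?q a = ?Q" by simp
  then have nz: "sqrt (?q a) \<noteq> 0" using pos by auto
  obtain Q where Q: "Q = ?Q" "0 < Q" using pos by blast
  have d': "((\<lambda>s. inverse (sqrt (?q s))) has_real_derivative
      - (inverse (sqrt ?Q) / 2 * (2 * \<sigma> * b w p) * inverse (sqrt ?Q ^ Suc (Suc 0)))) (at a)"
    using DERIV_inverse_fun[OF d nz] unfolding qa .
  have e1: "- (inverse (sqrt Q) / 2 * (2 * \<sigma> * b w p) * inverse (sqrt Q ^ Suc (Suc 0))) =
      - inverse (sqrt Q) * (\<sigma> * b w p / Q)"
  proof -
    have "sqrt Q ^ Suc (Suc 0) = Q" using Q(2) by simp
    then show ?thesis by (simp only: divide_inverse) simp
  qed
  have e2: "\<sigma> * b w p / Q = b w p / b p p"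
    unfolding Q(1) using \<sigma> pos by (auto simp: divide_simps)
  have inv: "((\<lambda>s. inverse (sqrt (?q s))) has_real_derivative - inverse (sqrt ?Q) * (b w p / b p p)) (at a)"
    using d' unfolding e1[unfolded Q(1)] e2[unfolded Q(1)] .
  have "((\<lambda>s. p + (s - a) *\<^sub>R w) has_vector_derivative w) (at a)"
    by (auto intro!: derivative_eq_intros)
  from has_vector_derivative_scaleR[OF inv this]
  show ?thesis
    unfolding radial_projection_def q by (simp add: algebra_simps divide_inverse)
qed

text \<open>The k tangent vectors are each scaled by 1 / sqrt Q, which gives k factors 1 / Q in
  their Gram determinant, and \<open>gram_det_projected\<close> gives one more. So the integrand is
  a constant times the density in \<open>cone_integral_eq\<close>.\<close>

lemma projected_volume_eq:
  fixes v :: "nat \<Rightarrow> 'v" and k :: nat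
  defines "u \<equiv> v \<circ> base_last k"
  assumes \<sigma>: "\<sigma> * \<sigma> = 1" and co: "coercive {..k} (\<lambda>i j. \<sigma> * gram u i j) R"
  shows "parametrized_volume b k (std_simplex k) (\<lambda>x. radial_projection \<sigma> (affine_param k v x)) =
    sqrt (\<sigma> * gram_det {..k} u) * cone_integral {..k} (\<lambda>i j. \<sigma> * gram u i j) / enn2real (radial_constant k)"
proof -
  let ?M = "Pi\<^sub>M {..<k} (\<lambda>_. lborel :: real measure)"
  let ?H = "\<lambda>i j. \<sigma> * gram u i j"
  let ?p = "affine_param k v"
  let ?Q = "\<lambda>x. qform {..k} ?H (barycentric k x)"
  let ?\<Phi> = "\<lambda>x. radial_projection \<sigma> (?p x)"
  have p: "?p x = (\<Sum>j\<le>k. barycentric k x j *\<^sub>R u j)" for x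
    by (simp add: affine_param_eq_barycentric u_def)
  have Q: "?Q x = \<sigma> * b (?p x) (?p x)" for x by (simp add: qform_gram p)
  have pos: "0 < ?Q x" if x: "x \<in> std_simplex k" for x
  proof -
    have nonneg: "0 \<le> barycentric k x i" if "i \<in> {..k}" for i
      using x that by (auto simp: barycentric_def std_simplex_def)
    have "\<exists>i\<in>{..k}. barycentric k x i \<noteq> 0" by (metis sum.neutral sum_barycentric zero_neq_one)
    then obtain i where "i \<in> {..k}" "0 < barycentric k x i" using nonneg by force
    then show ?thesis by (intro coercive_pos[OF co, of "barycentric k x" i] nonneg)
  qed
  have "sqrt (Determinant.det (Matrix.mat k k (\<lambda>(i, j). b (partial_deriv ?\<Phi> i x) (partial_deriv ?\<Phi> j x)))) =
      sqrt (\<sigma> * gram_det {..k} u) * (1 / sqrt (?Q x ^ (k + 1)))" if x: "x \<in> std_simplex k" for x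
  proof -
    have Qx: "0 < \<sigma> * b (?p x) (?p x)" using pos[OF x] Q by simp
    then have nz: "b (?p x) (?p x) \<noteq> 0" by auto
    define w where "w i = (u i - u k) - (b (u i - u k) (?p x) / b (?p x) (?p x)) *\<^sub>R ?p x" for i
    have pd: "partial_deriv ?\<Phi> i x = (1 / sqrt (?Q x)) *\<^sub>R w i" if "i < k" for i
    proof -
      have "u i - u k = v (Suc i) - v 0" using that by (simp add: u_def base_last_def)
      then show ?thesis
        unfolding partial_deriv_def affine_param_fun_upd[OF that] w_def Q
        using vector_derivative_at[OF vector_derivative_radial_projection[OF \<sigma> Qx, of "x i" "v (Suc i) - v 0"]]
        by simp
    qed
    have "Determinant.det (Matrix.mat k k (\<lambda>(i, j). b (partial_deriv ?\<Phi> i x) (partial_deriv ?\<Phi> j x))) =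
        gdet {..<k} (\<lambda>i j. (1 / ?Q x) * gram w i j)"
      unfolding det_mat_eq_gdet
    proof (rule gdet_cong)
      fix i j assume "i \<in> {..<k}" "j \<in> {..<k}"
      then show "b (partial_deriv ?\<Phi> i x) (partial_deriv ?\<Phi> j x) = (1 / ?Q x) * gram w i j"
        using pos[OF x] by (simp add: pd linear_simps gram_def)
    qed
    also have "\<dots> = (1 / ?Q x) ^ k * gram_det {..<k} w"
      by (subst gdet_scale_rows) simp_all
    also have "gram_det {..<k} w = gram_det {..k} u / b (?p x) (?p x)"
      unfolding w_def by (rule gram_det_projected[OF sum_barycentric p nz])
    also have "\<dots> = \<sigma> * gram_det {..k} u / ?Q x"
      unfolding Q using \<sigma> nz by (auto simp: divide_simps)
    finally have "Determinant.det (Matrix.mat k k (\<lambda>(i, j). b (partial_deriv ?\<Phi> i x) (partial_deriv ?\<Phi> j x))) =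
        \<sigma> * gram_det {..k} u / ?Q x ^ (k + 1)" by (simp add: power_divide)
    then show ?thesis by (simp add: real_sqrt_divide)
  qed
  then have "parametrized_volume b k (std_simplex k) ?\<Phi> =
      (LINT x:std_simplex k|?M. sqrt (\<sigma> * gram_det {..k} u) * (1 / sqrt (?Q x ^ (k + 1))))"
    unfolding parametrized_volume_def
    by (intro set_lebesgue_integral_cong measurable_std_simplex) simp
  also have "\<dots> = sqrt (\<sigma> * gram_det {..k} u) * (LINT x:std_simplex k|?M. 1 / sqrt (?Q x ^ (k + 1)))"
    by (rule set_integral_mult_right)
  also have "(LINT x:std_simplex k|?M. 1 / sqrt (?Q x ^ (k + 1))) =
      cone_integral {..k} ?H / enn2real (radial_constant k)"
  proof -
    have "enn2real (radial_constant k) \<noteq> 0"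
      using radial_constant_finite[of k] radial_constant_pos[of k] by (auto simp: enn2real_eq_0_iff)
    then show ?thesis using cone_integral_eq[OF co] by simp
  qed
  finally show ?thesis by simp
qed

lemma gram_det_face:
  assumes "finite F" "card F = k + 1"
  shows "gram_det F P = gram_det {..k} (face_vertices P F \<circ> base_last k)"
  using gdet_reindex[OF _ face_enumeration(1)[OF assms], of "gram P"]
  unfolding face_enumeration(2)[OF assms] by (simp add: gram_def[abs_def] face_vertices_def)

lemma projected_face_volume_eq:
  fixes P :: "nat \<Rightarrow> 'v"
  assumes \<sigma>: "\<sigma> * \<sigma> = 1" and F: "finite F" "card F = k + 1"
    and co: "coercive F (\<lambda>i j. \<sigma> * gram P i j) R"
  shows "parametrized_volume b k (std_simplex k) (\<lambda>x. radial_projection \<sigma> (affine_param k (face_vertices P F) x)) =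
    sqrt (\<sigma> * gram_det F P) * cone_integral F (\<lambda>i j. \<sigma> * gram P i j) / enn2real (radial_constant k)"
proof -
  let ?\<tau> = "\<lambda>i. sorted_list_of_set F ! base_last k i"
  note inj = face_enumeration(1)[OF F] and img = face_enumeration(2)[OF F]
  let ?u = "face_vertices P F \<circ> base_last k"
  have gram: "gram ?u = (\<lambda>i j. gram P (?\<tau> i) (?\<tau> j))"
    by (simp add: fun_eq_iff gram_def face_vertices_def)
  have co': "coercive {..k} (\<lambda>i j. \<sigma> * gram ?u i j) R"
    using coercive_reindex[OF inj, of "\<lambda>i j. \<sigma> * gram P i j" R] co unfolding img gram by simp
  have "cone_integral F (\<lambda>i j. \<sigma> * gram P i j) = cone_integral {..k} (\<lambda>i j. \<sigma> * gram ?u i j)"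
    using cone_integral_reindex[OF _ inj, of "\<lambda>i j. \<sigma> * gram P i j"] unfolding img gram by simp
  then show ?thesis using projected_volume_eq[OF \<sigma> co'] gram_det_face[OF F, of P] by simp
qed

section \<open>First variation of the volume\<close>

lemma has_real_derivative_gram:
  assumes "((\<lambda>t. B t i) has_vector_derivative B' i) (at s within S)"
    "((\<lambda>t. B t j) has_vector_derivative B' j) (at s within S)"
  shows "((\<lambda>t. gram (B t) i j) has_real_derivative b (B s i) (B' j) + b (B s j) (B' i)) (at s within S)"
  using has_vector_derivative[OF assms] unfolding gram_def has_real_derivative_iff_has_vector_derivative
  by (simp add: commute)

text \<open>Each Gram entry has two velocity terms; they contribute equally since the cofactor
  matrix is symmetric, hence the factor 2.\<close>

lemma has_real_derivative_gram_det:
  assumes F: "finite F"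
    and B: "\<And>i. i \<in> F \<Longrightarrow> ((\<lambda>t. B t i) has_vector_derivative B' i) (at s within S)"
  shows "((\<lambda>t. gram_det F (B t)) has_real_derivative
    2 * (\<Sum>i\<in>F. \<Sum>l\<in>F. gcof F (gram (B s)) i l * b (B s l) (B' i))) (at s within S)"
proof -
  let ?K = "gcof F (gram (B s))"
  have "((\<lambda>t. gram_det F (B t)) has_real_derivative
      (\<Sum>i\<in>F. \<Sum>l\<in>F. ?K i l * (b (B s i) (B' l) + b (B s l) (B' i)))) (at s within S)"
    by (intro has_real_derivative_gdet F has_real_derivative_gram B)
  also have "(\<Sum>i\<in>F. \<Sum>l\<in>F. ?K i l * (b (B s i) (B' l) + b (B s l) (B' i))) =
      (\<Sum>i\<in>F. \<Sum>l\<in>F. ?K i l * b (B s i) (B' l)) + (\<Sum>i\<in>F. \<Sum>l\<in>F. ?K i l * b (B s l) (B' i))"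
    by (simp add: distrib_left sum.distrib)
  also have "(\<Sum>i\<in>F. \<Sum>l\<in>F. ?K i l * b (B s i) (B' l)) = (\<Sum>i\<in>F. \<Sum>l\<in>F. ?K i l * b (B s l) (B' i))"
    by (subst sum.swap) (intro sum.cong refl, simp add: gcof_sym[OF F] gram_commute)
  finally show ?thesis by simp
qed

text \<open>The divergence theorem for the field \<open>K C x\<close> times \<open>cutoff (qform F H x)\<close>. If \<open>C l m\<close> is the product of the
  vertex l and the velocity of the vertex m, then \<open>K C x\<close> is, up to the factor \<open>gram_det F B\<close>, the
  projection to the face of the velocity of the point with the coordinates x.\<close>

lemma stokes_cone:
  assumes F: "finite F" and \<sigma>: "\<sigma> * \<sigma> = 1" and D: "gram_det F B \<noteq> 0"
    and co: "coercive F (\<lambda>i j. \<sigma> * gram B i j) R"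
  defines "H \<equiv> \<lambda>i j. \<sigma> * gram B i j" and "K \<equiv> gcof F (gram B)"
  shows "(\<Sum>i\<in>F. \<Sum>l\<in>F. K i l * C l i) * cone_integral F H +
      gram_det F B * (\<integral>x. orthant F x * (cutoff_deriv (qform F H x) * qform F (\<lambda>i j. \<sigma> * (C i j + C j i)) x) \<partial>Pi\<^sub>M F (\<lambda>_. lborel)) =
    - (\<Sum>i\<in>F. \<Sum>m\<in>F - {i}. (\<Sum>l\<in>F. K i l * C l m) * cone_moment (F - {i}) H m)"
proof -
  let ?M = "Pi\<^sub>M F (\<lambda>_. lborel :: real measure)"
  define L where "L i m = (\<Sum>l\<in>F. K i l * C l m)" for i m
  define f where "f i x = orthant F x * (L i i * cutoff (qform F H x) +
      (\<Sum>m\<in>F. L i m * x m) * (cutoff_deriv (qform F H x) * (2 * (\<Sum>j\<in>F. H i j * x j))))" for i x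
  let ?T = "\<Sum>i\<in>F. \<Sum>l\<in>F. K i l * C l i"
  let ?g = "\<lambda>x. orthant F x * cutoff (qform F H x)"
  let ?h = "\<lambda>x. orthant F x * (cutoff_deriv (qform F H x) * qform F (\<lambda>i j. \<sigma> * (C i j + C j i)) x)"
  have sym: "H i j = H j i" for i j by (simp add: H_def gram_commute)
  have coH: "coercive F H R" using co by (simp add: H_def)
  have KG: "(\<Sum>i\<in>F. K i l * gram B i j) = (if l = j then gram_det F B else 0)" if "l \<in> F" "j \<in> F" for l j
  proof -
    have "(\<Sum>i\<in>F. K i l * gram B i j) = (\<Sum>i\<in>F. K l i * gram B j i)"
      by (intro sum.cong refl) (simp add: K_def gcof_sym[OF F _ that(1)] gram_commute)
    also have "\<dots> = (if l = j then gram_det F B else 0)"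
      unfolding K_def by (rule gcof_mult_row[OF F that])
    finally show ?thesis .
  qed
  \<comment> \<open>The derivative of the quadratic form along the field. Contracting K with the
    Gram matrix gives the determinant times the identity, which leaves the form of the symmetrized
    C, that is, the rate of change of the Gram form under the motion.\<close>
  have quad: "(\<Sum>i\<in>F. (\<Sum>m\<in>F. L i m * x m) * (2 * (\<Sum>j\<in>F. H i j * x j))) =
      gram_det F B * qform F (\<lambda>i j. \<sigma> * (C i j + C j i)) x" for x
  proof -
    define c where "c l = (\<Sum>m\<in>F. C l m * x m)" for l
    have Lc: "(\<Sum>m\<in>F. L i m * x m) = (\<Sum>l\<in>F. K i l * c l)" for i
      unfolding L_def c_def sum_distrib_left sum_distrib_right by (subst sum.swap) (simp add: mult.assoc)
    have "(\<Sum>i\<in>F. (\<Sum>m\<in>F. L i m * x m) * (2 * (\<Sum>j\<in>F. H i j * x j))) =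
        (\<Sum>i\<in>F. \<Sum>l\<in>F. \<Sum>j\<in>F. 2 * \<sigma> * c l * x j * (K i l * gram B i j))"
      unfolding Lc
      by (simp add: sum_product sum_distrib_left H_def mult_ac) (rule sum.cong[OF refl], rule sum.swap)
    also have "\<dots> = (\<Sum>l\<in>F. \<Sum>i\<in>F. \<Sum>j\<in>F. 2 * \<sigma> * c l * x j * (K i l * gram B i j))"
      by (rule sum.swap)
    also have "\<dots> = (\<Sum>l\<in>F. \<Sum>j\<in>F. \<Sum>i\<in>F. 2 * \<sigma> * c l * x j * (K i l * gram B i j))"
      by (rule sum.cong[OF refl], rule sum.swap)
    also have "\<dots> = (\<Sum>l\<in>F. \<Sum>j\<in>F. 2 * \<sigma> * c l * x j * (\<Sum>i\<in>F. K i l * gram B i j))"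
      unfolding sum_distrib_left ..
    also have "\<dots> = (\<Sum>l\<in>F. 2 * \<sigma> * c l * x l * gram_det F B)"
    proof (rule sum.cong[OF refl])
      fix l assume l: "l \<in> F"
      have "(\<Sum>j\<in>F. 2 * \<sigma> * c l * x j * (\<Sum>i\<in>F. K i l * gram B i j)) =
          (\<Sum>j\<in>F. if l = j then 2 * \<sigma> * c l * x j * gram_det F B else 0)"
        by (intro sum.cong refl) (simp add: KG[OF l])
      then show "(\<Sum>j\<in>F. 2 * \<sigma> * c l * x j * (\<Sum>i\<in>F. K i l * gram B i j)) = 2 * \<sigma> * c l * x l * gram_det F B"
        using l F by simp
    qed
    also have "\<dots> = gram_det F B * (\<sigma> * (\<Sum>l\<in>F. c l * x l) + \<sigma> * (\<Sum>l\<in>F. c l * x l))"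
      by (simp add: sum_distrib_left sum.distrib[symmetric] algebra_simps)
    also have "(\<Sum>l\<in>F. c l * x l) = (\<Sum>i\<in>F. \<Sum>j\<in>F. C i j * x i * x j)"
      unfolding c_def sum_distrib_right by (simp add: mult_ac)
    also have "\<sigma> * (\<Sum>i\<in>F. \<Sum>j\<in>F. C i j * x i * x j) + \<sigma> * (\<Sum>i\<in>F. \<Sum>j\<in>F. C i j * x i * x j) =
        \<sigma> * (\<Sum>i\<in>F. \<Sum>j\<in>F. C i j * x i * x j) + \<sigma> * (\<Sum>i\<in>F. \<Sum>j\<in>F. C j i * x j * x i)"
      by (subst (3) sum.swap) simp
    also have "\<dots> = qform F (\<lambda>i j. \<sigma> * (C i j + C j i)) x"
      unfolding qform_def sum_distrib_left sum.distrib[symmetric]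
      by (intro sum.cong refl) (simp add: algebra_simps)
    finally show ?thesis .
  qed
  have fsum: "(\<Sum>i\<in>F. f i x) = ?T * ?g x + gram_det F B * ?h x" for x
  proof -
    have "(\<Sum>i\<in>F. f i x) = orthant F x * ((\<Sum>i\<in>F. L i i) * cutoff (qform F H x) +
        cutoff_deriv (qform F H x) * (\<Sum>i\<in>F. (\<Sum>m\<in>F. L i m * x m) * (2 * (\<Sum>j\<in>F. H i j * x j))))"
      unfolding f_def by (simp add: sum.distrib sum_distrib_left[symmetric] sum_distrib_right[symmetric] mult.left_commute)
    then show ?thesis unfolding quad by (simp add: L_def algebra_simps)
  qed
  have int: "integrable ?M (f i)" and val: "(\<integral>x. f i x \<partial>?M) = - (\<Sum>m\<in>F - {i}. L i m * cone_moment (F - {i}) H m)"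
    if "i \<in> F" for i
    using integral_orthant_partial[OF F that sym coH, where L="L i"] unfolding f_def by auto
  have g: "integrable ?M ?g" by (rule integrable_cone_integrand[OF F coH])
  have "gram_det F B * (\<integral>x. ?h x \<partial>?M) = (\<integral>x. (\<Sum>i\<in>F. f i x) - ?T * ?g x \<partial>?M)"
    unfolding fsum by simp
  also have "\<dots> = (\<Sum>i\<in>F. \<integral>x. f i x \<partial>?M) - ?T * cone_integral F H"
    unfolding cone_integral_def using int g by (subst Bochner_Integration.integral_diff) (auto simp: Bochner_Integration.integral_sum)
  finally show ?thesis using val by (simp add: L_def sum_negf)
qed

text \<open>By the product rule the derivative is \<sigma> / sqrt (\<sigma> * det) times the left
  side of \<open>stokes_cone\<close>, where the square root is written as \<sigma> / sqrt (\<sigma>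
  * det) times det. The interior contributions thus cancel and only facet terms remain.\<close>

lemma has_real_derivative_cone_volume:
  assumes F: "finite F" and \<sigma>: "\<sigma> * \<sigma> = 1" and D: "0 < \<sigma> * gram_det F (B s)"
    and B: "\<And>i. i \<in> F \<Longrightarrow> ((\<lambda>t. B t i) has_vector_derivative B' i) (at s within S)"
    and co: "coercive F (\<lambda>i j. \<sigma> * gram (B s) i j) R"
    and ev: "\<forall>\<^sub>F t in at s within S. coercive F (\<lambda>i j. \<sigma> * gram (B t) i j) R"
  shows "((\<lambda>t. sqrt (\<sigma> * gram_det F (B t)) * cone_integral F (\<lambda>i j. \<sigma> * gram (B t) i j)) has_real_derivative
    - \<sigma> / sqrt (\<sigma> * gram_det F (B s)) * (\<Sum>i\<in>F. \<Sum>m\<in>F - {i}.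
      (\<Sum>l\<in>F. gcof F (gram (B s)) i l * b (B s l) (B' m)) *
      cone_moment (F - {i}) (\<lambda>i j. \<sigma> * gram (B s) i j) m)) (at s within S)"
proof -
  let ?D = "gram_det F (B s)"
  let ?H = "\<lambda>i j. \<sigma> * gram (B s) i j"
  let ?T = "\<Sum>i\<in>F. \<Sum>l\<in>F. gcof F (gram (B s)) i l * b (B s l) (B' i)"
  let ?I = "\<integral>x. orthant F x * (cutoff_deriv (qform F ?H x) *
      qform F (\<lambda>i j. \<sigma> * (b (B s i) (B' j) + b (B s j) (B' i))) x) \<partial>Pi\<^sub>M F (\<lambda>_. lborel)"
  let ?S = "\<Sum>i\<in>F. \<Sum>m\<in>F - {i}. (\<Sum>l\<in>F. gcof F (gram (B s)) i l * b (B s l) (B' m)) * cone_moment (F - {i}) ?H m"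
  have dJ: "((\<lambda>t. cone_integral F (\<lambda>i j. \<sigma> * gram (B t) i j)) has_real_derivative ?I) (at s within S)"
    by (rule has_real_derivative_cone_integral[OF F co ev]) (intro DERIV_cmult has_real_derivative_gram B)
  have "(sqrt has_real_derivative inverse (sqrt (\<sigma> * ?D)) / 2) (at (\<sigma> * ?D))"
    using D by (auto intro!: derivative_eq_intros)
  then have dD: "((\<lambda>t. sqrt (\<sigma> * gram_det F (B t))) has_real_derivative
      inverse (sqrt (\<sigma> * ?D)) / 2 * (\<sigma> * (2 * ?T))) (at s within S)"
    by (rule DERIV_chain2) (intro DERIV_cmult has_real_derivative_gram_det F B)
  have r: "sqrt (\<sigma> * ?D) = \<sigma> / sqrt (\<sigma> * ?D) * ?D"
    using real_div_sqrt[of "\<sigma> * ?D"] D by simp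
  have "inverse (sqrt (\<sigma> * ?D)) / 2 * (\<sigma> * (2 * ?T)) * cone_integral F ?H + sqrt (\<sigma> * ?D) * ?I =
      \<sigma> / sqrt (\<sigma> * ?D) * (?T * cone_integral F ?H + ?D * ?I)"
  proof -
    have "inverse x / 2 * (\<sigma> * (2 * T)) * J + \<sigma> / x * d * I = \<sigma> / x * (T * J + d * I)" for x T J d I :: real
    proof -
      have "inverse x / 2 * (\<sigma> * (2 * T)) * J = \<sigma> / x * (T * J)"
        by (simp only: divide_inverse) simp
      then show ?thesis by (simp only: distrib_left mult.assoc)
    qed
    from this[of "sqrt (\<sigma> * ?D)" ?T "cone_integral F ?H" ?D ?I] show ?thesis
      unfolding r[symmetric] .
  qed
  also have "?T * cone_integral F ?H + ?D * ?I = - ?S"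
    by (rule stokes_cone[OF F \<sigma> _ co]) (use D in auto)
  finally have "inverse (sqrt (\<sigma> * ?D)) / 2 * (\<sigma> * (2 * ?T)) * cone_integral F ?H + sqrt (\<sigma> * ?D) * ?I =
      - \<sigma> / sqrt (\<sigma> * ?D) * ?S"
    by (simp only: minus_divide_left[symmetric] mult_minus_left mult_minus_right)
  then show ?thesis
    by (rule DERIV_cong[OF DERIV_mult[OF dD dJ] trans[OF arg_cong2[where f="(+)", OF refl mult.commute]]])
qed

end

section \<open>Constraints and rigidity\<close>

lemma mono_on_derivative_nonneg:
  fixes f :: "real \<Rightarrow> real"
  assumes "mono_on {0..} f" "(f has_real_derivative v) (at t within {0..})" "0 \<le> t"
  shows "0 \<le> v"
proof (rule tendsto_lowerbound)
  have "((\<lambda>y. (f y - f t) / (y - t)) \<longlongrightarrow> v) (at t within {0..})"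
    using assms(2) by (simp add: has_field_derivative_iff)
  then show "((\<lambda>y. (f y - f t) / (y - t)) \<longlongrightarrow> v) (at_right t)"
    by (rule tendsto_within_subset) (use assms(3) in auto)
  show "\<forall>\<^sub>F y in at_right t. 0 \<le> (f y - f t) / (y - t)"
    unfolding eventually_at_filter
    by (rule always_eventually) (use mono_onD[OF assms(1)] assms(3) in \<open>auto intro!: divide_nonneg_nonneg\<close>)
  show "at_right t \<noteq> bot" by simp
qed

text \<open>Only the signs of the weights enter. This allows w to be built from the stress at time
  t, while the constraints use \<alpha>.\<close>

lemma G_constraints_imp_preserved:
  assumes \<epsilon>: "0 < \<epsilon>"
    and d: "\<And>t F. 0 \<le> t \<Longrightarrow> t < \<epsilon> \<Longrightarrow> F \<in> faces n k \<Longrightarrow>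
      ((\<lambda>t. vol t F) has_real_derivative v t F) (at t within {0..})"
    and w: "\<And>t F. 0 \<le> t \<Longrightarrow> t < \<epsilon> \<Longrightarrow> F \<in> faces n k \<Longrightarrow> 0 < w t F * (\<Prod>s\<in>F. \<alpha> s)"
    and sum: "\<And>t. 0 \<le> t \<Longrightarrow> t < \<epsilon> \<Longrightarrow> (\<Sum>F\<in>faces n k. w t F * v t F) = 0"
    and G: "G_constraints n k \<alpha> vol"
  shows "preserves_volumes_initially n k vol"
proof -
  have fin: "finite (faces n k)"
    by (rule finite_subset[of _ "Pow {1..n + 2}"]) (auto simp: faces_def)
  have nonneg: "0 \<le> w t F * v t F" if t: "0 \<le> t" "t < \<epsilon>" and F: "F \<in> faces n k" for t F
  proof (cases "(\<Prod>s\<in>F. \<alpha> s) > 0")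
    case True
    then have "mono_on {0..} (\<lambda>t. vol t F)" using G F by (auto simp: G_constraints_def)
    then have "0 \<le> v t F" by (rule mono_on_derivative_nonneg) (use d t F in auto)
    then show ?thesis using w[OF t F] True by (simp add: zero_less_mult_iff)
  next
    case False
    then have neg: "(\<Prod>s\<in>F. \<alpha> s) < 0" using w[OF t F] by (cases "(\<Prod>s\<in>F. \<alpha> s) = 0") auto
    then have "antimono_on {0..} (\<lambda>t. vol t F)" using G F by (auto simp: G_constraints_def)
    then have "mono_on {0..} (\<lambda>t. - vol t F)"
      unfolding monotone_on_def by auto
    then have "0 \<le> - v t F"
      by (rule mono_on_derivative_nonneg[OF _ DERIV_minus[OF d[OF t F]] t(1)])
    then show ?thesis using w[OF t F] neg by (simp add: zero_less_mult_iff mult_nonpos_nonpos)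
  qed
  have zero: "v t F = 0" if "0 \<le> t" "t < \<epsilon>" "F \<in> faces n k" for t F
  proof -
    have "w t F * v t F = 0"
      using sum_nonneg_0[OF fin _ sum[OF that(1,2)] that(3)] nonneg that by blast
    moreover have "w t F \<noteq> 0" using w[OF that] by auto
    ultimately show ?thesis by simp
  qed
  show ?thesis
    unfolding preserves_volumes_initially_def
  proof (intro exI conjI ballI)
    fix F assume F: "F \<in> faces n k"
    have "\<exists>c. \<forall>t\<in>{0..<\<epsilon>}. vol t F = c"
    proof (rule has_field_derivative_zero_constant)
      fix t assume t: "t \<in> {0..<\<epsilon>}"
      then have "((\<lambda>t. vol t F) has_real_derivative 0) (at t within {0..})"
        using d[of t F] zero[of t F] F by simp
      then show "((\<lambda>t. vol t F) has_real_derivative 0) (at t within {0..<\<epsilon>})"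
        by (rule has_field_derivative_subset) auto
    qed simp
    then show "(\<lambda>t. vol t F) constant_on {0..<\<epsilon>}" by (simp add: constant_on_def)
  qed (rule \<epsilon>)
qed

text \<open>Negating the volumes exchanges the two sets of constraints and keeps the linear
  relation.\<close>

lemma constraints_imp_preserved:
  assumes \<epsilon>: "0 < \<epsilon>"
    and d: "\<And>t F. 0 \<le> t \<Longrightarrow> t < \<epsilon> \<Longrightarrow> F \<in> faces n k \<Longrightarrow>
      ((\<lambda>t. vol t F) has_real_derivative v t F) (at t within {0..})"
    and w: "\<And>t F. 0 \<le> t \<Longrightarrow> t < \<epsilon> \<Longrightarrow> F \<in> faces n k \<Longrightarrow> 0 < w t F * (\<Prod>s\<in>F. \<alpha> s)"
    and sum: "\<And>t. 0 \<le> t \<Longrightarrow> t < \<epsilon> \<Longrightarrow> (\<Sum>F\<in>faces n k. w t F * v t F) = 0"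
    and G: "G_constraints n k \<alpha> vol \<or> G'_constraints n k \<alpha> vol"
  shows "preserves_volumes_initially n k vol"
  using G
proof
  assume "G_constraints n k \<alpha> vol"
  then show ?thesis using G_constraints_imp_preserved[OF \<epsilon>] d w sum by blast
next
  assume G': "G'_constraints n k \<alpha> vol"
  have "G_constraints n k \<alpha> (\<lambda>t F. - vol t F)"
    using G' unfolding G_constraints_def G'_constraints_def monotone_on_def by auto
  then have "preserves_volumes_initially n k (\<lambda>t F. - vol t F)"
    by (rule G_constraints_imp_preserved[OF \<epsilon> DERIV_minus[OF d] w, rotated -1])
      (auto simp: sum_negf intro: sum)
  then show ?thesis
    unfolding preserves_volumes_initially_def constant_on_def by (metis minus_minus)
qed

section \<open>Persistence of nondegeneracy and of the stress\<close>

lemma tendsto_gdet: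
  assumes "\<And>i j. i \<in> F \<Longrightarrow> j \<in> F \<Longrightarrow> ((\<lambda>t. M t i j) \<longlongrightarrow> N i j) fl"
  shows "((\<lambda>t. gdet F (M t)) \<longlongrightarrow> gdet F N) fl"
  unfolding gdet_def
  by (intro tendsto_sum tendsto_mult tendsto_const tendsto_prod assms) (auto simp: permutes_in_image)

lemma tendsto_gcof:
  assumes "\<And>i j. i \<in> F \<Longrightarrow> j \<in> F \<Longrightarrow> ((\<lambda>t. M t i j) \<longlongrightarrow> N i j) fl"
  shows "((\<lambda>t. gcof F (M t) i l) \<longlongrightarrow> gcof F N i l) fl"
  unfolding gcof_def by (rule tendsto_gdet) (simp add: assms)

lemma independent_family_iff:
  assumes "finite F"
  shows "independent_family F B \<longleftrightarrow> inj_on B F \<and> independent (B ` F)"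
proof
  assume ind: "independent_family F B"
  have inj: "inj_on B F"
  proof (rule inj_onI, rule ccontr)
    fix i j assume ij: "i \<in> F" "j \<in> F" "B i = B j" "i \<noteq> j"
    let ?x = "\<lambda>l. if l = i then 1 else if l = j then - 1 else 0 :: real"
    have "(\<Sum>l\<in>F. ?x l *\<^sub>R B l) = (\<Sum>l\<in>{i, j}. ?x l *\<^sub>R B l)"
      using assms ij by (intro sum.mono_neutral_right) auto
    also have "\<dots> = 0" using ij by simp
    finally have "\<forall>l\<in>F. ?x l = 0" using ind[unfolded independent_family_def, THEN spec, of ?x] by blast
    then have "?x i = 0" using ij(1) by (rule bspec)
    then show False by simp
  qed
  moreover have "\<not> dependent (B ` F)"
    using assms inj ind by (auto simp: dependent_finite independent_family_def sum.reindex)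
  ultimately show "inj_on B F \<and> independent (B ` F)" by simp
next
  assume B: "inj_on B F \<and> independent (B ` F)"
  show "independent_family F B"
    unfolding independent_family_def
  proof (intro allI impI ballI)
    fix x i assume x: "(\<Sum>i\<in>F. x i *\<^sub>R B i) = 0" and i: "i \<in> F"
    have x': "(\<Sum>v\<in>B ` F. x (inv_into F B v) *\<^sub>R v) = 0"
      using B x by (simp add: sum.reindex)
    have "\<forall>v\<in>B ` F. u v = 0" if "(\<Sum>v\<in>B ` F. u v *\<^sub>R v) = 0" for u
      using B that unfolding dependent_finite[OF finite_imageI[OF assms]] by blast
    from this[OF x'] have "\<forall>v\<in>B ` F. x (inv_into F B v) = 0" .
    then show "x i = 0" using B i by auto
  qed
qed

lemma independent_family_spans:
  fixes B :: "'i \<Rightarrow> 'v::euclidean_space"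
  assumes "finite F" "independent_family F B" "card F = DIM('v)"
  shows "\<exists>x. z = (\<Sum>i\<in>F. x i *\<^sub>R B i)"
proof -
  have B: "inj_on B F" "independent (B ` F)" using assms independent_family_iff by blast+
  have "z \<in> span (B ` F)"
  proof (rule ccontr)
    assume z: "z \<notin> span (B ` F)"
    then have "independent (insert z (B ` F))" using B(2) by (rule independent_insertI)
    then have "card (insert z (B ` F)) \<le> DIM('v)" using independent_bound by blast
    moreover have "z \<notin> B ` F" using z span_base[of z "B ` F"] by blast
    ultimately show False using assms B(1) by (simp add: card_image)
  qed
  then obtain u where "z = (\<Sum>v\<in>B ` F. u v *\<^sub>R v)" using assms(1) by (auto simp: span_finite)
  then show ?thesis using B(1) by (intro exI[of _ "\<lambda>i. u (B i)"]) (simp add: sum.reindex)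
qed

lemma smooth_motionE:
  assumes "smooth_motion n M A P"
  obtains P' where "\<And>t i. 0 \<le> t \<Longrightarrow> i \<in> {1..n + 2} \<Longrightarrow> ((\<lambda>t. P t i) has_vector_derivative P' t i) (at t within {0..})"
proof -
  have "\<exists>D. \<forall>t\<ge>0. ((\<lambda>t. P t i) has_vector_derivative D t) (at t within {0..})" if i: "i \<in> {1..n + 2}" for i
  proof -
    obtain D where D: "D 0 = (\<lambda>t. P t i)"
      "\<forall>m. \<forall>t\<ge>0. (D m has_vector_derivative D (Suc m) t) (at t within {0..})"
      using assms i unfolding smooth_motion_def smooth_curve_def by blast
    then have "\<forall>t\<ge>0. ((\<lambda>t. P t i) has_vector_derivative D (Suc 0) t) (at t within {0..})" by metis
    then show ?thesis by blast
  qed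
  then obtain D where "\<And>i t. i \<in> {1..n + 2} \<Longrightarrow> 0 \<le> t \<Longrightarrow> ((\<lambda>t. P t i) has_vector_derivative D i t) (at t within {0..})"
    by metis
  then show thesis by (intro that[of "\<lambda>t i. D i t"]) auto
qed

lemma face_extends:
  assumes "E \<subseteq> {1..n + 2}" "card E \<le> n + 1"
  obtains F where "E \<subseteq> F" "F \<in> faces n n"
  using exists_subset_between[of E "n + 1" "{1..n + 2}"] assms by (auto simp: faces_def)

context symmetric_form
begin

lemma tendsto_gram:
  assumes "((\<lambda>t. B t i) \<longlongrightarrow> A i) fl" "((\<lambda>t. B t j) \<longlongrightarrow> A j) fl"
  shows "((\<lambda>t. gram (B t) i j) \<longlongrightarrow> gram A i j) fl"
  unfolding gram_def by (rule tendsto[OF assms])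

text \<open>The stress is given by Cramer's rule, so it depends continuously on t.\<close>

lemma eventually_stress:
  assumes F: "finite F" "z \<notin> F"
    and cont: "\<And>i. i \<in> insert z F \<Longrightarrow> ((\<lambda>t. B t i) \<longlongrightarrow> A i) fl"
    and D: "gram_det F A \<noteq> 0"
    and stress: "(\<Sum>i\<in>insert z F. \<alpha> i *\<^sub>R A i) = 0" "\<And>i. i \<in> insert z F \<Longrightarrow> \<alpha> i \<noteq> 0"
    and span: "\<And>t. gram_det F (B t) \<noteq> 0 \<Longrightarrow> \<exists>x. B t z = (\<Sum>i\<in>F. x i *\<^sub>R B t i)"
  shows "\<forall>\<^sub>F t in fl. \<exists>a. (\<Sum>i\<in>insert z F. a i *\<^sub>R B t i) = 0 \<and> (\<forall>i\<in>insert z F. 0 < a i * \<alpha> i)"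
proof -
  \<comment> \<open>Multiplying the expansion of \<open>V z\<close> in the vectors of F by the Gram
    determinant gives coefficients without division. The constant factor in \<open>a\<close> makes
    \<open>a A\<close> equal to \<alpha>, so that the signs agree nearby by continuity.\<close>
  define c where "c V i = (if i = z then gram_det F V else - b (dual_vector F V i) (V z))" for V i
  define a where "a V i = \<alpha> z / gram_det F A * c V i" for V i
  have dual: "b (dual_vector F V i) (V z) = (\<Sum>l\<in>F. gcof F (gram V) i l * gram V l z)" for V i
    by (simp add: dual_vector_def gram_def linear_simps)
  have aA: "a A i = \<alpha> i" if i: "i \<in> insert z F" for i
  proof (cases "i = z")
    case True
    then show ?thesis using D by (simp add: a_def c_def)
  next
    case False
    then have iF: "i \<in> F" using i by simp
    have "\<alpha> z *\<^sub>R A z = - (\<Sum>l\<in>F. \<alpha> l *\<^sub>R A l)"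
      using stress(1) F by (simp add: eq_neg_iff_add_eq_0)
    then have "\<alpha> z * b (dual_vector F A i) (A z) = - b (dual_vector F A i) (\<Sum>l\<in>F. \<alpha> l *\<^sub>R A l)"
      by (metis minus_right scale_right)
    also have "\<dots> = - (gram_det F A * \<alpha> i)"
      by (simp only: form_dual_vector_sum[OF F(1) iF])
    finally show ?thesis using D False by (simp add: a_def c_def divide_simps)
  qed
  have lim: "((\<lambda>t. a (B t) i) \<longlongrightarrow> a A i) fl" if i: "i \<in> insert z F" for i
  proof (cases "i = z")
    case True
    have "((\<lambda>t. \<alpha> z / gram_det F A * gram_det F (B t)) \<longlongrightarrow> \<alpha> z / gram_det F A * gram_det F A) fl"
      by (intro tendsto_mult tendsto_const tendsto_gdet tendsto_gram cont) auto
    then show ?thesis using True unfolding a_def c_def by simp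
  next
    case False
    have "((\<lambda>t. \<Sum>l\<in>F. gcof F (gram (B t)) i l * gram (B t) l z) \<longlongrightarrow> (\<Sum>l\<in>F. gcof F (gram A) i l * gram A l z)) fl"
      by (intro tendsto_sum tendsto_mult tendsto_gcof tendsto_gram cont) auto
    from tendsto_mult[OF tendsto_const[of "\<alpha> z / gram_det F A"] tendsto_minus[OF this]]
    show ?thesis using False unfolding a_def c_def dual by simp
  qed
  have pos: "\<forall>\<^sub>F t in fl. \<forall>i\<in>insert z F. 0 < a (B t) i * \<alpha> i"
  proof (intro eventually_ball_finite ballI)
    fix i assume i: "i \<in> insert z F"
    have "((\<lambda>t. a (B t) i * \<alpha> i) \<longlongrightarrow> \<alpha> i * \<alpha> i) fl"
      using lim[OF i] by (intro tendsto_mult tendsto_const) (simp add: aA[OF i])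
    moreover have "0 < \<alpha> i * \<alpha> i" using stress(2)[OF i] by (metis not_real_square_gt_zero)
    ultimately show "\<forall>\<^sub>F t in fl. 0 < a (B t) i * \<alpha> i" by (rule order_tendstoD(1))
  qed (use F in auto)
  have zero: "(\<Sum>i\<in>insert z F. a V i *\<^sub>R V i) = 0" if V: "V z = (\<Sum>i\<in>F. x i *\<^sub>R V i)" for V x
  proof -
    have "b (dual_vector F V i) (V z) = gram_det F V * x i" if "i \<in> F" for i
      unfolding V by (rule form_dual_vector_sum[OF F(1) that])
    then have "(\<Sum>i\<in>F. c V i *\<^sub>R V i) = (\<Sum>i\<in>F. - (gram_det F V *\<^sub>R (x i *\<^sub>R V i)))"
      using F by (intro sum.cong refl) (auto simp: c_def)
    also have "\<dots> = - (c V z *\<^sub>R V z)"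
      unfolding V by (simp add: c_def sum_negf scaleR_sum_right)
    finally have "(\<Sum>i\<in>insert z F. c V i *\<^sub>R V i) = 0" using F by simp
    moreover have "(\<Sum>i\<in>insert z F. a V i *\<^sub>R V i) = (\<alpha> z / gram_det F A) *\<^sub>R (\<Sum>i\<in>insert z F. c V i *\<^sub>R V i)"
      unfolding scaleR_sum_right a_def by simp
    ultimately show ?thesis by simp
  qed
  have "\<forall>\<^sub>F t in fl. gram_det F (B t) \<noteq> 0"
    by (rule tendsto_imp_eventually_ne[OF _ D]) (intro tendsto_gdet tendsto_gram cont, auto)
  with pos show ?thesis
  proof eventually_elim
    case (elim t)
    then obtain x where "B t z = (\<Sum>i\<in>F. x i *\<^sub>R B t i)" using span by blast
    from zero[OF this] elim(1) show ?case by blast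
  qed
qed

text \<open>Serves the sphere and hyperbolic space at once. The derivatives come from
  \<open>has_real_derivative_cone_volume\<close>, and their weighted sum vanishes by
  \<open>stress_boundary_sum\<close> with the cone moments as facet weights.\<close>

lemma projected_rigidity:
  fixes P :: "real \<Rightarrow> nat \<Rightarrow> 'v"
  assumes k: "1 \<le> k" "k \<le> n" and \<sigma>: "\<sigma> * \<sigma> = 1" and \<epsilon>: "0 < \<epsilon>"
    and P': "\<And>t i. 0 \<le> t \<Longrightarrow> i \<in> {1..n + 2} \<Longrightarrow> ((\<lambda>t. P t i) has_vector_derivative P' t i) (at t within {0..})"
    and D: "\<And>t E. 0 \<le> t \<Longrightarrow> t < \<epsilon> \<Longrightarrow> E \<subseteq> {1..n + 2} \<Longrightarrow> E \<noteq> {} \<Longrightarrow> card E \<le> n + 1 \<Longrightarrow>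
      0 < \<sigma> * gram_det E (P t)"
    and co: "\<And>t F. 0 \<le> t \<Longrightarrow> t < \<epsilon> \<Longrightarrow> F \<in> faces n k \<Longrightarrow>
      \<exists>R. coercive F (\<lambda>i j. \<sigma> * gram (P t) i j) R \<and>
        (\<forall>\<^sub>F u in at t within {0..}. coercive F (\<lambda>i j. \<sigma> * gram (P u) i j) R)"
    and stress: "\<And>t. 0 \<le> t \<Longrightarrow> t < \<epsilon> \<Longrightarrow>
      \<exists>a. (\<Sum>i = 1..n + 2. a i *\<^sub>R P t i) = 0 \<and> (\<forall>i\<in>{1..n + 2}. 0 < a i * \<alpha> i)"
    and vol: "vol = (\<lambda>t F. parametrized_volume b k (std_simplex k)
      (\<lambda>x. radial_projection \<sigma> (affine_param k (face_vertices (P t) F) x)))"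
    and G: "G_constraints n k \<alpha> vol \<or> G'_constraints n k \<alpha> vol"
  shows "preserves_volumes_initially n k vol"
proof -
  let ?U = "{1..n + 2}"
  have faces: "faces n k = {F. F \<subseteq> ?U \<and> card F = Suc k}" by (auto simp: faces_def)
  have F: "finite F" "F \<subseteq> ?U" "card F = k + 1" "F \<noteq> {}" if "F \<in> faces n k" for F
    using that finite_subset[of F ?U] by (auto simp: faces)
  obtain a where a: "\<And>t. 0 \<le> t \<Longrightarrow> t < \<epsilon> \<Longrightarrow> (\<Sum>i = 1..n + 2. a t i *\<^sub>R P t i) = 0"
    "\<And>t i. 0 \<le> t \<Longrightarrow> t < \<epsilon> \<Longrightarrow> i \<in> ?U \<Longrightarrow> 0 < a t i * \<alpha> i"
    using stress by metis
  define \<kappa> where "\<kappa> = enn2real (radial_constant k)"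
  define S where "S t F = (\<Sum>i\<in>F. \<Sum>m\<in>F - {i}.
      (\<Sum>l\<in>F. gcof F (gram (P t)) i l * b (P t l) (P' t m)) *
      cone_moment (F - {i}) (\<lambda>i j. \<sigma> * gram (P t) i j) m)" for t F
  define v where "v t F = - \<sigma> / sqrt (\<sigma> * gram_det F (P t)) * S t F / \<kappa>" for t F
  \<comment> \<open>The square root cancels the denominator in \<open>v\<close>, so that only the
    stress products and the facet sums remain.\<close>
  define w where "w t F = (\<Prod>s\<in>F. a t s) * sqrt (\<sigma> * gram_det F (P t))" for t F
  have DF: "0 < \<sigma> * gram_det F (P t)" if "0 \<le> t" "t < \<epsilon>" "F \<in> faces n k" for t F
    using D[OF that(1,2)] F[OF that(3)] k by simp
  have vol_eq: "vol t F = sqrt (\<sigma> * gram_det F (P t)) * cone_integral F (\<lambda>i j. \<sigma> * gram (P t) i j) / \<kappa>"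
    if "0 \<le> t" "t < \<epsilon>" "F \<in> faces n k" for t F
    using co[OF that] projected_face_volume_eq[OF \<sigma> F(1,3)[OF that(3)]] unfolding vol \<kappa>_def by blast
  show ?thesis
  proof (rule constraints_imp_preserved[OF \<epsilon>, where v=v and w=w])
    fix t F assume t: "0 \<le> t" "t < \<epsilon>" and Fk: "F \<in> faces n k"
    obtain R where R: "coercive F (\<lambda>i j. \<sigma> * gram (P t) i j) R"
      "\<forall>\<^sub>F u in at t within {0..}. coercive F (\<lambda>i j. \<sigma> * gram (P u) i j) R"
      using co[OF t Fk] by blast
    have "((\<lambda>t. sqrt (\<sigma> * gram_det F (P t)) * cone_integral F (\<lambda>i j. \<sigma> * gram (P t) i j)) has_real_derivative
        - \<sigma> / sqrt (\<sigma> * gram_det F (P t)) * S t F) (at t within {0..})"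
      unfolding S_def
      by (rule has_real_derivative_cone_volume[OF F(1)[OF Fk] \<sigma> DF[OF t Fk] _ R]) (use P' t F(2)[OF Fk] in blast)
    from DERIV_cdivide[OF this, of \<kappa>]
    have "((\<lambda>t. sqrt (\<sigma> * gram_det F (P t)) * cone_integral F (\<lambda>i j. \<sigma> * gram (P t) i j) / \<kappa>) has_real_derivative
        v t F) (at t within {0..})" unfolding v_def .
    then show "((\<lambda>t. vol t F) has_real_derivative v t F) (at t within {0..})"
      \<comment> \<open>The volume formula is available only before \<epsilon>, hence within
        distance \<epsilon> - t of t.\<close>
      by (rule has_field_derivative_transform_within[where d="\<epsilon> - t"])
        (use t Fk vol_eq in \<open>auto simp: dist_real_def\<close>)
    have "w t F * (\<Prod>s\<in>F. \<alpha> s) = (\<Prod>s\<in>F. a t s * \<alpha> s) * sqrt (\<sigma> * gram_det F (P t))"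
      by (simp add: w_def prod.distrib)
    also have "\<dots> > 0"
    proof (rule mult_pos_pos)
      show "0 < (\<Prod>s\<in>F. a t s * \<alpha> s)"
        by (rule prod_pos) (use a(2)[OF t] F(2)[OF Fk] in blast)
      show "0 < sqrt (\<sigma> * gram_det F (P t))" using DF[OF t Fk] by simp
    qed
    finally show "0 < w t F * (\<Prod>s\<in>F. \<alpha> s)" .
  next
    fix t assume t: "0 \<le> t" "t < \<epsilon>"
    have "(\<Sum>F\<in>faces n k. w t F * v t F) = (\<Sum>F\<in>faces n k. - \<sigma> / \<kappa> * ((\<Prod>s\<in>F. a t s) * S t F))"
    proof (rule sum.cong[OF refl])
      fix F assume "F \<in> faces n k"
      then have "sqrt (\<sigma> * gram_det F (P t)) \<noteq> 0" using DF[OF t] by force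
      then show "w t F * v t F = - \<sigma> / \<kappa> * ((\<Prod>s\<in>F. a t s) * S t F)"
        unfolding w_def v_def by (simp add: divide_simps)
    qed
    also have "\<dots> = - \<sigma> / \<kappa> * (\<Sum>F | F \<subseteq> ?U \<and> card F = Suc k. (\<Prod>s\<in>F. a t s) * S t F)"
      unfolding faces by (rule sum_distrib_left[symmetric])
    also have "(\<Sum>F | F \<subseteq> ?U \<and> card F = Suc k. (\<Prod>s\<in>F. a t s) * S t F) = 0"
      unfolding S_def
    proof (rule stress_boundary_sum)
      show "(\<Sum>i\<in>?U. a t i *\<^sub>R P t i) = 0" by (rule a(1)[OF t])
      \<comment> \<open>E has k vertices, and k \<ge> 1 keeps it nonempty, as \<open>D\<close>
        demands.\<close>
      show "gram_det E (P t) \<noteq> 0" if "E \<subseteq> ?U" "card E = k" for E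
        using D[OF t that(1)] that k by force
      show "(\<Sum>l\<in>?U. a t l * b (P t l) (P' t m)) = 0" for m
      proof -
        have "(\<Sum>l\<in>?U. a t l * b (P t l) (P' t m)) = b (\<Sum>l\<in>?U. a t l *\<^sub>R P t l) (P' t m)"
          by (simp only: sum_left scale_left)
        then show ?thesis unfolding a(1)[OF t] by simp
      qed
    qed simp
    finally show "(\<Sum>F\<in>faces n k. w t F * v t F) = 0" by simp
  qed (rule G)
qed

end

text \<open>Fixes the ambient dimension as n + 1, so that n + 1 independent points span and the
  remaining point is a combination of them at every time.\<close>

locale ambient_form = symmetric_form b
  for b :: "real \<times> (real ^ 'n::finite) \<Rightarrow> real \<times> (real ^ 'n) \<Rightarrow> real"
begin

text \<open>Finitely many strict inequalities in continuous quantities persist for small t. The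
  empty set is excluded because its determinant 1 has the wrong sign when \<sigma> is -1.\<close>

lemma nondegenerate_initially:
  fixes B :: "real \<Rightarrow> nat \<Rightarrow> real \<times> (real ^ 'n)"
  defines "U \<equiv> {1..CARD('n) + 2}"
  assumes cont: "\<And>i. i \<in> U \<Longrightarrow> ((\<lambda>t. B t i) \<longlongrightarrow> B 0 i) (at 0 within {0..})"
    and D: "\<And>E. E \<subseteq> U \<Longrightarrow> E \<noteq> {} \<Longrightarrow> card E \<le> CARD('n) + 1 \<Longrightarrow> 0 < \<sigma> * gram_det E (B 0)"
    and stress: "linear_stress CARD('n) \<alpha> (B 0)"
  shows "\<exists>\<epsilon>>0. \<forall>t. 0 \<le> t \<and> t < \<epsilon> \<longrightarrow>
    (\<forall>E. E \<subseteq> U \<and> E \<noteq> {} \<and> card E \<le> CARD('n) + 1 \<longrightarrow> 0 < \<sigma> * gram_det E (B t)) \<and>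
    (\<exists>a. (\<Sum>i\<in>U. a i *\<^sub>R B t i) = 0 \<and> (\<forall>i\<in>U. 0 < a i * \<alpha> i))"
proof -
  let ?fl = "at 0 within {0::real..}"
  let ?F = "{1..CARD('n) + 1}"
  let ?\<E> = "{E. E \<subseteq> U \<and> E \<noteq> {} \<and> card E \<le> CARD('n) + 1}"
  define Q where "Q t \<longleftrightarrow> (\<forall>E\<in>?\<E>. 0 < \<sigma> * gram_det E (B t)) \<and>
    (\<exists>a. (\<Sum>i\<in>U. a i *\<^sub>R B t i) = 0 \<and> (\<forall>i\<in>U. 0 < a i * \<alpha> i))" for t
  have U: "U = insert (CARD('n) + 2) ?F" unfolding U_def by auto
  have "\<forall>\<^sub>F t in ?fl. \<forall>E\<in>?\<E>. 0 < \<sigma> * gram_det E (B t)"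
  proof (intro eventually_ball_finite ballI)
    have "finite U" by (simp add: U_def)
    then show "finite ?\<E>" by simp
    fix E assume E: "E \<in> ?\<E>"
    have "((\<lambda>t. \<sigma> * gram_det E (B t)) \<longlongrightarrow> \<sigma> * gram_det E (B 0)) ?fl"
      by (intro tendsto_mult tendsto_const tendsto_gdet tendsto_gram cont) (use E in auto)
    then show "\<forall>\<^sub>F t in ?fl. 0 < \<sigma> * gram_det E (B t)"
      by (rule order_tendstoD(1)) (use D E in auto)
  qed
  moreover have "\<forall>\<^sub>F t in ?fl. \<exists>a. (\<Sum>i\<in>U. a i *\<^sub>R B t i) = 0 \<and> (\<forall>i\<in>U. 0 < a i * \<alpha> i)"
    unfolding U
  proof (rule eventually_stress)
    have "?F \<subseteq> U" unfolding U by (rule subset_insertI)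
    then have "0 < \<sigma> * gram_det ?F (B 0)" by (rule D) auto
    then show "gram_det ?F (B 0) \<noteq> 0" by auto
    show "\<exists>x. B t (CARD('n) + 2) = (\<Sum>i\<in>?F. x i *\<^sub>R B t i)" if "gram_det ?F (B t) \<noteq> 0" for t
      by (rule independent_family_spans) (use gram_det_nonzero_imp_independent[OF _ that] in auto)
    show "(\<Sum>i\<in>insert (CARD('n) + 2) ?F. \<alpha> i *\<^sub>R B 0 i) = 0"
      using stress unfolding U[symmetric] by (simp add: linear_stress_def U_def)
    show "\<alpha> i \<noteq> 0" if "i \<in> insert (CARD('n) + 2) ?F" for i
      using stress that unfolding U[symmetric] by (auto simp: linear_stress_def U_def)
    show "((\<lambda>t. B t i) \<longlongrightarrow> B 0 i) ?fl" if "i \<in> insert (CARD('n) + 2) ?F" for i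
      using cont that unfolding U by blast
  qed auto
  ultimately have "\<forall>\<^sub>F t in ?fl. Q t" unfolding Q_def by eventually_elim auto
  then obtain \<epsilon> where \<epsilon>: "0 < \<epsilon>" "\<And>t. 0 \<le> t \<Longrightarrow> t \<noteq> 0 \<Longrightarrow> dist t 0 < \<epsilon> \<Longrightarrow> Q t"
    unfolding eventually_at by auto
  \<comment> \<open>The filter at 0 says nothing about the point 0 itself, where \<alpha> is the
    required stress.\<close>
  have "Q 0" unfolding Q_def
  proof (intro conjI ballI exI[of _ \<alpha>])
    show "(\<Sum>i\<in>U. \<alpha> i *\<^sub>R B 0 i) = 0" using stress by (simp add: linear_stress_def U_def)
    show "0 < \<alpha> i * \<alpha> i" if "i \<in> U" for i
      using stress that unfolding linear_stress_def U_def by (metis not_real_square_gt_zero)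
  qed (use D in auto)
  then have "Q t" if "0 \<le> t" "t < \<epsilon>" for t using \<epsilon>(2)[of t] that by (cases "t = 0") auto
  then show ?thesis using \<epsilon>(1) unfolding Q_def by blast
qed

end

section \<open>The three geometries\<close>

interpretation euclid: symmetric_form inner
  by (intro symmetric_form.intro symmetric_form_axioms.intro bounded_bilinear_inner inner_commute)

lemma independent_family_nonzero:
  assumes "finite F" "independent_family F B" "i \<in> F"
  shows "B i \<noteq> 0"
proof -
  have "independent (B ` F)" using assms independent_family_iff by blast
  then show ?thesis using assms(3) dependent_zero[of "B ` F"] by force
qed

lemma gram_det_pos:
  assumes "finite F" "independent_family F B"
  shows "0 < euclid.gram_det F B"
proof (cases "F = {}")
  case False
  have "0 < 1 * euclid.gram_det F B"
    by (rule euclid.gram_det_sign[OF assms(1) False assms(2)])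
      (use independent_family_nonzero[OF assms] in auto)
  then show ?thesis by simp
qed simp

text \<open>The Gram determinant times x i is the product of the dual vector with the point
  \<open>?p\<close>. Cauchy-Schwarz bounds the square of x i by the diagonal cofactor divided by the
  determinant.\<close>

lemma coercive_gram:
  assumes F: "finite F" and D: "0 < euclid.gram_det F B" and R: "0 \<le> R"
    and K: "\<And>i. i \<in> F \<Longrightarrow> gcof F (euclid.gram B) i i \<le> R\<^sup>2 * euclid.gram_det F B"
  shows "coercive F (euclid.gram B) R"
  unfolding coercive_def
proof (intro allI impI ballI)
  fix x i assume x: "(\<forall>i\<in>F. 0 \<le> x i) \<and> qform F (euclid.gram B) x \<le> 1" and i: "i \<in> F"
  let ?D = "euclid.gram_det F B" and ?N = "euclid.dual_vector F B i" and ?p = "\<Sum>m\<in>F. x m *\<^sub>R B m"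
  let ?K = "gcof F (euclid.gram B) i i"
  have p: "?p \<bullet> ?p \<le> 1"
    using x euclid.qform_gram[of F 1 B x] by simp
  have N: "?N \<bullet> ?N = ?D * ?K" by (rule euclid.form_dual_vector_self[OF F i])
  have "(?D * x i)\<^sup>2 = (?N \<bullet> ?p)\<^sup>2" by (simp only: euclid.form_dual_vector_sum[OF F i])
  also have "\<dots> \<le> (?N \<bullet> ?N) * (?p \<bullet> ?p)" by (rule Cauchy_Schwarz_ineq)
  also have "\<dots> \<le> (?N \<bullet> ?N) * 1" using p by (intro mult_left_mono) auto
  also have "\<dots> \<le> ?D * (R\<^sup>2 * ?D)" unfolding N using K[OF i] D by simp
  also have "\<dots> = (?D * R)\<^sup>2" by (simp add: power2_eq_square)
  finally have "?D * x i \<le> ?D * R" by (rule power2_le_imp_le) (use D R in simp)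
  then show "x i \<le> R" using D by simp
qed

lemma coercive_gram_near:
  assumes F: "finite F" and D: "0 < euclid.gram_det F (B s)"
    and cont: "\<And>i. i \<in> F \<Longrightarrow> ((\<lambda>t. B t i) \<longlongrightarrow> B s i) (at s within S)"
  shows "\<exists>R. coercive F (euclid.gram (B s)) R \<and> (\<forall>\<^sub>F t in at s within S. coercive F (euclid.gram (B t)) R)"
proof -
  let ?D = "\<lambda>t. euclid.gram_det F (B t)" and ?K = "\<lambda>t i. gcof F (euclid.gram (B t)) i i"
  \<comment> \<open>The added 1 makes the bound strict, so that it persists near s, and gives R
    \<ge> 1, hence R \<le> R^2.\<close>
  define R where "R = 1 + (\<Sum>i\<in>F. \<bar>?K s i\<bar> / ?D s)"
  have R1: "1 \<le> R" unfolding R_def using D by (simp add: sum_nonneg)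
  have K: "?K s i < R\<^sup>2 * ?D s" if i: "i \<in> F" for i
  proof -
    have "\<bar>?K s i\<bar> / ?D s \<le> (\<Sum>i\<in>F. \<bar>?K s i\<bar> / ?D s)"
      using i F D by (intro member_le_sum) auto
    then have "\<bar>?K s i\<bar> / ?D s < R" by (simp add: R_def)
    also have "R \<le> R\<^sup>2" using R1 by (simp add: power2_eq_square)
    finally have "\<bar>?K s i\<bar> < R\<^sup>2 * ?D s" using D by (simp add: divide_less_eq)
    then show ?thesis by linarith
  qed
  have limD: "(?D \<longlongrightarrow> ?D s) (at s within S)"
    by (intro tendsto_gdet euclid.tendsto_gram cont)
  have "\<forall>\<^sub>F t in at s within S. \<forall>i\<in>F. 0 < R\<^sup>2 * ?D t - ?K t i"
  proof (intro eventually_ball_finite ballI F)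
    fix i assume i: "i \<in> F"
    have "((\<lambda>t. R\<^sup>2 * ?D t - ?K t i) \<longlongrightarrow> R\<^sup>2 * ?D s - ?K s i) (at s within S)"
      by (intro tendsto_diff tendsto_mult tendsto_const limD tendsto_gcof euclid.tendsto_gram cont)
    then show "\<forall>\<^sub>F t in at s within S. 0 < R\<^sup>2 * ?D t - ?K t i"
      by (rule order_tendstoD(1)) (use K[OF i] in simp)
  qed
  moreover have "\<forall>\<^sub>F t in at s within S. 0 < ?D t" by (rule order_tendstoD(1)[OF limD D])
  ultimately have "\<forall>\<^sub>F t in at s within S. coercive F (euclid.gram (B t)) R"
  proof eventually_elim
    case (elim t)
    show ?case by (rule coercive_gram[OF F elim(2)]) (use elim(1) R1 in force)+
  qed
  moreover have "coercive F (euclid.gram (B s)) R"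
    by (rule coercive_gram[OF F D]) (use K R1 in force)+
  ultimately show ?thesis by blast
qed

lemma independent_subfamily:
  assumes "linearly_nondegenerate_faces n A" "E \<subseteq> {1..n + 2}" "card E \<le> n + 1"
  shows "independent_family E A"
proof -
  obtain F where F: "E \<subseteq> F" "F \<in> faces n n" using face_extends assms(2,3) by blast
  have fin: "finite F" using F(2) finite_subset[of F "{1..n + 2}"] by (auto simp: faces_def)
  have "independent_family F A"
    using assms(1) F(2) fin by (auto simp: linearly_nondegenerate_faces_def independent_family_iff)
  then show ?thesis using independent_family_subset fin F(1) by blast
qed

lemma smooth_motion_start:
  assumes "smooth_motion n M A P" "i \<in> {1..n + 2}"
  shows "P 0 i = A i"
  using assms by (simp add: smooth_motion_def)

lemma linear_stress_cong:
  assumes "linear_stress n \<alpha> A" "\<And>i. i \<in> {1..n + 2} \<Longrightarrow> B i = A i"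
  shows "linear_stress n \<alpha> B"
proof -
  have "(\<Sum>i = 1..n + 2. \<alpha> i *\<^sub>R B i) = (\<Sum>i = 1..n + 2. \<alpha> i *\<^sub>R A i)"
    by (rule sum.cong[OF refl]) (simp only: assms(2))
  then show ?thesis using assms(1) by (simp add: linear_stress_def)
qed

lemma has_vector_derivative_imp_tendsto:
  assumes "(f has_vector_derivative f') (at t within S)"
  shows "(f \<longlongrightarrow> f t) (at t within S)"
  using has_vector_derivative_continuous[OF assms] by (simp add: continuous_within)

section \<open>The sphere\<close>

lemma spherical_rigidity:
  fixes A :: "nat \<Rightarrow> real \<times> (real ^ 'n::finite)" and k :: nat
  assumes k: "1 \<le> k" "k \<le> CARD('n)"
    and nd: "linearly_nondegenerate_faces CARD('n) A"
    and st: "linear_stress CARD('n) \<alpha> A"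
    and P: "smooth_motion CARD('n) (sphere 0 1) A P"
    and vol: "vol = (\<lambda>t F. spherical_simplex_volume k (face_vertices (P t) F))"
    and G: "G_constraints CARD('n) k \<alpha> vol \<or> G'_constraints CARD('n) k \<alpha> vol"
  shows "preserves_volumes_initially CARD('n) k vol"
proof -
  interpret ambient_form "inner :: real \<times> (real ^ 'n) \<Rightarrow> real \<times> (real ^ 'n) \<Rightarrow> real" ..
  obtain P' where P': "\<And>t i. 0 \<le> t \<Longrightarrow> i \<in> {1..CARD('n) + 2} \<Longrightarrow>
      ((\<lambda>t. P t i) has_vector_derivative P' t i) (at t within {0..})"
    by (rule smooth_motionE[OF P]) blast
  have cont: "((\<lambda>t. P t i) \<longlongrightarrow> P t i) (at t within {0..})" if "0 \<le> t" "i \<in> {1..CARD('n) + 2}" for t i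
    using has_vector_derivative_imp_tendsto[OF P'[OF that]] .
  have D0: "0 < 1 * euclid.gram_det E (P 0)" if E: "E \<subseteq> {1..CARD('n) + 2}" "E \<noteq> {}" "card E \<le> CARD('n) + 1" for E
  proof -
    have "euclid.gram_det E (P 0) = euclid.gram_det E A"
      by (rule euclid.gram_det_cong) (use smooth_motion_start[OF P] E(1) in blast)
    moreover have "finite E" using E(1) finite_subset by blast
    ultimately show ?thesis using gram_det_pos[OF _ independent_subfamily[OF nd E(1,3)]] by simp
  qed
  have st0: "linear_stress CARD('n) \<alpha> (P 0)"
    by (rule linear_stress_cong[OF st smooth_motion_start[OF P]])
  have "\<exists>\<epsilon>>0. \<forall>t. 0 \<le> t \<and> t < \<epsilon> \<longrightarrow>
      (\<forall>E. E \<subseteq> {1..CARD('n) + 2} \<and> E \<noteq> {} \<and> card E \<le> CARD('n) + 1 \<longrightarrow> 0 < 1 * euclid.gram_det E (P t)) \<and>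
      (\<exists>a. (\<Sum>i\<in>{1..CARD('n) + 2}. a i *\<^sub>R P t i) = 0 \<and> (\<forall>i\<in>{1..CARD('n) + 2}. 0 < a i * \<alpha> i))" (is "\<exists>\<epsilon>>0. ?near \<epsilon>")
    by (rule nondegenerate_initially[where B=P and \<sigma>=1 and \<alpha>=\<alpha>, OF _ _ st0])
      (rule cont[OF order_refl] D0; assumption)+
  then obtain \<epsilon> where \<epsilon>0: "0 < \<epsilon>" and near: "?near \<epsilon>" by blast
  have near_det: "0 < 1 * euclid.gram_det E (P t)"
    if "0 \<le> t" "t < \<epsilon>" "E \<subseteq> {1..CARD('n) + 2}" "E \<noteq> {}" "card E \<le> CARD('n) + 1" for t E
    using near that by blast
  have near_stress: "\<exists>a. (\<Sum>i\<in>{1..CARD('n) + 2}. a i *\<^sub>R P t i) = 0 \<and> (\<forall>i\<in>{1..CARD('n) + 2}. 0 < a i * \<alpha> i)" if "0 \<le> t" "t < \<epsilon>" for t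
    using near that by blast
  note \<epsilon> = \<epsilon>0 near_det near_stress
  show ?thesis
  proof (rule euclid.projected_rigidity[where P=P and P'=P' and \<sigma>=1 and \<alpha>=\<alpha>, OF k _ \<epsilon>(1) P' \<epsilon>(2) _ \<epsilon>(3) _ G])
    fix t F assume t: "0 \<le> t" "t < \<epsilon>" and F: "F \<in> faces CARD('n) k"
    have U: "F \<subseteq> {1..CARD('n) + 2}" and card: "card F = k + 1" using F by (auto simp: faces_def)
    have fin: "finite F" using U finite_subset by blast
    have "0 < euclid.gram_det F (P t)" using \<epsilon>(2)[OF t U] card k by force
    then have "\<exists>R. coercive F (euclid.gram (P t)) R \<and>
        (\<forall>\<^sub>F u in at t within {0..}. coercive F (euclid.gram (P u)) R)"
      by (rule coercive_gram_near[where B=P and s=t, OF fin]) (use cont[OF t(1)] U in blast)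
    then show "\<exists>R. coercive F (\<lambda>i j. 1 * euclid.gram (P t) i j) R \<and>
        (\<forall>\<^sub>F u in at t within {0..}. coercive F (\<lambda>i j. 1 * euclid.gram (P u) i j) R)"
      by simp
  next
    have "(sphere_proj :: real \<times> (real ^ 'n) \<Rightarrow> _) = euclid.radial_projection 1"
      by (simp add: fun_eq_iff sphere_proj_def euclid.radial_projection_def norm_eq_sqrt_inner)
    then show "vol = (\<lambda>t F. parametrized_volume inner k (std_simplex k)
        (\<lambda>x. euclid.radial_projection 1 (affine_param k (face_vertices (P t) F) x)))"
      unfolding vol spherical_simplex_volume_def by simp
  qed simp
qed

section \<open>Hyperbolic space\<close>

lemma symmetric_form_lorentz: "symmetric_form (lorentz :: real \<times> (real ^ 'n::finite) \<Rightarrow> _)"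
proof
  show "\<exists>K. \<forall>a b :: real \<times> (real ^ 'n). norm (lorentz a b) \<le> norm a * norm b * K"
  proof (intro exI allI)
    fix a b :: "real \<times> (real ^ 'n)"
    have le: "\<bar>fst x\<bar> \<le> norm x" "norm (snd x) \<le> norm x" for x :: "real \<times> (real ^ 'n)"
      using norm_fst_le[of "fst x" "snd x"] norm_snd_le[of "snd x" "fst x"] by simp_all
    have "\<bar>fst a * fst b\<bar> \<le> norm a * norm b"
      unfolding abs_mult by (intro mult_mono le) auto
    moreover have "\<bar>snd a \<bullet> snd b\<bar> \<le> norm a * norm b"
      by (rule order_trans[OF Cauchy_Schwarz_ineq2]) (intro mult_mono le norm_ge_zero)
    ultimately show "norm (lorentz a b) \<le> norm a * norm b * 2" by (simp add: lorentz_def)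
  qed
qed (auto simp: lorentz_def algebra_simps inner_add_left inner_add_right inner_commute)

text \<open>Otherwise Cauchy-Schwarz for the spatial parts bounds (fst v)^2 (fst x)^2 by (fst v)^2
  ((fst x)^2 - 1), which forces fst v = 0 and then v = 0.\<close>

lemma lorentz_orthogonal_pos:
  assumes x: "x \<in> hyperbolic_space" and orth: "lorentz v x = 0" and v: "v \<noteq> 0"
  shows "0 < lorentz v v"
proof (rule ccontr)
  assume "\<not> 0 < lorentz v v"
  then have vv: "snd v \<bullet> snd v \<le> (fst v)\<^sup>2" by (simp add: lorentz_def power2_eq_square)
  have xx: "snd x \<bullet> snd x = (fst x)\<^sup>2 - 1" using x by (simp add: hyperbolic_space_def lorentz_def power2_eq_square)
  have "(fst v)\<^sup>2 * (fst x)\<^sup>2 = (snd v \<bullet> snd x)\<^sup>2"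
    using orth by (simp add: lorentz_def power_mult_distrib[symmetric])
  also have "\<dots> \<le> (snd v \<bullet> snd v) * (snd x \<bullet> snd x)" by (rule Cauchy_Schwarz_ineq)
  also have "\<dots> \<le> (fst v)\<^sup>2 * ((fst x)\<^sup>2 - 1)"
    unfolding xx[symmetric] using vv by (intro mult_right_mono) auto
  finally have "(fst v)\<^sup>2 \<le> 0" by (simp add: right_diff_distrib)
  then have "fst v = 0" by simp
  moreover from this have "snd v \<bullet> snd v = 0" using vv by (intro antisym) simp_all
  then have "snd v = 0" by simp
  ultimately show False using v by (simp add: prod_eq_iff)
qed

text \<open>The spatial part of a point of the hyperboloid is no longer than its first coordinate.
  This makes all entries of the negated Gram matrix nonnegative.\<close>

lemma lorentz_nonpos:
  assumes "x \<in> hyperbolic_space" "y \<in> hyperbolic_space"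
  shows "lorentz x y \<le> 0"
proof -
  have le: "norm (snd z) \<le> fst z" if "z \<in> hyperbolic_space" for z :: "real \<times> (real ^ 'n)"
  proof (rule power2_le_imp_le)
    have "snd z \<bullet> snd z \<le> (fst z)\<^sup>2"
      using that by (simp add: hyperbolic_space_def lorentz_def power2_eq_square)
    then show "(norm (snd z))\<^sup>2 \<le> (fst z)\<^sup>2" by (simp only: power2_norm_eq_inner)
    show "0 \<le> fst z" using that by (simp add: hyperbolic_space_def)
  qed
  have "snd x \<bullet> snd y \<le> norm (snd x) * norm (snd y)" by (rule norm_cauchy_schwarz)
  also have "\<dots> \<le> fst x * fst y"
    using le[OF assms(1)] le[OF assms(2)] order_trans[OF norm_ge_zero le[OF assms(1)]]
    by (intro mult_mono) auto
  finally show ?thesis by (simp add: lorentz_def)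
qed

lemma hyperbolic_rigidity:
  fixes A :: "nat \<Rightarrow> real \<times> (real ^ 'n::finite)" and k :: nat
  assumes k: "1 \<le> k" "k \<le> CARD('n)"
    and nd: "linearly_nondegenerate_faces CARD('n) A"
    and st: "linear_stress CARD('n) \<alpha> A"
    and P: "smooth_motion CARD('n) hyperbolic_space A P"
    and vol: "vol = (\<lambda>t F. hyperbolic_simplex_volume k (face_vertices (P t) F))"
    and G: "G_constraints CARD('n) k \<alpha> vol \<or> G'_constraints CARD('n) k \<alpha> vol"
  shows "preserves_volumes_initially CARD('n) k vol"
proof -
  interpret symmetric_form "lorentz :: real \<times> (real ^ 'n) \<Rightarrow> real \<times> (real ^ 'n) \<Rightarrow> real"
    by (rule symmetric_form_lorentz)
  interpret ambient_form "lorentz :: real \<times> (real ^ 'n) \<Rightarrow> real \<times> (real ^ 'n) \<Rightarrow> real" ..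
  have H: "P t i \<in> hyperbolic_space" if "0 \<le> t" "i \<in> {1..CARD('n) + 2}" for t i
    using P that by (simp add: smooth_motion_def)
  obtain P' where P': "\<And>t i. 0 \<le> t \<Longrightarrow> i \<in> {1..CARD('n) + 2} \<Longrightarrow>
      ((\<lambda>t. P t i) has_vector_derivative P' t i) (at t within {0..})"
    by (rule smooth_motionE[OF P]) blast
  have cont: "((\<lambda>t. P t i) \<longlongrightarrow> P t i) (at t within {0..})" if "0 \<le> t" "i \<in> {1..CARD('n) + 2}" for t i
    using has_vector_derivative_imp_tendsto[OF P'[OF that]] .
  have D0: "0 < - 1 * gram_det E (P 0)"
    if E: "E \<subseteq> {1..CARD('n) + 2}" "E \<noteq> {}" "card E \<le> CARD('n) + 1" for E
  proof (rule gram_det_sign)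
    show "finite E" using E(1) finite_subset by blast
    have "independent_family E A" by (rule independent_subfamily[OF nd E(1,3)])
    moreover have "(\<Sum>i\<in>E. x i *\<^sub>R P 0 i) = (\<Sum>i\<in>E. x i *\<^sub>R A i)" for x
      by (rule sum.cong[OF refl]) (use smooth_motion_start[OF P] E in auto)
    ultimately show "independent_family E (P 0)" by (simp add: independent_family_def)
    show "0 < - 1 * lorentz (P 0 i) (P 0 i)" if "i \<in> E" for i
      using H[of 0 i] that E by (auto simp: hyperbolic_space_def)
    show "0 < lorentz v v" if "i \<in> E" "lorentz v (P 0 i) = 0" "v \<noteq> 0" for v i
      using lorentz_orthogonal_pos[OF H[of 0 i] that(2,3)] that(1) E by auto
  qed (rule E(2))
  have st0: "linear_stress CARD('n) \<alpha> (P 0)"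
    by (rule linear_stress_cong[OF st smooth_motion_start[OF P]])
  have "\<exists>\<epsilon>>0. \<forall>t. 0 \<le> t \<and> t < \<epsilon> \<longrightarrow>
      (\<forall>E. E \<subseteq> {1..CARD('n) + 2} \<and> E \<noteq> {} \<and> card E \<le> CARD('n) + 1 \<longrightarrow> 0 < - 1 * gram_det E (P t)) \<and>
      (\<exists>a. (\<Sum>i\<in>{1..CARD('n) + 2}. a i *\<^sub>R P t i) = 0 \<and> (\<forall>i\<in>{1..CARD('n) + 2}. 0 < a i * \<alpha> i))" (is "\<exists>\<epsilon>>0. ?near \<epsilon>")
    by (rule nondegenerate_initially[where B=P and \<sigma>="- 1" and \<alpha>=\<alpha>, OF _ _ st0])
      (rule cont[OF order_refl] D0; assumption)+
  then obtain \<epsilon> where \<epsilon>0: "0 < \<epsilon>" and near: "?near \<epsilon>" by blast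
  have near_det: "0 < - 1 * gram_det E (P t)"
    if "0 \<le> t" "t < \<epsilon>" "E \<subseteq> {1..CARD('n) + 2}" "E \<noteq> {}" "card E \<le> CARD('n) + 1" for t E
    using near that by blast
  have near_stress: "\<exists>a. (\<Sum>i\<in>{1..CARD('n) + 2}. a i *\<^sub>R P t i) = 0 \<and> (\<forall>i\<in>{1..CARD('n) + 2}. 0 < a i * \<alpha> i)" if "0 \<le> t" "t < \<epsilon>" for t
    using near that by blast
  note \<epsilon> = \<epsilon>0 near_det near_stress
  \<comment> \<open>The negated Gram matrix has nonnegative entries and diagonal 1, so the square of
    each coordinate is at most the value of the form. The bound 1 therefore works for all times at
    once.\<close>
  have co: "coercive F (\<lambda>i j. - 1 * gram (P t) i j) 1"
    if t: "0 \<le> t" and U: "F \<subseteq> {1..CARD('n) + 2}" for t F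
    unfolding coercive_def
  proof (intro allI impI ballI)
    fix x i assume x: "(\<forall>i\<in>F. 0 \<le> x i) \<and> qform F (\<lambda>i j. - 1 * gram (P t) i j) x \<le> 1" and i: "i \<in> F"
    have fin: "finite F" using U finite_subset by blast
    have nonneg: "0 \<le> - 1 * gram (P t) l j * x l * x j" if "l \<in> F" "j \<in> F" for l j
    proof -
      have "lorentz (P t l) (P t j) \<le> 0" using lorentz_nonpos[OF H[OF t] H[OF t]] that U by blast
      then have "0 \<le> - 1 * gram (P t) l j" by (simp add: gram_def)
      then show ?thesis by (rule mult_nonneg_nonneg[OF mult_nonneg_nonneg]) (use x that in auto)
    qed
    have "x i * x i = - 1 * gram (P t) i i * x i * x i"
      using H[OF t, of i] i U by (auto simp: gram_def hyperbolic_space_def)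
    also have "\<dots> \<le> (\<Sum>j\<in>F. - 1 * gram (P t) i j * x i * x j)"
      by (rule member_le_sum[OF i _ fin]) (use nonneg i in blast)
    also have "\<dots> \<le> qform F (\<lambda>i j. - 1 * gram (P t) i j) x"
      unfolding qform_def by (rule member_le_sum[OF i _ fin]) (use nonneg in \<open>blast intro: sum_nonneg\<close>)
    finally have "(x i)\<^sup>2 \<le> 1\<^sup>2" using x by (simp add: power2_eq_square)
    then show "x i \<le> 1" by (rule power2_le_imp_le) simp
  qed
  show ?thesis
  proof (rule projected_rigidity[where P=P and P'=P' and \<sigma>="- 1" and \<alpha>=\<alpha>, OF k _ \<epsilon>(1) P' \<epsilon>(2) _ \<epsilon>(3) _ G])
    fix t F assume t: "0 \<le> t" "t < \<epsilon>" and F: "F \<in> faces CARD('n) k"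
    have U: "F \<subseteq> {1..CARD('n) + 2}" using F by (auto simp: faces_def)
    show "\<exists>R. coercive F (\<lambda>i j. - 1 * gram (P t) i j) R \<and>
        (\<forall>\<^sub>F u in at t within {0..}. coercive F (\<lambda>i j. - 1 * gram (P u) i j) R)"
    proof (intro exI conjI)
      show "\<forall>\<^sub>F u in at t within {0..}. coercive F (\<lambda>i j. - 1 * gram (P u) i j) 1"
        unfolding eventually_at_filter by (rule always_eventually) (use co[OF _ U] in simp)
    qed (rule co[OF t(1) U])
  next
    have "hyperbolic_proj = radial_projection (- 1)"
      by (simp add: fun_eq_iff hyperbolic_proj_def radial_projection_def)
    then show "vol = (\<lambda>t F. parametrized_volume lorentz k (std_simplex k)
        (\<lambda>x. radial_projection (- 1) (affine_param k (face_vertices (P t) F) x)))"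
      unfolding vol hyperbolic_simplex_volume_def by simp
  qed simp
qed

section \<open>Euclidean space\<close>

text \<open>A Euclidean simplex is lifted to the height c, where affine relations become linear. The dependence of
  the Gram determinant on c isolates the squared volume.\<close>

lemma gram_det_lift:
  fixes u :: "nat \<Rightarrow> 'v::real_inner" and c :: real
  shows "euclid.gram_det {..k} (\<lambda>i. (c, u i)) =
    c\<^sup>2 * euclid.gram_det {..<k} (\<lambda>i. u i - u k) + euclid.gram_det {..k} u"
proof -
  let ?h = "\<lambda>i. if i < k then u i - u k else u k" and ?k = "{..k}"
  let ?M = "euclid.gram ?h"
  have ins: "?k = insert k {..<k}" by auto
  have "euclid.gram_det ?k (\<lambda>i. (c, u i)) =
      euclid.gram_det ?k (\<lambda>i. (c, u i) + (if i = k then 0 else - 1) *\<^sub>R (c, u k))"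
    using euclid.gram_det_add_multiples[of ?k k "\<lambda>i. (c, u i)" "\<lambda>_. - 1"] by simp
  \<comment> \<open>After the subtraction only vector k keeps the height, so c enters only the entry
    (k, k).\<close>
  also have "\<dots> = gdet ?k (?M(k := (\<lambda>j. ?M k j + c\<^sup>2 * of_bool (j = k))))"
    by (rule gdet_cong) (auto simp: euclid.gram_def power2_eq_square)
  also have "\<dots> = (\<Sum>l\<in>?k. gcof ?k ?M k l * ?M k l) + c\<^sup>2 * (\<Sum>l\<in>?k. gcof ?k ?M k l * of_bool (l = k))"
    by (subst gdet_row) (auto simp: distrib_left sum.distrib sum_distrib_left mult_ac)
  also have "(\<Sum>l\<in>?k. gcof ?k ?M k l * ?M k l) = gdet ?k ?M"
    using gcof_mult_row[of ?k k k ?M] by simp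
  also have "(\<Sum>l\<in>?k. gcof ?k ?M k l * of_bool (l = k)) = gcof ?k ?M k k"
    by (subst sum.remove[of _ k]) (auto intro!: sum.neutral)
  also have "gcof ?k ?M k k = gdet {..<k} ?M"
    unfolding ins by (rule gcof_insert_self) auto
  also have "gdet {..<k} ?M = euclid.gram_det {..<k} (\<lambda>i. u i - u k)"
    by (rule euclid.gram_det_cong) simp
  also have "gdet ?k ?M = euclid.gram_det ?k (\<lambda>i. u i + (if i = k then 0 else - 1) *\<^sub>R u k)"
    by (rule euclid.gram_det_cong) auto
  also have "\<dots> = euclid.gram_det ?k u"
    using euclid.gram_det_add_multiples[of ?k k u "\<lambda>_. - 1"] by simp
  finally show ?thesis by simp
qed

lemma independent_differences:
  fixes u :: "nat \<Rightarrow> 'v::real_inner"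
  assumes "independent_family {..k} (\<lambda>i. (1::real, u i))"
  shows "independent_family {..<k} (\<lambda>i. u i - u k)"
  unfolding independent_family_def
proof (intro allI impI ballI)
  fix x i assume x: "(\<Sum>i<k. x i *\<^sub>R (u i - u k)) = 0" and i: "i \<in> {..<k}"
  let ?y = "\<lambda>i. if i < k then x i else - (\<Sum>i<k. x i)"
  have "(\<Sum>i\<le>k. ?y i *\<^sub>R (1::real, u i)) = 0"
    using x unfolding lessThan_Suc_atMost[symmetric]
    by (simp add: prod_eq_iff fst_sum snd_sum scaleR_diff_right sum_subtractf scaleR_sum_left)
  then have "\<forall>i\<in>{..k}. ?y i = 0"
    using assms[unfolded independent_family_def, THEN spec, of ?y] by blast
  then have "?y i = 0" using i by (auto dest: bspec[of _ _ i])
  then show "x i = 0" using i by simp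
qed

text \<open>The column sum is a determinant with row l replaced by ones. The height adds c^2 to the
  entries of the other rows, which is a multiple of that row, so c drops out.\<close>

lemma gcof_column_sum_lift:
  fixes u :: "'i \<Rightarrow> 'v::real_inner" and c :: real
  assumes "finite F" "l \<in> F"
  shows "(\<Sum>i\<in>F. gcof F (euclid.gram (\<lambda>i. (c, u i))) i l) = gdet F ((euclid.gram u)(l := (\<lambda>_. 1)))"
proof -
  let ?G = "euclid.gram (\<lambda>i. (c, u i))" and ?N = "(euclid.gram u)(l := (\<lambda>_. 1))"
  have "(\<Sum>i\<in>F. gcof F ?G i l) = (\<Sum>i\<in>F. gcof F ?G l i * 1)"
    by (intro sum.cong refl) (simp add: gcof_sym[OF assms(1) _ assms(2)] euclid.gram_commute)
  also have "\<dots> = gdet F (?G(l := (\<lambda>_. 1)))" by (rule gdet_row[OF assms, symmetric])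
  also have "\<dots> = gdet F (\<lambda>i j. ?N i j + (if i = l then 0 else c\<^sup>2) * ?N l j)"
    by (rule gdet_cong) (simp add: euclid.gram_def power2_eq_square)
  also have "\<dots> = gdet F ?N" by (rule gdet_add_rows[OF assms])
  finally show ?thesis .
qed

text \<open>Separates half the derivative of a Gram determinant into a part that sees K only through
  column sums, which do not depend on the height, and off-diagonal terms of the kind treated by
  \<open>stress_boundary_sum\<close>.\<close>

lemma trace_split:
  fixes K C :: "'i \<Rightarrow> 'i \<Rightarrow> real"
  assumes "finite F"
  shows "(\<Sum>i\<in>F. \<Sum>l\<in>F. K i l * C l i) =
    (\<Sum>l\<in>F. (\<Sum>i\<in>F. K i l) * (\<Sum>m\<in>F. C l m)) - (\<Sum>i\<in>F. \<Sum>m\<in>F - {i}. \<Sum>l\<in>F. K i l * C l m)"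
proof -
  have "(\<Sum>l\<in>F. (\<Sum>i\<in>F. K i l) * (\<Sum>m\<in>F. C l m)) = (\<Sum>l\<in>F. \<Sum>i\<in>F. \<Sum>m\<in>F. K i l * C l m)"
    by (simp add: sum_product)
  also have "\<dots> = (\<Sum>i\<in>F. \<Sum>l\<in>F. \<Sum>m\<in>F. K i l * C l m)" by (rule sum.swap)
  also have "\<dots> = (\<Sum>i\<in>F. \<Sum>m\<in>F. \<Sum>l\<in>F. K i l * C l m)" by (rule sum.cong[OF refl], rule sum.swap)
  also have "\<dots> = (\<Sum>i\<in>F. (\<Sum>l\<in>F. K i l * C l i) + (\<Sum>m\<in>F - {i}. \<Sum>l\<in>F. K i l * C l m))"
    by (rule sum.cong[OF refl], rule sum.remove[OF assms])
  finally show ?thesis by (simp add: sum.distrib)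
qed

text \<open>The tangent vectors are constant, so the integrand is; the second factor depends on k
  alone and passes through the differentiation as a constant.\<close>

lemma euclidean_simplex_volume_eq:
  "euclidean_simplex_volume k v = sqrt (euclid.gram_det {..<k} (\<lambda>i. v (Suc i) - v 0)) *
    (LINT x:std_simplex k|Pi\<^sub>M {..<k} (\<lambda>_. lborel). 1)"
proof -
  have pd: "partial_deriv (affine_param k v) i x = v (Suc i) - v 0" if "i < k" for i x
    unfolding partial_deriv_def affine_param_fun_upd[OF that]
    by (rule vector_derivative_at) (auto intro!: derivative_eq_intros)
  have "Determinant.det (Matrix.mat k k (\<lambda>(i, j). partial_deriv (affine_param k v) i x \<bullet> partial_deriv (affine_param k v) j x)) =
      euclid.gram_det {..<k} (\<lambda>i. v (Suc i) - v 0)" for x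
    unfolding det_mat_eq_gdet by (rule gdet_cong) (simp add: pd euclid.gram_def)
  then show ?thesis
    unfolding euclidean_simplex_volume_def parametrized_volume_def
    by (simp add: set_integral_mult_right[symmetric] del: set_integral_mult_right)
qed

text \<open>At height c the Gram determinant of a face has derivative 2 T c. In T 2 - T 1 the
  column-sum parts of \<open>trace_split\<close> cancel, leaving Y 1 - Y 2, and each Y, weighted
  with the stress products, sums to zero over the faces.\<close>

lemma euclidean_rigidity:
  fixes A :: "nat \<Rightarrow> real ^ 'n::finite" and k :: nat
  assumes k: "1 \<le> k" "k \<le> CARD('n)"
    and nd: "affinely_nondegenerate_faces CARD('n) A"
    and st: "affine_stress CARD('n) \<alpha> A"
    and P: "smooth_motion CARD('n) UNIV A P"
    and vol: "vol = (\<lambda>t F. euclidean_simplex_volume k (face_vertices (P t) F))"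
    and G: "G_constraints CARD('n) k \<alpha> vol \<or> G'_constraints CARD('n) k \<alpha> vol"
  shows "preserves_volumes_initially CARD('n) k vol"
proof -
  let ?U = "{1..CARD('n) + 2}"
  interpret ambient_form "inner :: real \<times> (real ^ 'n) \<Rightarrow> real \<times> (real ^ 'n) \<Rightarrow> real" ..
  define L where "L c t i = (c, P t i)" for c :: real and t i
  obtain P' where P': "\<And>t i. 0 \<le> t \<Longrightarrow> i \<in> ?U \<Longrightarrow> ((\<lambda>t. P t i) has_vector_derivative P' t i) (at t within {0..})"
    by (rule smooth_motionE[OF P]) blast
  have L': "((\<lambda>t. L c t i) has_vector_derivative (0, P' t i)) (at t within {0..})" if "0 \<le> t" "i \<in> ?U" for c t i
    unfolding L_def by (intro has_vector_derivative_Pair has_vector_derivative_const P' that)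
  have fin: "finite F" if "F \<subseteq> ?U" for F using that finite_subset by blast
  have sum_L: "(\<Sum>i\<in>S. x i *\<^sub>R L c t i) = (c * (\<Sum>i\<in>S. x i), \<Sum>i\<in>S. x i *\<^sub>R P t i)" for S x c t
    by (simp add: prod_eq_iff L_def fst_sum snd_sum sum_distrib_left mult.commute)
  have "linearly_nondegenerate_faces CARD('n) (L 1 0)"
    unfolding linearly_nondegenerate_faces_def
  proof
    fix F assume F: "F \<in> faces CARD('n) CARD('n)"
    then have FU: "F \<subseteq> ?U" by (auto simp: faces_def)
    have A: "inj_on A F" "\<not> affine_dependent (A ` F)"
      using nd F by (auto simp: affinely_nondegenerate_faces_def)
    have "independent_family F (L 1 0)"
      unfolding independent_family_def
    proof (intro allI impI ballI)
      fix x i assume x: "(\<Sum>i\<in>F. x i *\<^sub>R L 1 0 i) = 0" and i: "i \<in> F"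
      have "(\<Sum>i\<in>F. x i *\<^sub>R P 0 i) = (\<Sum>i\<in>F. x i *\<^sub>R A i)"
        by (rule sum.cong[OF refl]) (use smooth_motion_start[OF P] FU in auto)
      then have s: "(\<Sum>i\<in>F. x i) = 0" "(\<Sum>i\<in>F. x i *\<^sub>R A i) = 0"
        using x unfolding sum_L by (simp_all add: prod_eq_iff)
      let ?u = "\<lambda>v. x (inv_into F A v)"
      have "sum ?u (A ` F) = 0" "(\<Sum>v\<in>A ` F. ?u v *\<^sub>R v) = 0"
        using s A(1) by (simp_all add: sum.reindex)
      then have "\<forall>v\<in>A ` F. ?u v = 0"
        using A(2) unfolding affine_dependent_explicit_finite[OF finite_imageI[OF fin[OF FU]]] by blast
      then show "x i = 0" using i A(1) by auto
    qed
    then show "inj_on (L 1 0) F \<and> independent (L 1 0 ` F)" using independent_family_iff[OF fin[OF FU]] by blast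
  qed
  then have D0: "0 < 1 * euclid.gram_det E (L 1 0)" if "E \<subseteq> ?U" "E \<noteq> {}" "card E \<le> CARD('n) + 1" for E
    using gram_det_pos[OF fin[OF that(1)] independent_subfamily[OF _ that(1,3)]] by simp
  have "(\<Sum>i\<in>?U. \<alpha> i *\<^sub>R P 0 i) = (\<Sum>i\<in>?U. \<alpha> i *\<^sub>R A i)"
    by (rule sum.cong[OF refl]) (simp only: smooth_motion_start[OF P])
  then have st1: "linear_stress CARD('n) \<alpha> (L 1 0)"
    using st unfolding affine_stress_def linear_stress_def sum_L by (simp add: zero_prod_def)
  have "\<exists>\<epsilon>>0. \<forall>t. 0 \<le> t \<and> t < \<epsilon> \<longrightarrow>
      (\<forall>E. E \<subseteq> {1..CARD('n) + 2} \<and> E \<noteq> {} \<and> card E \<le> CARD('n) + 1 \<longrightarrow> 0 < 1 * euclid.gram_det E (L 1 t)) \<and>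
      (\<exists>a. (\<Sum>i\<in>?U. a i *\<^sub>R L 1 t i) = 0 \<and> (\<forall>i\<in>?U. 0 < a i * \<alpha> i))" (is "\<exists>\<epsilon>>0. ?near \<epsilon>")
    by (rule nondegenerate_initially[where B="L 1" and \<sigma>=1 and \<alpha>=\<alpha>, OF _ _ st1])
      (rule has_vector_derivative_imp_tendsto[OF L'[OF order_refl]] D0; assumption)+
  then obtain \<epsilon> where \<epsilon>0: "0 < \<epsilon>" and near: "?near \<epsilon>" by blast
  have near_det: "0 < 1 * euclid.gram_det E (L 1 t)"
    if "0 \<le> t" "t < \<epsilon>" "E \<subseteq> {1..CARD('n) + 2}" "E \<noteq> {}" "card E \<le> CARD('n) + 1" for t E
    using near that by blast
  have near_stress: "\<exists>a. (\<Sum>i\<in>?U. a i *\<^sub>R L 1 t i) = 0 \<and> (\<forall>i\<in>?U. 0 < a i * \<alpha> i)" if "0 \<le> t" "t < \<epsilon>" for t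
    using near that by blast
  note \<epsilon> = \<epsilon>0 near_det near_stress
  have "\<forall>t\<in>{0..<\<epsilon>}. \<exists>a. (\<Sum>i\<in>?U. a i *\<^sub>R L 1 t i) = 0 \<and> (\<forall>i\<in>?U. 0 < a i * \<alpha> i)"
    by (intro ballI near_stress) simp_all
  from bchoice[OF this] obtain a where
    a': "\<forall>t\<in>{0..<\<epsilon>}. (\<Sum>i\<in>?U. a t i *\<^sub>R L 1 t i) = 0 \<and> (\<forall>i\<in>?U. 0 < a t i * \<alpha> i)"
    by (elim exE)
  have a: "(\<Sum>i\<in>?U. a t i *\<^sub>R L 1 t i) = 0" "\<And>i. i \<in> ?U \<Longrightarrow> 0 < a t i * \<alpha> i" if "0 \<le> t" "t < \<epsilon>" for t
    using bspec[OF a', of t] that by (simp_all del: atLeastAtMost_iff)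
  \<comment> \<open>A relation at height 1 contains both the vanishing of the sum of the
    coefficients and the relation among the points, hence a relation at every height.\<close>
  have aL: "(\<Sum>i\<in>?U. a t i *\<^sub>R L c t i) = 0" if "0 \<le> t" "t < \<epsilon>" for c t
    using a(1)[OF that] unfolding sum_L by (simp add: prod_eq_iff)
  \<comment> \<open>A nonzero height can be rescaled without affecting independence, so
    nondegeneracy passes from height 1 to height 2.\<close>
  have DL: "euclid.gram_det E (L c t) \<noteq> 0"
    if "0 \<le> t" "t < \<epsilon>" "E \<subseteq> ?U" "card E = k" "c \<noteq> 0" for c t E
  proof -
    have "euclid.gram_det E (L 1 t) \<noteq> 0" using \<epsilon>(2)[OF that(1,2,3)] that(4) k by force
    then have "independent_family E (L 1 t)"
      by (rule euclid.gram_det_nonzero_imp_independent[OF fin[OF that(3)]])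
    then have "independent_family E (L c t)"
      using that(5) unfolding independent_family_def sum_L by (simp add: zero_prod_def)
    then show ?thesis using gram_det_pos[OF fin[OF that(3)]] by force
  qed
  have faces: "faces CARD('n) k = {F. F \<subseteq> ?U \<and> card F = Suc k}" by (auto simp: faces_def)
  have F: "finite F" "F \<subseteq> ?U" "card F = k + 1" if "F \<in> faces CARD('n) k" for F
    using that fin by (auto simp: faces)
  define g where "g t F = euclid.gram_det {..<k} (\<lambda>i. face_vertices (P t) F (Suc i) - face_vertices (P t) F 0)" for t F
  define \<mu> where "\<mu> = (LINT x:std_simplex k|Pi\<^sub>M {..<k} (\<lambda>_. lborel :: real measure). (1::real))"
  have vol_eq: "vol t F = sqrt (g t F) * \<mu>" for t F
    unfolding vol g_def \<mu>_def by (rule euclidean_simplex_volume_eq)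
  have lift: "euclid.gram_det F (L c t) = c\<^sup>2 * g t F + euclid.gram_det F (P t)"
    if "F \<in> faces CARD('n) k" for c t F
  proof -
    let ?u = "face_vertices (P t) F \<circ> base_last k"
    have "euclid.gram_det F (L c t) = euclid.gram_det {..k} (\<lambda>i. (c, ?u i))"
      unfolding euclid.gram_det_face[OF F(1,3)[OF that]]
      by (rule euclid.gram_det_cong) (simp add: L_def face_vertices_def)
    also have "\<dots> = c\<^sup>2 * euclid.gram_det {..<k} (\<lambda>i. ?u i - ?u k) + euclid.gram_det {..k} ?u"
      by (rule gram_det_lift)
    also have "euclid.gram_det {..k} ?u = euclid.gram_det F (P t)"
      by (rule euclid.gram_det_face[OF F(1,3)[OF that], symmetric])
    also have "euclid.gram_det {..<k} (\<lambda>i. ?u i - ?u k) = g t F"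
      unfolding g_def by (rule euclid.gram_det_cong) (simp add: base_last_def)
    finally show ?thesis .
  qed
  \<comment> \<open>The term without c cancels in the difference, and 3 is 2^2 - 1^2.\<close>
  have g_eq: "g t F = (euclid.gram_det F (L 2 t) - euclid.gram_det F (L 1 t)) / 3" if "F \<in> faces CARD('n) k" for t F
    unfolding lift[OF that] by simp
  have g_pos: "0 < g t F" if t: "0 \<le> t" "t < \<epsilon>" and Fk: "F \<in> faces CARD('n) k" for t F
  proof -
    let ?u = "face_vertices (P t) F \<circ> base_last k"
    have "euclid.gram_det F (L 1 t) \<noteq> 0" using \<epsilon>(2)[OF t F(2)[OF Fk]] F(3)[OF Fk] k by force
    moreover have "euclid.gram_det F (L 1 t) = euclid.gram_det {..k} (\<lambda>i. (1::real, ?u i))"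
      unfolding euclid.gram_det_face[OF F(1,3)[OF Fk]]
      by (rule euclid.gram_det_cong) (simp add: L_def face_vertices_def)
    ultimately have "independent_family {..k} (\<lambda>i. (1::real, ?u i))"
      by (intro euclid.gram_det_nonzero_imp_independent) auto
    then have "0 < euclid.gram_det {..<k} (\<lambda>i. ?u i - ?u k)"
      by (intro gram_det_pos independent_differences) auto
    also have "euclid.gram_det {..<k} (\<lambda>i. ?u i - ?u k) = g t F"
      unfolding g_def by (rule euclid.gram_det_cong) (simp add: base_last_def)
    finally show ?thesis .
  qed
  \<comment> \<open>The lifted velocities have height 0, so these products are the same for every c;
    the height enters only through the cofactors.\<close>
  define C where "C t l m = P t l \<bullet> P' t m" for t l m
  define K where "K c t F = gcof F (euclid.gram (L c t))" for c t F
  define T where "T c t F = (\<Sum>i\<in>F. \<Sum>l\<in>F. K c t F i l * C t l i)" for c t F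
  define Y where "Y c t F = (\<Sum>i\<in>F. \<Sum>m\<in>F - {i}. (\<Sum>l\<in>F. K c t F i l * C t l m) * 1)" for c t F
  define v where "v t F = inverse (sqrt (g t F)) / 2 * ((2 * T 2 t F - 2 * T 1 t F) / 3) * \<mu>" for t F
  define w where "w t F = (\<Prod>s\<in>F. a t s) * sqrt (g t F)" for t F
  have dD: "((\<lambda>t. euclid.gram_det F (L c t)) has_real_derivative 2 * T c t F) (at t within {0..})"
    if t: "0 \<le> t" and Fk: "F \<in> faces CARD('n) k" for c t F
  proof -
    have "((\<lambda>t. euclid.gram_det F (L c t)) has_real_derivative
        2 * (\<Sum>i\<in>F. \<Sum>l\<in>F. gcof F (euclid.gram (L c t)) i l * (L c t l \<bullet> (0, P' t i)))) (at t within {0..})"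
      by (rule euclid.has_real_derivative_gram_det[OF F(1)[OF Fk]]) (use L' t F(2)[OF Fk] in blast)
    then show ?thesis by (simp add: T_def K_def C_def L_def)
  qed
  have TY: "T 2 t F - T 1 t F = Y 1 t F - Y 2 t F" if "F \<in> faces CARD('n) k" for t F
  proof -
    have "(\<Sum>i\<in>F. K 2 t F i l) = (\<Sum>i\<in>F. K 1 t F i l)" if "l \<in> F" for l
      using gcof_column_sum_lift[OF F(1)[OF \<open>F \<in> faces CARD('n) k\<close>] that, of _ "P t"]
      unfolding K_def L_def[abs_def] by simp
    then have "(\<Sum>l\<in>F. (\<Sum>i\<in>F. K 2 t F i l) * (\<Sum>m\<in>F. C t l m)) = (\<Sum>l\<in>F. (\<Sum>i\<in>F. K 1 t F i l) * (\<Sum>m\<in>F. C t l m))"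
      by simp
    then show ?thesis
      unfolding T_def Y_def trace_split[OF F(1)[OF that]] by simp
  qed
  have Y0: "(\<Sum>F\<in>faces CARD('n) k. (\<Prod>s\<in>F. a t s) * Y c t F) = 0"
    if t: "0 \<le> t" "t < \<epsilon>" and c: "c \<noteq> 0" for c t
    unfolding faces Y_def K_def
  proof (rule euclid.stress_boundary_sum[where R="\<lambda>_ _. 1"])
    show "(\<Sum>i\<in>?U. a t i *\<^sub>R L c t i) = 0" by (rule aL[OF t])
    show "euclid.gram_det E (L c t) \<noteq> 0" if "E \<subseteq> ?U" "card E = k" for E
      using DL[OF t that c] .
    have "(\<Sum>l\<in>?U. a t l *\<^sub>R P t l) = 0"
      using a(1)[OF t] unfolding sum_L by (simp add: prod_eq_iff)
    moreover have "(\<Sum>l\<in>?U. a t l * C t l m) = (\<Sum>l\<in>?U. a t l *\<^sub>R P t l) \<bullet> P' t m" for m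
      by (simp only: C_def inner_sum_left inner_scaleR_left)
    ultimately show "(\<Sum>l\<in>?U. a t l * C t l m) = 0" for m by simp
  qed simp
  show ?thesis
  proof (rule constraints_imp_preserved[OF \<epsilon>(1), where v=v and w=w])
    fix t F assume t: "0 \<le> t" "t < \<epsilon>" and Fk: "F \<in> faces CARD('n) k"
    have "((\<lambda>t. (euclid.gram_det F (L 2 t) - euclid.gram_det F (L 1 t)) / 3) has_real_derivative
        (2 * T 2 t F - 2 * T 1 t F) / 3) (at t within {0..})"
      by (intro DERIV_cdivide DERIV_diff dD t(1) Fk)
    then have dg: "((\<lambda>t. g t F) has_real_derivative (2 * T 2 t F - 2 * T 1 t F) / 3) (at t within {0..})"
      unfolding g_eq[OF Fk] .
    have "(sqrt has_real_derivative inverse (sqrt (g t F)) / 2) (at (g t F))"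
      by (rule DERIV_real_sqrt[OF g_pos[OF t Fk]])
    from DERIV_cmult_right[OF DERIV_chain2[OF this dg]]
    show "((\<lambda>t. vol t F) has_real_derivative v t F) (at t within {0..})"
      unfolding vol_eq v_def .
    have "w t F * (\<Prod>s\<in>F. \<alpha> s) = (\<Prod>s\<in>F. a t s * \<alpha> s) * sqrt (g t F)"
      by (simp add: w_def prod.distrib)
    also have "\<dots> > 0"
    proof (rule mult_pos_pos)
      show "0 < (\<Prod>s\<in>F. a t s * \<alpha> s)"
        by (rule prod_pos) (use a(2)[OF t] F(2)[OF Fk] in blast)
      show "0 < sqrt (g t F)" using g_pos[OF t Fk] by simp
    qed
    finally show "0 < w t F * (\<Prod>s\<in>F. \<alpha> s)" .
  next
    fix t assume t: "0 \<le> t" "t < \<epsilon>"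
    have "(\<Sum>F\<in>faces CARD('n) k. w t F * v t F) =
        (\<Sum>F\<in>faces CARD('n) k. \<mu> / 3 * ((\<Prod>s\<in>F. a t s) * Y 1 t F - (\<Prod>s\<in>F. a t s) * Y 2 t F))"
    proof (rule sum.cong[OF refl])
      fix F assume Fk: "F \<in> faces CARD('n) k"
      have "sqrt (g t F) * inverse (sqrt (g t F)) = 1" using g_pos[OF t Fk] by simp
      moreover have "w t F * v t F = (\<Prod>s\<in>F. a t s) * (sqrt (g t F) * inverse (sqrt (g t F))) *
          ((T 2 t F - T 1 t F) * (\<mu> / 3))"
        unfolding w_def v_def by (simp add: field_simps)
      ultimately show "w t F * v t F = \<mu> / 3 * ((\<Prod>s\<in>F. a t s) * Y 1 t F - (\<Prod>s\<in>F. a t s) * Y 2 t F)"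
        unfolding TY[OF Fk] by (simp add: algebra_simps)
    qed
    also have "\<dots> = \<mu> / 3 * ((\<Sum>F\<in>faces CARD('n) k. (\<Prod>s\<in>F. a t s) * Y 1 t F) -
        (\<Sum>F\<in>faces CARD('n) k. (\<Prod>s\<in>F. a t s) * Y 2 t F))"
      by (simp only: sum_distrib_left sum_subtractf right_diff_distrib)
    also have "\<dots> = 0" using Y0[OF t] by simp
    finally show "(\<Sum>F\<in>faces CARD('n) k. w t F * v t F) = 0" .
  qed (rule G)
qed

theorem theorem1p3:
  fixes k :: nat
  assumes "1 \<le> k" and "k \<le> CARD('n::finite)"
  shows
    "(\<forall>(A :: nat \<Rightarrow> real ^ 'n) \<alpha> P vol.
        affinely_nondegenerate_faces CARD('n) A \<and>
        affine_stress CARD('n) \<alpha> A \<and>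
        smooth_motion CARD('n) UNIV A P \<and>
        vol = (\<lambda>t F. euclidean_simplex_volume k (face_vertices (P t) F)) \<and>
        (G_constraints CARD('n) k \<alpha> vol \<or> G'_constraints CARD('n) k \<alpha> vol)
        \<longrightarrow> preserves_volumes_initially CARD('n) k vol)
   \<and> (\<forall>(A :: nat \<Rightarrow> real \<times> (real ^ 'n)) \<alpha> P vol.
        (\<forall>i \<in> {1..CARD('n) + 2}. A i \<in> sphere 0 1) \<and>
        linearly_nondegenerate_faces CARD('n) A \<and>
        linear_stress CARD('n) \<alpha> A \<and>
        smooth_motion CARD('n) (sphere 0 1) A P \<and>
        vol = (\<lambda>t F. spherical_simplex_volume k (face_vertices (P t) F)) \<and>
        (G_constraints CARD('n) k \<alpha> vol \<or> G'_constraints CARD('n) k \<alpha> vol)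
        \<longrightarrow> preserves_volumes_initially CARD('n) k vol)
   \<and> (\<forall>(A :: nat \<Rightarrow> real \<times> (real ^ 'n)) \<alpha> P vol.
        (\<forall>i \<in> {1..CARD('n) + 2}. A i \<in> hyperbolic_space) \<and>
        linearly_nondegenerate_faces CARD('n) A \<and>
        linear_stress CARD('n) \<alpha> A \<and>
        smooth_motion CARD('n) hyperbolic_space A P \<and>
        vol = (\<lambda>t F. hyperbolic_simplex_volume k (face_vertices (P t) F)) \<and>
        (G_constraints CARD('n) k \<alpha> vol \<or> G'_constraints CARD('n) k \<alpha> vol)
        \<longrightarrow> preserves_volumes_initially CARD('n) k vol)"
  using euclidean_rigidity[OF assms] spherical_rigidity[OF assms] hyperbolic_rigidity[OF assms]
  by blast


end
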